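(* Let $m,n\ge 0$ be integers with $n\mid m/\gcd(2,m)$, and let $(A,B;D)$ be an amalgam of groups in the variety $(m,n)$. The amalgam is strongly embeddable in $(m,n)$ if and only if the following two conditions are satisfied: (a) $D\cap A^nA'\subseteq Z(B)$ and $D\cap B^nB'\subseteq Z(A)$. (b) For every integer $q>0$ with $q\mid n$, and all $a\in A$, $a'\in A^nA'$, $b\in B$, $b'\in B^nB'$ with $a^qa'\in D$ and $b^qb'\in D$, we have $[a^qa',b]=[a,b^qb']\in D$ (that is, the commutator $[a^qa',b]$ computed in $B$ and the commutator $[a,b^qb']$ computed in $A$ both lie in $D$ and are the same element of $D$).
   Context: Commutators are $[x,y]=x^{-1}y^{-1}xy$ and $[x,y,z]=[[x,y],z]$; $G'=[G,G]$; $Z(G)$ is the center. For $k>0$, $G^k$ is the subgroup generated by all $k$-th powers of elements of $G$, and $G^0=\{e\}$. Every integer divides $0$, and $0$ divides only $0$. For nonnegative integers $m,n$ with $n\mid m/\gcd(2,m)$, $(m,n)$ denotes the variety (class) of all groups satisfying the identities $x^m=[x_1,x_2]^n=[x_1,x_2,x_3]=e$. In particular $(0,0)=\mathcal N_2$ is the variety of all nilpotent groups of class at most two. An amalgam $(A,B;D)$ of groups in a class $\mathcal C$ consists of groups $A,B,D\in\mathcal C$ together with injective homomorphisms $D\to A$ and $D\to B$; $D$ is identified with its images, so it is regarded as a subgroup of both $A$ and $B$. It is weakly embeddable in $\mathcal C$ if there are $M\in\mathcal C$ and injective homomorphisms $\lambda_A\colon A\to M$, $\lambda_B\colon B\to M$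 which agree on $D$; it is strongly embeddable in $\mathcal C$ if they can be chosen so that moreover $\lambda_A(A)\cap\lambda_B(B)=\lambda_A(D)$. *)

theory Defs
  imports "HOL-Algebra.Generated_Groups"
begin

definition commutator :: "('a, 'x) monoid_scheme \<Rightarrow> 'a \<Rightarrow> 'a \<Rightarrow> 'a" where
  "commutator G x y = inv\<^bsub>G\<^esub> x \<otimes>\<^bsub>G\<^esub> inv\<^bsub>G\<^esub> y \<otimes>\<^bsub>G\<^esub> x \<otimes>\<^bsub>G\<^esub> y"

definition center :: "('a, 'x) monoid_scheme \<Rightarrow> 'a set" where
  "center G = {z \<in> carrier G. \<forall>x \<in> carrier G. z \<otimes>\<^bsub>G\<^esub> x = x \<otimes>\<^bsub>G\<^esub> z}"

definition power_subgroup :: "('a, 'x) monoid_scheme \<Rightarrow> nat \<Rightarrow> 'a set" where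
  "power_subgroup G k =
     (if k = 0 then {\<one>\<^bsub>G\<^esub>} else generate G ((\<lambda>x. x [^]\<^bsub>G\<^esub> k) ` carrier G))"

(* The subset G^k G'. The library's derived subgroup is generated by the elements
   x y x^-1 y^-1 = [x^-1, y^-1], hence is the usual G'. *)
definition power_derived :: "('a, 'x) monoid_scheme \<Rightarrow> nat \<Rightarrow> 'a set" where
  "power_derived G k = power_subgroup G k <#>\<^bsub>G\<^esub> derived G (carrier G)"

definition in_variety :: "nat \<Rightarrow> nat \<Rightarrow> ('a, 'x) monoid_scheme \<Rightarrow> bool" where
  "in_variety m n G \<longleftrightarrow> group G \<and>
     (\<forall>x \<in> carrier G. x [^]\<^bsub>G\<^esub> m = \<one>\<^bsub>G\<^esub>) \<and>
     (\<forall>x \<in> carrier G. \<forall>y \<in> carrier G. commutator G x y [^]\<^bsub>G\<^esub> n = \<one>\<^bsub>G\<^esub>) \<and>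
     (\<forall>x \<in> carrier G. \<forall>y \<in> carrier G. \<forall>z \<in> carrier G.
        commutator G (commutator G x y) z = \<one>\<^bsub>G\<^esub>)"

definition amalgam ::
  "nat \<Rightarrow> nat \<Rightarrow> ('a, 'x) monoid_scheme \<Rightarrow> ('b, 'y) monoid_scheme \<Rightarrow> ('d, 'z) monoid_scheme \<Rightarrow>
   ('d \<Rightarrow> 'a) \<Rightarrow> ('d \<Rightarrow> 'b) \<Rightarrow> bool" where
  "amalgam m n A B D \<iota>\<^sub>A \<iota>\<^sub>B \<longleftrightarrow>
     in_variety m n A \<and> in_variety m n B \<and> in_variety m n D \<and>
     \<iota>\<^sub>A \<in> mon D A \<and> \<iota>\<^sub>B \<in> mon D B"

definition strong_embedding ::
  "nat \<Rightarrow> nat \<Rightarrow> ('a, 'x) monoid_scheme \<Rightarrow> ('b, 'y) monoid_scheme \<Rightarrow> ('d, 'z) monoid_scheme \<Rightarrow>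
   ('d \<Rightarrow> 'a) \<Rightarrow> ('d \<Rightarrow> 'b) \<Rightarrow> ('c, 'w) monoid_scheme \<Rightarrow> ('a \<Rightarrow> 'c) \<Rightarrow> ('b \<Rightarrow> 'c) \<Rightarrow> bool" where
  "strong_embedding m n A B D \<iota>\<^sub>A \<iota>\<^sub>B M \<phi>\<^sub>A \<phi>\<^sub>B \<longleftrightarrow>
     in_variety m n M \<and> \<phi>\<^sub>A \<in> mon A M \<and> \<phi>\<^sub>B \<in> mon B M \<and>
     (\<forall>d \<in> carrier D. \<phi>\<^sub>A (\<iota>\<^sub>A d) = \<phi>\<^sub>B (\<iota>\<^sub>B d)) \<and>
     \<phi>\<^sub>A ` carrier A \<inter> \<phi>\<^sub>B ` carrier B = \<phi>\<^sub>A ` \<iota>\<^sub>A ` carrier D"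

(* HOL cannot quantify existentially over the type of M. Words in A and B name every element
   of the subgroup of M generated by the images of A and B, so the type of words is large
   enough; lemma strongly_embeddableI shows that an embedding into a group in the variety over
   any type whatsoever gives one over this type. *)
definition strongly_embeddable ::
  "nat \<Rightarrow> nat \<Rightarrow> ('a, 'x) monoid_scheme \<Rightarrow> ('b, 'y) monoid_scheme \<Rightarrow> ('d, 'z) monoid_scheme \<Rightarrow>
   ('d \<Rightarrow> 'a) \<Rightarrow> ('d \<Rightarrow> 'b) \<Rightarrow> bool" where
  "strongly_embeddable m n A B D \<iota>\<^sub>A \<iota>\<^sub>B \<longleftrightarrow>
     (\<exists>(M :: ('a + 'b) list monoid) \<phi>\<^sub>A \<phi>\<^sub>B. strong_embedding m n A B D \<iota>\<^sub>A \<iota>\<^sub>B M \<phi>\<^sub>A \<phi>\<^sub>B)"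

lemma in_variety_pullback:
  fixes G :: "('a, 'x) monoid_scheme" and H :: "('b, 'y) monoid_scheme"
  assumes G: "group G" and h: "h \<in> mon G H" and H: "in_variety m n H"
  shows "in_variety m n G"
proof -
  interpret G: group G by (rule G)
  interpret H: group H using H by (simp add: in_variety_def)
  have hom: "h \<in> hom G H" and inj: "inj_on h (carrier G)" using h by (auto simp: mon_def)
  interpret group_hom G H h
    using hom by (simp add: group_hom_def group_hom_axioms_def G.is_group H.is_group)
  have c: "commutator G x y \<in> carrier G" if "x \<in> carrier G" "y \<in> carrier G" for x y
    using that by (simp add: commutator_def)
  have hc: "h (commutator G x y) = commutator H (h x) (h y)"
    if "x \<in> carrier G" "y \<in> carrier G" for x y
    using that by (simp add: commutator_def)
  have one: "u = \<one>\<^bsub>G\<^esub>" if "u \<in> carrier G" "h u = \<one>\<^bsub>H\<^esub>" for u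
    using inj_onD[OF inj, of u "\<one>\<^bsub>G\<^esub>"] that by simp
  show ?thesis
    unfolding in_variety_def
  proof (intro conjI ballI)
    show "group G" by (rule G)
  next
    fix x assume "x \<in> carrier G"
    then show "x [^]\<^bsub>G\<^esub> m = \<one>\<^bsub>G\<^esub>"
      using H by (intro one) (auto simp: hom_nat_pow in_variety_def)
  next
    fix x y assume "x \<in> carrier G" "y \<in> carrier G"
    then show "commutator G x y [^]\<^bsub>G\<^esub> n = \<one>\<^bsub>G\<^esub>"
      using H by (intro one) (auto simp: hom_nat_pow in_variety_def c hc)
  next
    fix x y z assume "x \<in> carrier G" "y \<in> carrier G" "z \<in> carrier G"
    then show "commutator G (commutator G x y) z = \<one>\<^bsub>G\<^esub>"
      using H by (intro one) (auto simp: in_variety_def c hc)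
  qed
qed

lemma strongly_embeddableI:
  fixes A :: "('a, 'x) monoid_scheme" and B :: "('b, 'y) monoid_scheme"
    and D :: "('d, 'z) monoid_scheme" and M :: "('c, 'w) monoid_scheme"
  assumes am: "amalgam m n A B D \<iota>\<^sub>A \<iota>\<^sub>B"
    and emb: "strong_embedding m n A B D \<iota>\<^sub>A \<iota>\<^sub>B M \<phi>\<^sub>A \<phi>\<^sub>B"
  shows "strongly_embeddable m n A B D \<iota>\<^sub>A \<iota>\<^sub>B"
proof -
  have var: "in_variety m n M" and lA: "\<phi>\<^sub>A \<in> mon A M" and lB: "\<phi>\<^sub>B \<in> mon B M"
    and agree: "\<And>d. d \<in> carrier D \<Longrightarrow> \<phi>\<^sub>A (\<iota>\<^sub>A d) = \<phi>\<^sub>B (\<iota>\<^sub>B d)"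
    and int: "\<phi>\<^sub>A ` carrier A \<inter> \<phi>\<^sub>B ` carrier B = \<phi>\<^sub>A ` \<iota>\<^sub>A ` carrier D"
    using emb by (auto simp: strong_embedding_def)
  have iA: "\<iota>\<^sub>A d \<in> carrier A" if "d \<in> carrier D" for d
    using that am by (auto simp: amalgam_def mon_def hom_def)
  have grA: "group A" and grB: "group B"
    using am by (auto simp: amalgam_def in_variety_def)
  interpret M: group M using var by (simp add: in_variety_def)
  interpret A: group_hom A M \<phi>\<^sub>A
    using grA lA M.is_group by (auto simp: group_hom_def group_hom_axioms_def mon_def)
  interpret B: group_hom B M \<phi>\<^sub>B
    using grB lB M.is_group by (auto simp: group_hom_def group_hom_axioms_def mon_def)
  define W where "W = lists (carrier A <+> carrier B)"
  define s where "s = (\<lambda>u. case u of Inl a \<Rightarrow> \<phi>\<^sub>A a | Inr b \<Rightarrow> \<phi>\<^sub>B b)"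
  define f where "f = (\<lambda>w. foldr (\<lambda>u x. s u \<otimes>\<^bsub>M\<^esub> x) w \<one>\<^bsub>M\<^esub>)"
  have s: "s u \<in> carrier M" if "u \<in> carrier A <+> carrier B" for u
    using that by (auto simp: s_def)
  have f: "f w \<in> carrier M" if "w \<in> W" for w
    using that unfolding W_def by (induction w) (auto simp: f_def s)
  have fapp: "f (v @ w) = f v \<otimes>\<^bsub>M\<^esub> f w" if "v \<in> W" "w \<in> W" for v w
    using that(1) unfolding W_def
  proof (induction v)
    case Nil
    then show ?case using f[OF that(2)] by (simp add: f_def)
  next
    case (Cons u v)
    have e: "f (u # x) = s u \<otimes>\<^bsub>M\<^esub> f x" for x by (simp add: f_def)
    from Cons show ?case using s[of u] f[of v] f[OF that(2)]
      by (simp add: e M.m_assoc W_def)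
  qed
  have finv: "\<exists>v\<in>W. f v = inv\<^bsub>M\<^esub> f w" if "w \<in> W" for w
    using that unfolding W_def
  proof (induction w)
    case Nil
    show ?case by (rule bexI[of _ "[]"]) (auto simp: f_def)
  next
    case (Cons u w)
    then obtain v where v: "v \<in> W" "f v = inv\<^bsub>M\<^esub> f w" by (auto simp: W_def)
    obtain u' where u': "u' \<in> carrier A <+> carrier B" "s u' = inv\<^bsub>M\<^esub> s u"
    proof (cases u)
      case (Inl a)
      then have "a \<in> carrier A" using Cons by auto
      then show thesis using that[of "Inl (inv\<^bsub>A\<^esub> a)"] Inl by (auto simp: s_def)
    next
      case (Inr b)
      then have "b \<in> carrier B" using Cons by auto
      then show thesis using that[of "Inr (inv\<^bsub>B\<^esub> b)"] Inr by (auto simp: s_def)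
    qed
    have u'W: "[u'] \<in> W" using u' by (auto simp: W_def)
    have uw: "u \<in> carrier A <+> carrier B" "w \<in> W" using Cons by (auto simp: W_def)
    have "f (v @ [u']) = inv\<^bsub>M\<^esub> f w \<otimes>\<^bsub>M\<^esub> inv\<^bsub>M\<^esub> s u"
      using fapp[OF v(1) u'W] v u' s[OF u'(1)] s[OF uw(1)] by (simp add: f_def)
    also have "\<dots> = inv\<^bsub>M\<^esub> f (u # w)"
      using M.inv_mult_group[OF s[OF uw(1)] f[OF uw(2)]] by (simp add: f_def)
    finally show ?case using v(1) u'W by (intro bexI[of _ "v @ [u']"]) (auto simp: W_def)
  qed
  define H where "H = f ` W"
  have "subgroup H M"
  proof
    show "H \<subseteq> carrier M" using f by (auto simp: H_def)
    show "\<one>\<^bsub>M\<^esub> \<in> H" unfolding H_def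
      by (rule image_eqI[of _ _ "[]"]) (auto simp: f_def W_def)
  next
    fix x y assume "x \<in> H" "y \<in> H"
    then obtain v w where "v \<in> W" "w \<in> W" "x = f v" "y = f w" by (auto simp: H_def)
    then show "x \<otimes>\<^bsub>M\<^esub> y \<in> H" unfolding H_def
      by (intro image_eqI[of _ _ "v @ w"]) (auto simp: fapp W_def)
  next
    fix x assume "x \<in> H"
    then obtain w where w: "w \<in> W" "x = f w" by (auto simp: H_def)
    from finv[OF w(1)] obtain v where "v \<in> W" "f v = inv\<^bsub>M\<^esub> x" using w(2) by auto
    then show "inv\<^bsub>M\<^esub> x \<in> H" unfolding H_def by (metis imageI)
  qed
  define g where "g = inv_into W f"
  have fg: "f (g x) = x" if "x \<in> H" for x
    using that by (simp add: g_def H_def f_inv_into_f)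
  have ginj: "inj_on g H" by (rule inj_on_inverseI[of H f g]) (rule fg)
  define N :: "('a + 'b) list monoid" where
    "N = \<lparr>carrier = g ` H, mult = (\<lambda>x y. g (f x \<otimes>\<^bsub>M\<^esub> f y)), one = g \<one>\<^bsub>M\<^esub>\<rparr>"
  note sub = \<open>subgroup H M\<close>
  note HM = subgroup.mem_carrier[OF sub]
  have N: "group N"
  proof (rule groupI)
    fix x y assume "x \<in> carrier N" "y \<in> carrier N"
    then show "x \<otimes>\<^bsub>N\<^esub> y \<in> carrier N"
      by (auto simp: N_def fg subgroup.m_closed[OF sub])
  next
    show "\<one>\<^bsub>N\<^esub> \<in> carrier N" by (simp add: N_def subgroup.one_closed[OF sub])
  next
    fix x y z assume "x \<in> carrier N" "y \<in> carrier N" "z \<in> carrier N"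
    then show "x \<otimes>\<^bsub>N\<^esub> y \<otimes>\<^bsub>N\<^esub> z = x \<otimes>\<^bsub>N\<^esub> (y \<otimes>\<^bsub>N\<^esub> z)"
      by (auto simp: N_def fg subgroup.m_closed[OF sub] HM M.m_assoc)
  next
    fix x assume "x \<in> carrier N"
    then show "\<one>\<^bsub>N\<^esub> \<otimes>\<^bsub>N\<^esub> x = x"
      by (auto simp: N_def fg subgroup.one_closed[OF sub] HM)
  next
    fix x assume "x \<in> carrier N"
    then obtain h where h: "h \<in> H" "x = g h" by (auto simp: N_def)
    then show "\<exists>y\<in>carrier N. y \<otimes>\<^bsub>N\<^esub> x = \<one>\<^bsub>N\<^esub>"
      by (intro bexI[of _ "g (inv\<^bsub>M\<^esub> h)"])
        (auto simp: N_def fg subgroup.m_inv_closed[OF sub] HM)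
  qed
  have fmon: "f \<in> mon N M"
    by (auto simp: mon_def hom_def N_def fg subgroup.m_closed[OF sub] HM inj_on_def)
  have AH: "\<phi>\<^sub>A a \<in> H" if "a \<in> carrier A" for a
    unfolding H_def using that
    by (intro image_eqI[of _ _ "[Inl a]"]) (auto simp: f_def s_def W_def)
  have BH: "\<phi>\<^sub>B b \<in> H" if "b \<in> carrier B" for b
    unfolding H_def using that
    by (intro image_eqI[of _ _ "[Inr b]"]) (auto simp: f_def s_def W_def)
  have gA: "g \<circ> \<phi>\<^sub>A \<in> mon A N"
    using lA ginj by (auto simp: mon_def hom_def N_def AH fg inj_on_def)
  have gB: "g \<circ> \<phi>\<^sub>B \<in> mon B N"
    using lB ginj by (auto simp: mon_def hom_def N_def BH fg inj_on_def)
  have "(g \<circ> \<phi>\<^sub>A) ` carrier A \<inter> (g \<circ> \<phi>\<^sub>B) ` carrier B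
      = g ` (\<phi>\<^sub>A ` carrier A \<inter> \<phi>\<^sub>B ` carrier B)"
    using inj_on_image_Int[OF ginj, of "\<phi>\<^sub>A ` carrier A" "\<phi>\<^sub>B ` carrier B"] AH BH
    by (auto simp: image_comp)
  also have "\<dots> = (g \<circ> \<phi>\<^sub>A) ` \<iota>\<^sub>A ` carrier D" by (simp add: int image_comp)
  finally have "strong_embedding m n A B D \<iota>\<^sub>A \<iota>\<^sub>B N (g \<circ> \<phi>\<^sub>A) (g \<circ> \<phi>\<^sub>B)"
    using in_variety_pullback[OF N fmon var] gA gB agree
    by (simp add: strong_embedding_def)
  then show ?thesis unfolding strongly_embeddable_def by blast
qed

end

theory Submission
  imports Defs "HOL-Algebra.Product_Groups" "HOL-Algebra.FiniteProduct"
begin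

text \<open>
  In a group \<open>M\<close> of the variety the commutator is bilinear and \<open>M\<^sup>n M'\<close> is central, which gives
  necessity: \<open>[a\<^sup>q a', b] = [a, b]\<^sup>q = [a, b\<^sup>q b']\<close>.

  For sufficiency put \<open>X = A/A\<^sup>n A'\<close>, \<open>Y = B/B\<^sup>n B'\<close>, and let \<open>W\<close> be the product of \<open>A\<^sup>n A'\<close> and
  \<open>B\<^sup>n B'\<close> amalgamated over \<open>D\<close>. Commutators with \<open>D\<close> give pairings \<open>X \<times> D \<rightarrow> W\<close> and
  \<open>D \<times> Y \<rightarrow> W\<close>, and a group containing \<open>A\<close> and \<open>B\<close> needs a bilinear map \<open>\<beta>\<close> on \<open>X \<times> Y\<close>, with
  values in some \<open>V\<close> containing \<open>W\<close>, that extends both. The universal \<open>V\<close> is a quotient of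
  \<open>W \<oplus> (X \<otimes> Y)\<close>, and \<open>W\<close> embeds in it unless some relation between elements \<open>x \<otimes> d\<close> and
  \<open>d \<otimes> y\<close> of \<open>X \<otimes> Y\<close> is violated in \<open>W\<close>. Such a relation is given by an integer matrix;
  diagonalising it reduces the claim to relations \<open>x\<^sup>q \<otimes> y = x \<otimes> y\<^sup>q\<close>, which is condition (b).
  Finally \<open>A \<times> B \<times> V\<close>, with \<open>\<beta>\<close> as cocycle, modulo the evident identifications is the required
  group.
\<close>

section \<open>Balanced pairings\<close>

text \<open>In a group of the variety containing \<open>A\<close> and \<open>B\<close>,
  \<open>a^q a'\<close> in \<open>D\<close> forces \<open>[a, b]^q\<close> to be an element of
  \<open>B'\<close>. So \<open>[a, b]\<close> may have to be a root that \<open>W\<close> does not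
  possess, which is why values are sought in a larger \<open>V\<close>. When \<open>b^q b'\<close>
  lies in \<open>D\<close> as well, the same power is prescribed from both sides: this is the origin
  of condition (b). Condition (b) treats one such coincidence, whereas \<open>W\<close> could
  collapse through a combination of many. Row and column operations decouple a finite combination
  into single ones; a diagonal matrix is enough, without divisibility between its entries. These
  entries are arbitrary integers, but \<open>X\<close> and \<open>Y\<close> have exponent
  \<open>n\<close>, so an entry can be traded for its gcd with \<open>n\<close>. This leaves the
  positive divisors of \<open>n\<close>, and the entry 0 when \<open>n = 0\<close>. The latter, and
  the passage from elements of \<open>D\<close> to their images in \<open>X\<close> and
  \<open>Y\<close>, rest on condition (a). The hypothesis on \<open>m\<close> and \<open>n\<close>
  enters through \<open>(a b)^m = a^m b^m [a, b]^(-(m choose 2))\<close>: the last factor vanishes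
  because \<open>n\<close> divides \<open>m choose 2\<close>.\<close>

text \<open>Diagonalisation of integer matrices by the Euclidean algorithm, phrased as an induction
  principle so that no matrix factorisation has to be carried along. The outer induction is on the
  number of rows and removes one pivot at a time.\<close>

lemma smith_induct:
  fixes Q :: "'i \<Rightarrow> 'j \<Rightarrow> int"
  assumes fin: "finite I" "finite J"
    and zero: "\<And>I J Q. finite I \<Longrightarrow> finite J \<Longrightarrow> (\<And>i j. i \<in> I \<Longrightarrow> j \<in> J \<Longrightarrow> Q i j = 0) \<Longrightarrow> P I J Q"
    and pivot: "\<And>I J Q i\<^sub>0 j\<^sub>0. finite I \<Longrightarrow> finite J \<Longrightarrow> i\<^sub>0 \<in> I \<Longrightarrow> j\<^sub>0 \<in> J \<Longrightarrow>
      (\<And>j. j \<in> J - {j\<^sub>0} \<Longrightarrow> Q i\<^sub>0 j = 0) \<Longrightarrow> (\<And>i. i \<in> I - {i\<^sub>0} \<Longrightarrow> Q i j\<^sub>0 = 0) \<Longrightarrow>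
      P (I - {i\<^sub>0}) (J - {j\<^sub>0}) Q \<Longrightarrow> P I J Q"
    and col: "\<And>I J Q j\<^sub>0 s. finite I \<Longrightarrow> finite J \<Longrightarrow> j\<^sub>0 \<in> J \<Longrightarrow> s j\<^sub>0 = 0 \<Longrightarrow>
      P I J (\<lambda>i j. Q i j - s j * Q i j\<^sub>0) \<Longrightarrow> P I J Q"
    and row: "\<And>I J Q i\<^sub>0 s. finite I \<Longrightarrow> finite J \<Longrightarrow> i\<^sub>0 \<in> I \<Longrightarrow> s i\<^sub>0 = 0 \<Longrightarrow>
      P I J (\<lambda>i j. Q i j - s i * Q i\<^sub>0 j) \<Longrightarrow> P I J Q"
  shows "P I J Q"
  using fin
proof (induction "card I" arbitrary: I J Q rule: less_induct)
  case (less I J Q)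
  \<comment> \<open>The inner measure is the absolute value of the pivot: a nonzero remainder in its
    row or column becomes the next, smaller pivot.\<close>
  have main: "P I J Q" if "i\<^sub>0 \<in> I" "j\<^sub>0 \<in> J" "Q i\<^sub>0 j\<^sub>0 \<noteq> 0" for i\<^sub>0 j\<^sub>0 Q
    using that
  proof (induction "nat \<bar>Q i\<^sub>0 j\<^sub>0\<bar>" arbitrary: Q i\<^sub>0 j\<^sub>0 rule: less_induct)
    case inner: (less Q i\<^sub>0 j\<^sub>0)
    \<comment> \<open>Quotients of the pivot row by the pivot, so that one column operation leaves
      remainders in the whole row. The value 0 at \<open>j\<^sub>0\<close> keeps the pivot column,
      as \<open>col\<close> demands.\<close>
    define s where "s j = (if j = j\<^sub>0 then 0 else Q i\<^sub>0 j div Q i\<^sub>0 j\<^sub>0)" for j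
    define Q1 where "Q1 = (\<lambda>i j. Q i j - s j * Q i j\<^sub>0)"
    have Q1: "Q1 i\<^sub>0 j = (if j = j\<^sub>0 then Q i\<^sub>0 j\<^sub>0 else Q i\<^sub>0 j mod Q i\<^sub>0 j\<^sub>0)" for j
      by (simp add: Q1_def s_def minus_div_mult_eq_mod)
    have "P I J Q1"
    proof (cases "\<exists>j\<in>J. j \<noteq> j\<^sub>0 \<and> Q1 i\<^sub>0 j \<noteq> 0")
      case True
      then obtain j where j: "j \<in> J" "j \<noteq> j\<^sub>0" "Q1 i\<^sub>0 j \<noteq> 0" by blast
      have "nat \<bar>Q1 i\<^sub>0 j\<bar> < nat \<bar>Q i\<^sub>0 j\<^sub>0\<bar>"
        using j(2) inner.prems(3) abs_mod_less[of "Q i\<^sub>0 j\<^sub>0" "Q i\<^sub>0 j"] by (simp add: Q1)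
      then show ?thesis using inner.hyps[of Q1 i\<^sub>0 j] j inner.prems by blast
    next
      case False
      define t where "t i = (if i = i\<^sub>0 then 0 else Q1 i j\<^sub>0 div Q1 i\<^sub>0 j\<^sub>0)" for i
      define Q2 where "Q2 = (\<lambda>i j. Q1 i j - t i * Q1 i\<^sub>0 j)"
      have Q2: "Q2 i j\<^sub>0 = (if i = i\<^sub>0 then Q i\<^sub>0 j\<^sub>0 else Q1 i j\<^sub>0 mod Q i\<^sub>0 j\<^sub>0)" for i
        by (simp add: Q2_def t_def minus_div_mult_eq_mod Q1)
      have "P I J Q2"
      proof (cases "\<exists>i\<in>I. i \<noteq> i\<^sub>0 \<and> Q2 i j\<^sub>0 \<noteq> 0")
        case True
        then obtain i where i: "i \<in> I" "i \<noteq> i\<^sub>0" "Q2 i j\<^sub>0 \<noteq> 0" by blast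
        have "nat \<bar>Q2 i j\<^sub>0\<bar> < nat \<bar>Q i\<^sub>0 j\<^sub>0\<bar>"
          using i(2) inner.prems(3) abs_mod_less[of "Q i\<^sub>0 j\<^sub>0" "Q1 i j\<^sub>0"] by (simp add: Q2)
        then show ?thesis using inner.hyps[of Q2 i j\<^sub>0] i inner.prems by blast
      next
        case clear: False
        \<comment> \<open>Since \<open>t\<close> vanishes at \<open>i\<^sub>0\<close>, clearing the
          column has not refilled the pivot row, and the pivot is isolated.\<close>
        have "P (I - {i\<^sub>0}) (J - {j\<^sub>0}) Q2"
          using less.prems inner.prems(1)
          by (intro less.hyps) (auto intro!: psubset_card_mono simp del: card_Diff_insert)
        then show ?thesis
          using less.prems inner.prems clear False
          by (intro pivot[of I J i\<^sub>0 j\<^sub>0 Q2]) (auto simp: Q2_def t_def)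
      qed
      then show ?thesis
        using row[of I J i\<^sub>0 t Q1] less.prems inner.prems by (simp add: Q2_def t_def)
    qed
    then show ?case
      using col[of I J j\<^sub>0 s Q] less.prems inner.prems by (simp add: Q1_def s_def)
  qed
  show ?case
  proof (cases "\<exists>i\<in>I. \<exists>j\<in>J. Q i j \<noteq> 0")
    case True
    then show ?thesis using main by blast
  next
    case False
    then show ?thesis using less.prems by (intro zero) auto
  qed
qed

section \<open>Finite products in abelian groups\<close>

lemma hom_finprod:
  assumes "comm_group G" "comm_group H" "h \<in> hom G H" "f \<in> I \<rightarrow> carrier G"
  shows "h (finprod G f I) = finprod H (\<lambda>i. h (f i)) I"
proof -
  interpret G: comm_group G by fact
  interpret H: comm_group H by fact
  interpret group_hom G H h
    using assms by (simp add: group_hom_def group_hom_axioms_def G.is_group H.is_group)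
  show ?thesis
    using assms(4) by (induction I rule: infinite_finite_induct) (auto simp: Pi_iff)
qed

lemma (in comm_group) finprod_int_pow:
  assumes "f \<in> I \<rightarrow> carrier G"
  shows "finprod G f I [^] (k::int) = (\<Otimes>i\<in>I. f i [^] k)"
proof -
  have "(\<lambda>x. x [^] k) \<in> hom G G" by (auto simp: hom_def int_pow_distrib)
  then show ?thesis using hom_finprod[of G G "\<lambda>x. x [^] k"] assms comm_group_axioms by blast
qed

lemma (in comm_group) finprod_inv:
  assumes "f \<in> I \<rightarrow> carrier G"
  shows "inv (finprod G f I) = (\<Otimes>i\<in>I. inv (f i))"
proof -
  have "(\<lambda>x. inv x) \<in> hom G G" by (auto simp: hom_def inv_mult)
  then show ?thesis using hom_finprod[of G G "\<lambda>x. inv x"] assms comm_group_axioms by blast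
qed

text \<open>\<open>E\<close> plays the role of \<open>D\<close>, with images under \<open>p\<close>
  and \<open>r\<close> in \<open>X\<close> and \<open>Y\<close>. The maps \<alpha> and \<gamma>
  prescribe a bilinear map on \<open>X\<close> times \<open>r(E)\<close> and on \<open>p(E)\<close>
  times \<open>Y\<close>. The condition \<open>balance\<close> mirrors
  \<open>x^q \<otimes> y = x \<otimes> y^q\<close> in the tensor product: \<open>q = 1\<close> says
  that the prescriptions agree where they overlap, \<open>q = 0\<close> that they depend only on the
  images under \<open>r\<close> and \<open>p\<close>.\<close>

locale balanced_pairings =
  X: comm_group X + Y: comm_group Y + W: comm_group W + E: group E
  for X :: "('x, 'xs) monoid_scheme" and Y :: "('y, 'ys) monoid_scheme"
    and W :: "('w, 'ws) monoid_scheme" and E :: "('e, 'es) monoid_scheme" +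
  fixes p :: "'e \<Rightarrow> 'x" and r :: "'e \<Rightarrow> 'y" and \<alpha> :: "'x \<Rightarrow> 'e \<Rightarrow> 'w" and \<gamma> :: "'e \<Rightarrow> 'y \<Rightarrow> 'w"
  assumes p: "p \<in> hom E X" and r: "r \<in> hom E Y"
    and \<alpha>_left: "\<And>d. d \<in> carrier E \<Longrightarrow> (\<lambda>x. \<alpha> x d) \<in> hom X W"
    and \<alpha>_right: "\<And>x. x \<in> carrier X \<Longrightarrow> \<alpha> x \<in> hom E W"
    and \<gamma>_left: "\<And>y. y \<in> carrier Y \<Longrightarrow> (\<lambda>d. \<gamma> d y) \<in> hom E W"
    and \<gamma>_right: "\<And>d. d \<in> carrier E \<Longrightarrow> \<gamma> d \<in> hom Y W"
    and balance: "\<And>(q::int) x y d e. x \<in> carrier X \<Longrightarrow> y \<in> carrier Y \<Longrightarrow> d \<in> carrier E \<Longrightarrow>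
      e \<in> carrier E \<Longrightarrow> p d = x [^]\<^bsub>X\<^esub> q \<Longrightarrow> r e = y [^]\<^bsub>Y\<^esub> q \<Longrightarrow> \<gamma> d y = \<alpha> x e"
begin

text \<open>The hypotheses are symmetric in \<open>X\<close> and \<open>Y\<close>; through this
  symmetry, facts on columns yield facts on rows.\<close>

lemma flip: "balanced_pairings Y X W E r p (\<lambda>y d. \<gamma> d y) (\<lambda>d x. \<alpha> x d)"
proof unfold_locales
  show "\<alpha> x e = \<gamma> d y" if "y \<in> carrier Y" "x \<in> carrier X" "e \<in> carrier E" "d \<in> carrier E"
    "r e = y [^]\<^bsub>Y\<^esub> q" "p d = x [^]\<^bsub>X\<^esub> q" for q :: int and y x e d
    using balance[of x y d e q] that by simp
qed (fact r p \<gamma>_right \<gamma>_left \<alpha>_right \<alpha>_left)+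

sublocale p: group_hom E X p by unfold_locales (rule p)
sublocale r: group_hom E Y r by unfold_locales (rule r)

lemma \<alpha>_closed [simp]: "x \<in> carrier X \<Longrightarrow> d \<in> carrier E \<Longrightarrow> \<alpha> x d \<in> carrier W"
  using \<alpha>_right by (auto simp: hom_def)

lemma \<gamma>_closed [simp]: "y \<in> carrier Y \<Longrightarrow> d \<in> carrier E \<Longrightarrow> \<gamma> d y \<in> carrier W"
  using \<gamma>_right by (auto simp: hom_def)

lemma \<gamma>_mult_left:
  "y \<in> carrier Y \<Longrightarrow> d \<in> carrier E \<Longrightarrow> e \<in> carrier E \<Longrightarrow> \<gamma> (d \<otimes>\<^bsub>E\<^esub> e) y = \<gamma> d y \<otimes>\<^bsub>W\<^esub> \<gamma> e y"
  using \<gamma>_left by (auto simp: hom_def)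

lemma \<gamma>_mult_right:
  "y \<in> carrier Y \<Longrightarrow> z \<in> carrier Y \<Longrightarrow> d \<in> carrier E \<Longrightarrow> \<gamma> d (y \<otimes>\<^bsub>Y\<^esub> z) = \<gamma> d y \<otimes>\<^bsub>W\<^esub> \<gamma> d z"
  using \<gamma>_right by (auto simp: hom_def)

lemma \<gamma>_one_right: "d \<in> carrier E \<Longrightarrow> \<gamma> d \<one>\<^bsub>Y\<^esub> = \<one>\<^bsub>W\<^esub>"
  using hom_one[OF \<gamma>_right] by (simp add: Y.is_group W.is_group)

lemma \<gamma>_one_left: "y \<in> carrier Y \<Longrightarrow> \<gamma> \<one>\<^bsub>E\<^esub> y = \<one>\<^bsub>W\<^esub>"
  using hom_one[OF \<gamma>_left] by (simp add: E.is_group W.is_group)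

lemma \<gamma>_pow_left:
  "y \<in> carrier Y \<Longrightarrow> d \<in> carrier E \<Longrightarrow> \<gamma> (d [^]\<^bsub>E\<^esub> (k::int)) y = \<gamma> d y [^]\<^bsub>W\<^esub> k"
  using hom_int_pow[OF \<gamma>_left] by (simp add: E.is_group W.is_group)

lemma \<gamma>_pow_right:
  "y \<in> carrier Y \<Longrightarrow> d \<in> carrier E \<Longrightarrow> \<gamma> d (y [^]\<^bsub>Y\<^esub> (k::int)) = \<gamma> d y [^]\<^bsub>W\<^esub> k"
  using hom_int_pow[OF \<gamma>_right] by (simp add: Y.is_group W.is_group)

text \<open>In the tensor product of \<open>X\<close> and \<open>Y\<close>, both sums
  \<open>\<Sum>i. x i \<otimes> r (e i)\<close> and \<open>\<Sum>j. p (d j) \<otimes> y j\<close>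
  equal \<open>\<Sum>i j. Q i j (x i \<otimes> y j)\<close>. The definition asks that the prescribed
  values in \<open>W\<close> respect this coincidence. A matrix with a single entry \<open>q\<close>
  gives \<open>balance\<close>.\<close>

definition balanced :: "'i set \<Rightarrow> 'j set \<Rightarrow> ('i \<Rightarrow> 'j \<Rightarrow> int) \<Rightarrow> bool" where
  "balanced I J Q \<longleftrightarrow> (\<forall>x \<in> I \<rightarrow> carrier X. \<forall>y \<in> J \<rightarrow> carrier Y.
     \<forall>d \<in> J \<rightarrow> carrier E. \<forall>e \<in> I \<rightarrow> carrier E.
     (\<forall>j\<in>J. p (d j) = (\<Otimes>\<^bsub>X\<^esub>i\<in>I. x i [^]\<^bsub>X\<^esub> Q i j)) \<longrightarrow>
     (\<forall>i\<in>I. r (e i) = (\<Otimes>\<^bsub>Y\<^esub>j\<in>J. y j [^]\<^bsub>Y\<^esub> Q i j)) \<longrightarrow>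
     (\<Otimes>\<^bsub>W\<^esub>i\<in>I. \<alpha> (x i) (e i)) = (\<Otimes>\<^bsub>W\<^esub>j\<in>J. \<gamma> (d j) (y j)))"

lemma balanced_flip:
  "balanced_pairings.balanced Y X W E r p (\<lambda>y d. \<gamma> d y) (\<lambda>d x. \<alpha> x d) J I (\<lambda>j i. Q i j)
     \<longleftrightarrow> balanced I J Q"
  unfolding balanced_def balanced_pairings.balanced_def[OF flip]
  by (intro iffI ballI impI; rule sym; blast)

text \<open>Data for \<open>Q\<close> are turned into data for the modified matrix by the dual
  change of variables. In additive notation, \<open>y j\<^sub>0\<close> gains the sum of all
  \<open>s j * y j\<close>, each \<open>d j\<close> loses \<open>s j * d j\<^sub>0\<close>, and
  \<open>x\<close> and \<open>e\<close> stay as they are.\<close>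

lemma balanced_column_operation:
  assumes fin: "finite I" "finite J" and j0: "j\<^sub>0 \<in> J" "s j\<^sub>0 = 0"
    and bal: "balanced I J (\<lambda>i j. Q i j - s j * Q i j\<^sub>0)"
  shows "balanced I J Q"
  unfolding balanced_def
proof (intro ballI impI)
  fix x y d e
  assume x: "x \<in> I \<rightarrow> carrier X" and y: "y \<in> J \<rightarrow> carrier Y"
    and d: "d \<in> J \<rightarrow> carrier E" and e: "e \<in> I \<rightarrow> carrier E"
    and pd: "\<forall>j\<in>J. p (d j) = (\<Otimes>\<^bsub>X\<^esub>i\<in>I. x i [^]\<^bsub>X\<^esub> Q i j)"
    and re: "\<forall>i\<in>I. r (e i) = (\<Otimes>\<^bsub>Y\<^esub>j\<in>J. y j [^]\<^bsub>Y\<^esub> Q i j)"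
  define c where "c = (\<Otimes>\<^bsub>Y\<^esub>j\<in>J. y j [^]\<^bsub>Y\<^esub> s j)"
  define y' where "y' j = y j \<otimes>\<^bsub>Y\<^esub> (if j = j\<^sub>0 then c else \<one>\<^bsub>Y\<^esub>)" for j
  define d' where "d' j = d j \<otimes>\<^bsub>E\<^esub> d j\<^sub>0 [^]\<^bsub>E\<^esub> (- s j)" for j
  have mem: "\<And>i. i \<in> I \<Longrightarrow> x i \<in> carrier X" "\<And>j. j \<in> J \<Longrightarrow> y j \<in> carrier Y"
    "\<And>j. j \<in> J \<Longrightarrow> d j \<in> carrier E" "\<And>i. i \<in> I \<Longrightarrow> e i \<in> carrier E"
    using x y d e by auto
  have c: "c \<in> carrier Y" unfolding c_def by (rule Y.finprod_closed) (simp add: mem Pi_iff)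
  have y': "y' \<in> J \<rightarrow> carrier Y" and d': "d' \<in> J \<rightarrow> carrier E"
    using mem c j0 by (auto simp: y'_def d'_def)
  have pd': "p (d' j) = (\<Otimes>\<^bsub>X\<^esub>i\<in>I. x i [^]\<^bsub>X\<^esub> (Q i j - s j * Q i j\<^sub>0))" if "j \<in> J" for j
  proof -
    have "p (d' j) = (\<Otimes>\<^bsub>X\<^esub>i\<in>I. x i [^]\<^bsub>X\<^esub> Q i j) \<otimes>\<^bsub>X\<^esub> (\<Otimes>\<^bsub>X\<^esub>i\<in>I. x i [^]\<^bsub>X\<^esub> Q i j\<^sub>0) [^]\<^bsub>X\<^esub> (- s j)"
      using that j0 pd by (simp add: d'_def mem p.hom_int_pow)
    also have "\<dots> = (\<Otimes>\<^bsub>X\<^esub>i\<in>I. x i [^]\<^bsub>X\<^esub> Q i j \<otimes>\<^bsub>X\<^esub> (x i [^]\<^bsub>X\<^esub> Q i j\<^sub>0) [^]\<^bsub>X\<^esub> (- s j))"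
      by (subst X.finprod_int_pow) (auto simp: mem)
    also have "\<dots> = (\<Otimes>\<^bsub>X\<^esub>i\<in>I. x i [^]\<^bsub>X\<^esub> (Q i j - s j * Q i j\<^sub>0))"
      by (rule X.finprod_cong')
        (auto simp: mem X.int_pow_pow X.int_pow_mult[symmetric] mult.commute)
    finally show ?thesis .
  qed
  have re': "r (e i) = (\<Otimes>\<^bsub>Y\<^esub>j\<in>J. y' j [^]\<^bsub>Y\<^esub> (Q i j - s j * Q i j\<^sub>0))" if "i \<in> I" for i
  proof -
    have "(\<Otimes>\<^bsub>Y\<^esub>j\<in>J. y' j [^]\<^bsub>Y\<^esub> (Q i j - s j * Q i j\<^sub>0))
      = (\<Otimes>\<^bsub>Y\<^esub>j\<in>J. (y j [^]\<^bsub>Y\<^esub> Q i j \<otimes>\<^bsub>Y\<^esub> (y j [^]\<^bsub>Y\<^esub> s j) [^]\<^bsub>Y\<^esub> (- Q i j\<^sub>0))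
          \<otimes>\<^bsub>Y\<^esub> (if j = j\<^sub>0 then c [^]\<^bsub>Y\<^esub> Q i j\<^sub>0 else \<one>\<^bsub>Y\<^esub>))"
      using c j0 by (intro Y.finprod_cong')
        (auto simp: mem y'_def Y.int_pow_distrib Y.int_pow_pow Y.int_pow_mult[symmetric])
    also have "\<dots> = (\<Otimes>\<^bsub>Y\<^esub>j\<in>J. y j [^]\<^bsub>Y\<^esub> Q i j) \<otimes>\<^bsub>Y\<^esub> c [^]\<^bsub>Y\<^esub> (- Q i j\<^sub>0)
        \<otimes>\<^bsub>Y\<^esub> (\<Otimes>\<^bsub>Y\<^esub>j\<in>J. if j = j\<^sub>0 then c [^]\<^bsub>Y\<^esub> Q i j\<^sub>0 else \<one>\<^bsub>Y\<^esub>)"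
    proof -
      have "c [^]\<^bsub>Y\<^esub> (- Q i j\<^sub>0) = (\<Otimes>\<^bsub>Y\<^esub>j\<in>J. (y j [^]\<^bsub>Y\<^esub> s j) [^]\<^bsub>Y\<^esub> (- Q i j\<^sub>0))"
        unfolding c_def by (rule Y.finprod_int_pow) (simp add: mem)
      then show ?thesis using c by (subst Y.finprod_multf) (auto simp: mem)
    qed
    also have "\<dots> = (\<Otimes>\<^bsub>Y\<^esub>j\<in>J. y j [^]\<^bsub>Y\<^esub> Q i j)"
      using fin j0 c Y.finprod_singleton_swap[of j\<^sub>0 J "\<lambda>_. c [^]\<^bsub>Y\<^esub> Q i j\<^sub>0"]
      by (simp add: Y.m_assoc mem Y.int_pow_mult[symmetric])
    finally show ?thesis using re that by simp
  qed
  have "(\<Otimes>\<^bsub>W\<^esub>j\<in>J. \<gamma> (d' j) (y' j))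
    = (\<Otimes>\<^bsub>W\<^esub>j\<in>J. (\<gamma> (d j) (y j) \<otimes>\<^bsub>W\<^esub> \<gamma> (d j\<^sub>0) (y j [^]\<^bsub>Y\<^esub> s j) [^]\<^bsub>W\<^esub> (- 1 :: int))
        \<otimes>\<^bsub>W\<^esub> (if j = j\<^sub>0 then \<gamma> (d j\<^sub>0) c else \<one>\<^bsub>W\<^esub>))"
    using c j0 by (intro W.finprod_cong')
      (auto simp: mem y'_def d'_def \<gamma>_mult_left \<gamma>_mult_right \<gamma>_pow_left \<gamma>_pow_right \<gamma>_one_right
        W.int_pow_pow)
  \<comment> \<open>The value of \<gamma> at \<open>d j\<^sub>0\<close> and \<open>c\<close> occurs
    twice: inverted, collected from the changes of \<open>d\<close> over all columns, and once more
    from the change of \<open>y\<close> in column \<open>j\<^sub>0\<close>.\<close>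
  also have "\<dots> = (\<Otimes>\<^bsub>W\<^esub>j\<in>J. \<gamma> (d j) (y j)) \<otimes>\<^bsub>W\<^esub> (\<gamma> (d j\<^sub>0) c) [^]\<^bsub>W\<^esub> (- 1 :: int)
        \<otimes>\<^bsub>W\<^esub> (\<Otimes>\<^bsub>W\<^esub>j\<in>J. if j = j\<^sub>0 then \<gamma> (d j\<^sub>0) c else \<one>\<^bsub>W\<^esub>)"
  proof -
    have "\<gamma> (d j\<^sub>0) c = (\<Otimes>\<^bsub>W\<^esub>j\<in>J. \<gamma> (d j\<^sub>0) (y j [^]\<^bsub>Y\<^esub> s j))"
      unfolding c_def using j0
      by (intro hom_finprod \<gamma>_right) (auto simp: mem Y.comm_group_axioms W.comm_group_axioms)
    then show ?thesis
      using j0 c by (subst W.finprod_multf) (auto simp: mem W.finprod_int_pow)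
  qed
  also have "\<dots> = (\<Otimes>\<^bsub>W\<^esub>j\<in>J. \<gamma> (d j) (y j))"
    using fin j0 c W.finprod_singleton_swap[of j\<^sub>0 J "\<lambda>_. \<gamma> (d j\<^sub>0) c"]
    by (simp add: W.m_assoc mem W.int_pow_neg)
  finally have "(\<Otimes>\<^bsub>W\<^esub>j\<in>J. \<gamma> (d' j) (y' j)) = (\<Otimes>\<^bsub>W\<^esub>j\<in>J. \<gamma> (d j) (y j))" .
  moreover have "(\<Otimes>\<^bsub>W\<^esub>i\<in>I. \<alpha> (x i) (e i)) = (\<Otimes>\<^bsub>W\<^esub>j\<in>J. \<gamma> (d' j) (y' j))"
    using bal x y' d' e pd' re' unfolding balanced_def by blast
  ultimately show "(\<Otimes>\<^bsub>W\<^esub>i\<in>I. \<alpha> (x i) (e i)) = (\<Otimes>\<^bsub>W\<^esub>j\<in>J. \<gamma> (d j) (y j))" by simp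
qed

lemma balanced_row_operation:
  assumes fin: "finite I" "finite J" and i0: "i\<^sub>0 \<in> I" "s i\<^sub>0 = 0"
    and bal: "balanced I J (\<lambda>i j. Q i j - s i * Q i\<^sub>0 j)"
  shows "balanced I J Q"
proof -
  interpret F: balanced_pairings Y X W E r p "\<lambda>y d. \<gamma> d y" "\<lambda>d x. \<alpha> x d" by (rule flip)
  show ?thesis
    using F.balanced_column_operation[of J I i\<^sub>0 s "\<lambda>j i. Q i j"] assms
      balanced_flip[of J I Q] balanced_flip[of J I "\<lambda>i j. Q i j - s i * Q i\<^sub>0 j"]
    by blast
qed

text \<open>Each factor is trivial on its own. The exponent 0 in \<open>balance\<close>, with
  identity elements on the opposite side, shows that \<alpha> kills elements with trivial image
  under \<open>r\<close>, and \<gamma> those with trivial image under \<open>p\<close>.\<close>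

lemma balanced_zero:
  assumes "\<And>i j. i \<in> I \<Longrightarrow> j \<in> J \<Longrightarrow> Q i j = 0"
  shows "balanced I J Q"
  unfolding balanced_def
proof (intro ballI impI)
  fix x y d e
  assume x: "x \<in> I \<rightarrow> carrier X" and y: "y \<in> J \<rightarrow> carrier Y"
    and d: "d \<in> J \<rightarrow> carrier E" and e: "e \<in> I \<rightarrow> carrier E"
    and pd: "\<forall>j\<in>J. p (d j) = (\<Otimes>\<^bsub>X\<^esub>i\<in>I. x i [^]\<^bsub>X\<^esub> Q i j)"
    and re: "\<forall>i\<in>I. r (e i) = (\<Otimes>\<^bsub>Y\<^esub>j\<in>J. y j [^]\<^bsub>Y\<^esub> Q i j)"
  have "\<alpha> (x i) (e i) = \<one>\<^bsub>W\<^esub>" if "i \<in> I" for i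
  proof -
    have "r (e i) = \<one>\<^bsub>Y\<^esub>" using re that assms by (simp add: Y.finprod_one_eqI)
    then show ?thesis
      using balance[of "x i" "\<one>\<^bsub>Y\<^esub>" "\<one>\<^bsub>E\<^esub>" "e i" 0] that x e by (simp add: \<gamma>_one_left Pi_iff)
  qed
  moreover have "\<gamma> (d j) (y j) = \<one>\<^bsub>W\<^esub>" if "j \<in> J" for j
  proof -
    have "p (d j) = \<one>\<^bsub>X\<^esub>" using pd that assms by (simp add: X.finprod_one_eqI)
    moreover have "\<alpha> \<one>\<^bsub>X\<^esub> \<one>\<^bsub>E\<^esub> = \<one>\<^bsub>W\<^esub>"
      using hom_one[OF \<alpha>_left] by (simp add: X.is_group W.is_group)
    ultimately show ?thesis
      using balance[of "\<one>\<^bsub>X\<^esub>" "y j" "d j" "\<one>\<^bsub>E\<^esub>" 0] that y d by auto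
  qed
  ultimately show "(\<Otimes>\<^bsub>W\<^esub>i\<in>I. \<alpha> (x i) (e i)) = (\<Otimes>\<^bsub>W\<^esub>j\<in>J. \<gamma> (d j) (y j))"
    by (simp add: W.finprod_one_eqI)
qed

text \<open>An isolated entry concerns only \<open>x i\<^sub>0\<close>, \<open>e i\<^sub>0\<close>,
  \<open>d j\<^sub>0\<close> and \<open>y j\<^sub>0\<close>, and \<open>balance\<close> with that
  entry as exponent matches their contributions. The entry can have either sign, hence the integer
  exponent in \<open>balance\<close>.\<close>

lemma balanced_pivot:
  assumes fin: "finite I" "finite J" and ij: "i\<^sub>0 \<in> I" "j\<^sub>0 \<in> J"
    and row: "\<And>j. j \<in> J - {j\<^sub>0} \<Longrightarrow> Q i\<^sub>0 j = 0" and col: "\<And>i. i \<in> I - {i\<^sub>0} \<Longrightarrow> Q i j\<^sub>0 = 0"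
    and bal: "balanced (I - {i\<^sub>0}) (J - {j\<^sub>0}) Q"
  shows "balanced I J Q"
  unfolding balanced_def
proof (intro ballI impI)
  fix x y d e
  assume x: "x \<in> I \<rightarrow> carrier X" and y: "y \<in> J \<rightarrow> carrier Y"
    and d: "d \<in> J \<rightarrow> carrier E" and e: "e \<in> I \<rightarrow> carrier E"
    and pd: "\<forall>j\<in>J. p (d j) = (\<Otimes>\<^bsub>X\<^esub>i\<in>I. x i [^]\<^bsub>X\<^esub> Q i j)"
    and re: "\<forall>i\<in>I. r (e i) = (\<Otimes>\<^bsub>Y\<^esub>j\<in>J. y j [^]\<^bsub>Y\<^esub> Q i j)"
  have mem: "\<And>i. i \<in> I \<Longrightarrow> x i \<in> carrier X" "\<And>j. j \<in> J \<Longrightarrow> y j \<in> carrier Y"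
    "\<And>j. j \<in> J \<Longrightarrow> d j \<in> carrier E" "\<And>i. i \<in> I \<Longrightarrow> e i \<in> carrier E"
    using x y d e by auto
  have splitX: "finprod X f I = f i\<^sub>0 \<otimes>\<^bsub>X\<^esub> finprod X f (I - {i\<^sub>0})" if "f \<in> I \<rightarrow> carrier X" for f
    using X.finprod_insert[of "I - {i\<^sub>0}" i\<^sub>0 f] that fin ij by (auto simp: insert_absorb)
  have splitY: "finprod Y f J = f j\<^sub>0 \<otimes>\<^bsub>Y\<^esub> finprod Y f (J - {j\<^sub>0})" if "f \<in> J \<rightarrow> carrier Y" for f
    using Y.finprod_insert[of "J - {j\<^sub>0}" j\<^sub>0 f] that fin ij by (auto simp: insert_absorb)
  have splitI: "finprod W f I = f i\<^sub>0 \<otimes>\<^bsub>W\<^esub> finprod W f (I - {i\<^sub>0})" if "f \<in> I \<rightarrow> carrier W" for f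
    using W.finprod_insert[of "I - {i\<^sub>0}" i\<^sub>0 f] that fin ij by (auto simp: insert_absorb)
  have splitJ: "finprod W f J = f j\<^sub>0 \<otimes>\<^bsub>W\<^esub> finprod W f (J - {j\<^sub>0})" if "f \<in> J \<rightarrow> carrier W" for f
    using W.finprod_insert[of "J - {j\<^sub>0}" j\<^sub>0 f] that fin ij by (auto simp: insert_absorb)
  have "p (d j\<^sub>0) = x i\<^sub>0 [^]\<^bsub>X\<^esub> Q i\<^sub>0 j\<^sub>0"
    using pd ij X.finprod_one_eqI[of "I - {i\<^sub>0}" "\<lambda>i. x i [^]\<^bsub>X\<^esub> Q i j\<^sub>0"] by (simp add: splitX mem col)
  moreover have "r (e i\<^sub>0) = y j\<^sub>0 [^]\<^bsub>Y\<^esub> Q i\<^sub>0 j\<^sub>0"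
    using re ij Y.finprod_one_eqI[of "J - {j\<^sub>0}" "\<lambda>j. y j [^]\<^bsub>Y\<^esub> Q i\<^sub>0 j"] by (simp add: splitY mem row)
  ultimately have "\<gamma> (d j\<^sub>0) (y j\<^sub>0) = \<alpha> (x i\<^sub>0) (e i\<^sub>0)"
    using balance mem ij by blast
  moreover have "(\<Otimes>\<^bsub>W\<^esub>i\<in>I - {i\<^sub>0}. \<alpha> (x i) (e i)) = (\<Otimes>\<^bsub>W\<^esub>j\<in>J - {j\<^sub>0}. \<gamma> (d j) (y j))"
  proof -
    have "p (d j) = (\<Otimes>\<^bsub>X\<^esub>i\<in>I - {i\<^sub>0}. x i [^]\<^bsub>X\<^esub> Q i j)" if "j \<in> J - {j\<^sub>0}" for j
      using pd that row ij by (simp add: splitX mem)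
    moreover have "r (e i) = (\<Otimes>\<^bsub>Y\<^esub>j\<in>J - {j\<^sub>0}. y j [^]\<^bsub>Y\<^esub> Q i j)" if "i \<in> I - {i\<^sub>0}" for i
      using re that col ij by (simp add: splitY mem)
    moreover have "x \<in> I - {i\<^sub>0} \<rightarrow> carrier X" "y \<in> J - {j\<^sub>0} \<rightarrow> carrier Y"
      "d \<in> J - {j\<^sub>0} \<rightarrow> carrier E" "e \<in> I - {i\<^sub>0} \<rightarrow> carrier E" by (auto simp: mem)
    ultimately show ?thesis using bal unfolding balanced_def by blast
  qed
  ultimately show "(\<Otimes>\<^bsub>W\<^esub>i\<in>I. \<alpha> (x i) (e i)) = (\<Otimes>\<^bsub>W\<^esub>j\<in>J. \<gamma> (d j) (y j))"
    by (simp add: splitI splitJ mem)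
qed

text \<open>The class of balanced matrices is closed under undoing every step of the
  diagonalisation, so the single relations \<open>balance\<close> control all finite
  combinations.\<close>

lemma balancedI:
  assumes "finite I" "finite J"
  shows "balanced I J Q"
  using assms
  by (rule smith_induct[where P = balanced])
    (blast intro: balanced_zero, rule balanced_pivot, assumption+,
      (rule balanced_column_operation, assumption+), rule balanced_row_operation, assumption+)

end

section \<open>Extending two pairings simultaneously\<close>

text \<open>With generators closed under inversion, every element is a product of generators, so
  induction may multiply by one generator on the left. The claim is strengthened to products
  \<open>x \<otimes> u\<close> to pass through the closure rule for two arbitrary factors.\<close>

lemma (in group) generate_left_induct [consumes 3, case_names one mult]:
  assumes "x \<in> generate G H" and H: "H \<subseteq> carrier G" "\<forall>h\<in>H. inv h \<in> H"
    and one: "P \<one>" and mult: "\<And>h u. h \<in> H \<Longrightarrow> u \<in> carrier G \<Longrightarrow> P u \<Longrightarrow> P (h \<otimes> u)"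
  shows "P x"
proof -
  have "P (x \<otimes> u)" if "u \<in> carrier G" "P u" for u
    using assms(1) that
  proof (induction x arbitrary: u rule: generate.induct)
    case (eng x y)
    then have "x \<in> carrier G" "y \<in> carrier G" using generate_in_carrier[OF H(1)] by auto
    then show ?case using eng by (simp add: m_assoc)
  qed (use H mult in auto)
  then have "P (x \<otimes> \<one>)" using one by simp
  then show ?thesis using generate_in_carrier[OF H(1) assms(1)] by simp
qed

lemma (in normal) coset_eq_self_iff:
  assumes "x \<in> carrier G"
  shows "H #> x = H \<longleftrightarrow> x \<in> H"
  using coset_join1[OF _ assms subgroup_axioms] coset_join2[OF assms subgroup_axioms] by metis

lemma comm_group_DirProd:
  assumes "comm_group G" "comm_group H"
  shows "comm_group (G \<times>\<times> H)"
proof -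
  interpret G: comm_group G by fact
  interpret H: comm_group H by fact
  show ?thesis
    by (rule group.group_comm_groupI)
      (auto simp: DirProd_group G.is_group H.is_group G.m_comm H.m_comm)
qed

lemma comm_group_product_group:
  assumes "\<And>i. i \<in> I \<Longrightarrow> comm_group (G i)"
  shows "comm_group (product_group I G)"
proof (rule group.group_comm_groupI)
  show "group (product_group I G)" using assms by (simp add: comm_group.axioms)
  fix f g assume "f \<in> carrier (product_group I G)" "g \<in> carrier (product_group I G)"
  then show "f \<otimes>\<^bsub>product_group I G\<^esub> g = g \<otimes>\<^bsub>product_group I G\<^esub> f"
    using assms by (auto simp: comm_groupE(4) PiE_iff intro!: restrict_ext)
qed

lemma pow_DirProd: "(g, h) [^]\<^bsub>G \<times>\<times> H\<^esub> (k::nat) = (g [^]\<^bsub>G\<^esub> k, h [^]\<^bsub>H\<^esub> k)"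
  by (induction k) auto

lemma pow_product_group:
  "f [^]\<^bsub>product_group I G\<^esub> (k::nat) = (\<lambda>i\<in>I. f i [^]\<^bsub>G i\<^esub> k)"
  by (induction k) (auto intro!: restrict_ext)

section \<open>A presentation of the universal target and its relators\<close>

context balanced_pairings
begin

text \<open>The function \<open>c\<close> is an element of the free abelian group on the set
  \<open>carrier X\<close>, and \<open>u\<close> is its image under the evaluation map to
  \<open>X\<close>.\<close>

definition combination :: "('x \<Rightarrow> int) \<Rightarrow> 'x \<Rightarrow> bool" where
  "combination c u \<longleftrightarrow> (\<exists>S. finite S \<and> S \<subseteq> carrier X \<and> (\<forall>z. z \<notin> S \<longrightarrow> c z = 0) \<and>
     (\<Otimes>\<^bsub>X\<^esub>z\<in>S. z [^]\<^bsub>X\<^esub> c z) = u)"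

text \<open>A function from \<open>carrier X\<close> to \<open>Y\<close> encodes a formal sum of
  tensors \<open>z \<otimes> g z\<close>. Under this reading \<open>point x y\<close> is
  \<open>x \<otimes> y\<close>, and \<open>spread c y\<close> below is the sum of all
  \<open>c z (z \<otimes> y)\<close>.\<close>

definition point :: "'x \<Rightarrow> 'y \<Rightarrow> 'x \<Rightarrow> 'y" where
  "point x y = (\<lambda>z\<in>carrier X. if z = x then y else \<one>\<^bsub>Y\<^esub>)"

definition spread :: "('x \<Rightarrow> int) \<Rightarrow> 'y \<Rightarrow> 'x \<Rightarrow> 'y" where
  "spread c y = (\<lambda>z\<in>carrier X. y [^]\<^bsub>Y\<^esub> c z)"

text \<open>The full product stands in for the direct sum of copies of \<open>Y\<close>. Relators
  have finite support, so they generate the same subgroup in either, and exponents of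
  \<open>W\<close> and \<open>Y\<close> carry over to the product at once.\<close>

definition ambient :: "('w \<times> ('x \<Rightarrow> 'y)) monoid" where
  "ambient = W \<times>\<times> product_group (carrier X) (\<lambda>_. Y)"

text \<open>A pair \<open>(w, g)\<close> stands for \<open>w - (\<Sum>x. x \<otimes> g x)\<close> in \<open>W \<oplus> (X \<otimes> Y)\<close>, so that the relators
  identify \<open>x \<otimes> r d\<close> with \<open>\<alpha> x d\<close> and \<open>p d \<otimes> y\<close> with \<open>\<gamma> d y\<close>. The case \<open>d = 1\<close> of the second
  kind makes \<open>\<otimes>\<close> additive in \<open>x\<close>.\<close>

definition relators :: "('w \<times> ('x \<Rightarrow> 'y)) set" where
  "relators = {(\<alpha> x d, point x (r d)) |x d. x \<in> carrier X \<and> d \<in> carrier E} \<union>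
     {(\<gamma> d y, spread c y) |d y c. d \<in> carrier E \<and> y \<in> carrier Y \<and> combination c (p d)}"

text \<open>A normal form for products of relators. All relators of the first kind at
  \<open>x\<close> are merged into the one element \<open>e x\<close>, by multiplicativity of
  \<alpha>; those of the second kind are kept as columns \<open>j < l\<close> with coefficients
  \<open>Q x j\<close>. The rows are indexed by the elements of \<open>X\<close> themselves. This is
  the shape of the data in \<open>balanced\<close>.\<close>

definition represents ::
  "'x set \<Rightarrow> ('x \<Rightarrow> 'e) \<Rightarrow> nat \<Rightarrow> ('x \<Rightarrow> nat \<Rightarrow> int) \<Rightarrow> (nat \<Rightarrow> 'e) \<Rightarrow> (nat \<Rightarrow> 'y) \<Rightarrow>
   'w \<times> ('x \<Rightarrow> 'y) \<Rightarrow> bool" where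
  "represents I e l Q d y u \<longleftrightarrow> finite I \<and> I \<subseteq> carrier X \<and> e \<in> UNIV \<rightarrow> carrier E \<and>
     (\<forall>x. x \<notin> I \<longrightarrow> e x = \<one>\<^bsub>E\<^esub> \<and> (\<forall>j. Q x j = 0)) \<and>
     d \<in> {..<l} \<rightarrow> carrier E \<and> y \<in> {..<l} \<rightarrow> carrier Y \<and>
     (\<forall>j<l. p (d j) = (\<Otimes>\<^bsub>X\<^esub>x\<in>I. x [^]\<^bsub>X\<^esub> Q x j)) \<and>
     fst u = (\<Otimes>\<^bsub>W\<^esub>x\<in>I. \<alpha> x (e x)) \<otimes>\<^bsub>W\<^esub> (\<Otimes>\<^bsub>W\<^esub>j\<in>{..<l}. \<gamma> (d j) (y j)) \<and>
     snd u = (\<lambda>x\<in>carrier X. r (e x) \<otimes>\<^bsub>Y\<^esub> (\<Otimes>\<^bsub>Y\<^esub>j\<in>{..<l}. y j [^]\<^bsub>Y\<^esub> Q x j))"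

lemma \<alpha>_mult_right:
  "x \<in> carrier X \<Longrightarrow> d \<in> carrier E \<Longrightarrow> e \<in> carrier E \<Longrightarrow> \<alpha> x (d \<otimes>\<^bsub>E\<^esub> e) = \<alpha> x d \<otimes>\<^bsub>W\<^esub> \<alpha> x e"
  using \<alpha>_right by (auto simp: hom_def)

lemma \<alpha>_one_right: "x \<in> carrier X \<Longrightarrow> \<alpha> x \<one>\<^bsub>E\<^esub> = \<one>\<^bsub>W\<^esub>"
  using hom_one[OF \<alpha>_right] by (simp add: E.is_group W.is_group)

sublocale ambient: comm_group ambient
  unfolding ambient_def
  by (intro comm_group_DirProd comm_group_product_group W.comm_group_axioms Y.comm_group_axioms)

lemma carrier_ambient: "carrier ambient = carrier W \<times> (carrier X \<rightarrow>\<^sub>E carrier Y)"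
  by (simp add: ambient_def)

lemma mult_ambient: "(w, g) \<otimes>\<^bsub>ambient\<^esub> (w', g') = (w \<otimes>\<^bsub>W\<^esub> w', \<lambda>x\<in>carrier X. g x \<otimes>\<^bsub>Y\<^esub> g' x)"
  by (simp add: ambient_def)

lemma one_ambient: "\<one>\<^bsub>ambient\<^esub> = (\<one>\<^bsub>W\<^esub>, \<lambda>x\<in>carrier X. \<one>\<^bsub>Y\<^esub>)"
  by (simp add: ambient_def)

lemma inv_ambient:
  assumes "w \<in> carrier W" "g \<in> carrier X \<rightarrow>\<^sub>E carrier Y"
  shows "inv\<^bsub>ambient\<^esub> (w, g) = (inv\<^bsub>W\<^esub> w, \<lambda>x\<in>carrier X. inv\<^bsub>Y\<^esub> (g x))"
  unfolding ambient_def
  using assms by (subst inv_DirProd) (auto simp: W.is_group Y.is_group)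

lemma point_closed: "y \<in> carrier Y \<Longrightarrow> point x y \<in> carrier X \<rightarrow>\<^sub>E carrier Y"
  by (auto simp: point_def)

lemma spread_closed: "y \<in> carrier Y \<Longrightarrow> spread c y \<in> carrier X \<rightarrow>\<^sub>E carrier Y"
  by (auto simp: spread_def)

lemma relators_subset: "relators \<subseteq> carrier ambient"
  unfolding relators_def carrier_ambient
  by (intro Un_least subsetI; elim CollectE exE conjE; simp add: point_closed spread_closed)

text \<open>This admits the induction over products of relators without inverse factors.\<close>

lemma relators_inv:
  assumes "h \<in> relators"
  shows "inv\<^bsub>ambient\<^esub> h \<in> relators"
  using assms unfolding relators_def
proof (elim UnE CollectE exE conjE)
  fix x d assume xd: "h = (\<alpha> x d, point x (r d))" "x \<in> carrier X" "d \<in> carrier E"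
  interpret a: group_hom E W "\<alpha> x" by unfold_locales (rule \<alpha>_right[OF xd(2)])
  have "inv\<^bsub>ambient\<^esub> h = (\<alpha> x (inv\<^bsub>E\<^esub> d), point x (r (inv\<^bsub>E\<^esub> d)))"
    using xd by (simp add: inv_ambient point_closed a.hom_inv) (auto simp: point_def)
  then show "inv\<^bsub>ambient\<^esub> h \<in> {(\<alpha> x d, point x (r d)) |x d. x \<in> carrier X \<and> d \<in> carrier E} \<union>
     {(\<gamma> d y, spread c y) |d y c. d \<in> carrier E \<and> y \<in> carrier Y \<and> combination c (p d)}"
    using xd by blast
next
  fix d y c assume h: "h = (\<gamma> d y, spread c y)" "d \<in> carrier E" "y \<in> carrier Y" "combination c (p d)"
  interpret a: group_hom Y W "\<gamma> d" by unfold_locales (rule \<gamma>_right[OF h(2)])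
  have "inv\<^bsub>ambient\<^esub> h = (\<gamma> d (inv\<^bsub>Y\<^esub> y), spread c (inv\<^bsub>Y\<^esub> y))"
    using h by (simp add: inv_ambient spread_closed a.hom_inv) (auto simp: spread_def Y.int_pow_inv)
  then show "inv\<^bsub>ambient\<^esub> h \<in> {(\<alpha> x d, point x (r d)) |x d. x \<in> carrier X \<and> d \<in> carrier E} \<union>
     {(\<gamma> d y, spread c y) |d y c. d \<in> carrier E \<and> y \<in> carrier Y \<and> combination c (p d)}"
    using h Y.inv_closed by blast
qed

text \<open>Rows outside \<open>I\<close> are trivial and contribute identity factors. Enlarging
  \<open>I\<close> makes room for the support of a further relator.\<close>

lemma represents_enlarge:
  assumes rep: "represents I e l Q d y u" and S: "finite S" "S \<subseteq> carrier X"
  shows "represents (I \<union> S) e l Q d y u"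
proof -
  have I: "finite I" "I \<subseteq> carrier X" "e \<in> UNIV \<rightarrow> carrier E"
    and out: "\<And>x. x \<notin> I \<Longrightarrow> e x = \<one>\<^bsub>E\<^esub>" "\<And>x j. x \<notin> I \<Longrightarrow> Q x j = 0"
    using rep by (auto simp: represents_def)
  have "(\<Otimes>\<^bsub>X\<^esub>x\<in>I. x [^]\<^bsub>X\<^esub> Q x j) = (\<Otimes>\<^bsub>X\<^esub>x\<in>I \<union> S. x [^]\<^bsub>X\<^esub> Q x j)" for j
    using I S out by (intro X.finprod_mono_neutral_cong_left) auto
  moreover have "(\<Otimes>\<^bsub>W\<^esub>x\<in>I. \<alpha> x (e x)) = (\<Otimes>\<^bsub>W\<^esub>x\<in>I \<union> S. \<alpha> x (e x))"
  proof (rule W.finprod_mono_neutral_cong_left)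
    show "\<alpha> x (e x) = \<one>\<^bsub>W\<^esub>" if "x \<in> I \<union> S - I" for x
      using that S out by (auto simp: \<alpha>_one_right)
  qed (use I S in \<open>auto intro!: \<alpha>_closed\<close>)
  ultimately show ?thesis using rep S unfolding represents_def by auto
qed

lemma represents_point:
  assumes rep: "represents I e l Q d y (w, g)" and x: "x \<in> carrier X" and d0: "d\<^sub>0 \<in> carrier E"
  shows "\<exists>I e. represents I e l Q d y ((\<alpha> x d\<^sub>0, point x (r d\<^sub>0)) \<otimes>\<^bsub>ambient\<^esub> (w, g))"
proof -
  have rep': "represents (insert x I) e l Q d y (w, g)"
    using represents_enlarge[OF rep, of "{x}"] x by simp
  let ?I = "insert x I"
  have I: "finite ?I" "?I \<subseteq> carrier X" and e: "\<And>z. e z \<in> carrier E"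
    and dy: "\<And>j. j < l \<Longrightarrow> d j \<in> carrier E" "\<And>j. j < l \<Longrightarrow> y j \<in> carrier Y"
    and w: "w = (\<Otimes>\<^bsub>W\<^esub>z\<in>?I. \<alpha> z (e z)) \<otimes>\<^bsub>W\<^esub> (\<Otimes>\<^bsub>W\<^esub>j\<in>{..<l}. \<gamma> (d j) (y j))"
    and g: "g = (\<lambda>z\<in>carrier X. r (e z) \<otimes>\<^bsub>Y\<^esub> (\<Otimes>\<^bsub>Y\<^esub>j\<in>{..<l}. y j [^]\<^bsub>Y\<^esub> Q z j))"
    using rep' by (auto simp: represents_def)
  \<comment> \<open>The new relator is merged into row \<open>x\<close>. The order of the two
    factors does not affect the images in the abelian groups \<open>W\<close> and
    \<open>Y\<close>.\<close>
  define e' where "e' = e(x := d\<^sub>0 \<otimes>\<^bsub>E\<^esub> e x)"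
  have "(\<Otimes>\<^bsub>W\<^esub>z\<in>?I. \<alpha> z (e' z))
    = (\<Otimes>\<^bsub>W\<^esub>z\<in>?I. (if z = x then \<alpha> z d\<^sub>0 else \<one>\<^bsub>W\<^esub>) \<otimes>\<^bsub>W\<^esub> \<alpha> z (e z))"
    using I e d0 x by (intro W.finprod_cong') (auto simp: e'_def \<alpha>_mult_right)
  also have "\<dots> = \<alpha> x d\<^sub>0 \<otimes>\<^bsub>W\<^esub> (\<Otimes>\<^bsub>W\<^esub>z\<in>?I. \<alpha> z (e z))"
  proof -
    have "(\<lambda>z. \<alpha> z d\<^sub>0) \<in> ?I \<rightarrow> carrier W" using I d0 by auto
    then show ?thesis
      using I e d0 W.finprod_singleton_swap[of x ?I "\<lambda>z. \<alpha> z d\<^sub>0"]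
      by (subst W.finprod_multf) auto
  qed
  finally have "(\<Otimes>\<^bsub>W\<^esub>z\<in>?I. \<alpha> z (e' z)) \<otimes>\<^bsub>W\<^esub> (\<Otimes>\<^bsub>W\<^esub>j\<in>{..<l}. \<gamma> (d j) (y j)) = \<alpha> x d\<^sub>0 \<otimes>\<^bsub>W\<^esub> w"
    using I e d0 x dy by (simp add: w W.m_assoc Pi_iff subset_iff)
  moreover have "(\<lambda>z\<in>carrier X. point x (r d\<^sub>0) z \<otimes>\<^bsub>Y\<^esub> g z)
    = (\<lambda>z\<in>carrier X. r (e' z) \<otimes>\<^bsub>Y\<^esub> (\<Otimes>\<^bsub>Y\<^esub>j\<in>{..<l}. y j [^]\<^bsub>Y\<^esub> Q z j))"
  proof (rule restrict_ext)
    fix z assume "z \<in> carrier X"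
    moreover have "(\<Otimes>\<^bsub>Y\<^esub>j\<in>{..<l}. y j [^]\<^bsub>Y\<^esub> Q z j) \<in> carrier Y"
      using dy by (intro Y.finprod_closed) auto
    ultimately show "point x (r d\<^sub>0) z \<otimes>\<^bsub>Y\<^esub> g z = r (e' z) \<otimes>\<^bsub>Y\<^esub> (\<Otimes>\<^bsub>Y\<^esub>j\<in>{..<l}. y j [^]\<^bsub>Y\<^esub> Q z j)"
      using e d0 by (auto simp: point_def g e'_def Y.m_assoc r.hom_closed)
  qed
  moreover have "e' \<in> UNIV \<rightarrow> carrier E" using e d0 by (auto simp: e'_def)
  ultimately have "represents ?I e' l Q d y ((\<alpha> x d\<^sub>0, point x (r d\<^sub>0)) \<otimes>\<^bsub>ambient\<^esub> (w, g))"
    using rep' by (auto simp: represents_def mult_ambient e'_def)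
  then show ?thesis by blast
qed

lemma represents_spread:
  assumes rep: "represents I e l Q d y (w, g)" and d0: "d\<^sub>0 \<in> carrier E" and y0: "y\<^sub>0 \<in> carrier Y"
    and c: "combination c (p d\<^sub>0)"
  shows "\<exists>I l Q d y. represents I e l Q d y ((\<gamma> d\<^sub>0 y\<^sub>0, spread c y\<^sub>0) \<otimes>\<^bsub>ambient\<^esub> (w, g))"
proof -
  obtain S where S: "finite S" "S \<subseteq> carrier X" "\<And>z. z \<notin> S \<Longrightarrow> c z = 0"
    "(\<Otimes>\<^bsub>X\<^esub>z\<in>S. z [^]\<^bsub>X\<^esub> c z) = p d\<^sub>0"
    using c by (auto simp: combination_def)
  let ?I = "I \<union> S"
  have rep': "represents ?I e l Q d y (w, g)" by (rule represents_enlarge[OF rep S(1,2)])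
  have I: "finite ?I" "?I \<subseteq> carrier X" and e: "\<And>z. e z \<in> carrier E"
    and dy: "\<And>j. j < l \<Longrightarrow> d j \<in> carrier E" "\<And>j. j < l \<Longrightarrow> y j \<in> carrier Y"
    and pd: "\<And>j. j < l \<Longrightarrow> p (d j) = (\<Otimes>\<^bsub>X\<^esub>x\<in>?I. x [^]\<^bsub>X\<^esub> Q x j)"
    and w: "w = (\<Otimes>\<^bsub>W\<^esub>z\<in>?I. \<alpha> z (e z)) \<otimes>\<^bsub>W\<^esub> (\<Otimes>\<^bsub>W\<^esub>j\<in>{..<l}. \<gamma> (d j) (y j))"
    and g: "g = (\<lambda>z\<in>carrier X. r (e z) \<otimes>\<^bsub>Y\<^esub> (\<Otimes>\<^bsub>Y\<^esub>j\<in>{..<l}. y j [^]\<^bsub>Y\<^esub> Q z j))"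
    using rep' by (auto simp: represents_def)
  \<comment> \<open>The new relator becomes column \<open>l\<close>, with \<open>c\<close> as its
    coefficients, so that the columns now run up to \<open>Suc l\<close>.\<close>
  define d' where "d' = d(l := d\<^sub>0)"
  define y' where "y' = y(l := y\<^sub>0)"
  define Q' where "Q' = (\<lambda>x. (Q x)(l := c x))"
  have pd': "p (d' j) = (\<Otimes>\<^bsub>X\<^esub>x\<in>?I. x [^]\<^bsub>X\<^esub> Q' x j)" if "j < Suc l" for j
  proof (cases "j = l")
    case True
    have "(\<Otimes>\<^bsub>X\<^esub>z\<in>S. z [^]\<^bsub>X\<^esub> c z) = (\<Otimes>\<^bsub>X\<^esub>z\<in>?I. z [^]\<^bsub>X\<^esub> c z)"
      using I S by (intro X.finprod_mono_neutral_cong_left) auto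
    then show ?thesis using True S by (simp add: d'_def Q'_def)
  next
    case False
    then show ?thesis using that pd by (simp add: d'_def Q'_def)
  qed
  have prodY: "(\<Otimes>\<^bsub>Y\<^esub>j\<in>{..<Suc l}. y' j [^]\<^bsub>Y\<^esub> Q' z j)
      = y\<^sub>0 [^]\<^bsub>Y\<^esub> c z \<otimes>\<^bsub>Y\<^esub> (\<Otimes>\<^bsub>Y\<^esub>j\<in>{..<l}. y j [^]\<^bsub>Y\<^esub> Q z j)" for z
  proof -
    have "(\<Otimes>\<^bsub>Y\<^esub>j\<in>{..<l}. y' j [^]\<^bsub>Y\<^esub> Q' z j) = (\<Otimes>\<^bsub>Y\<^esub>j\<in>{..<l}. y j [^]\<^bsub>Y\<^esub> Q z j)"
      using dy by (intro Y.finprod_cong') (auto simp: y'_def Q'_def)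
    then show ?thesis
      using dy y0 by (simp add: lessThan_Suc Pi_iff) (simp add: y'_def Q'_def)
  qed
  have prodW: "(\<Otimes>\<^bsub>W\<^esub>j\<in>{..<Suc l}. \<gamma> (d' j) (y' j))
      = \<gamma> d\<^sub>0 y\<^sub>0 \<otimes>\<^bsub>W\<^esub> (\<Otimes>\<^bsub>W\<^esub>j\<in>{..<l}. \<gamma> (d j) (y j))"
  proof -
    have "(\<Otimes>\<^bsub>W\<^esub>j\<in>{..<l}. \<gamma> (d' j) (y' j)) = (\<Otimes>\<^bsub>W\<^esub>j\<in>{..<l}. \<gamma> (d j) (y j))"
      using dy by (intro W.finprod_cong') (auto simp: y'_def d'_def)
    then show ?thesis
      using dy y0 d0 by (simp add: lessThan_Suc Pi_iff) (simp add: y'_def d'_def)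
  qed
  have "(\<Otimes>\<^bsub>W\<^esub>z\<in>?I. \<alpha> z (e z)) \<otimes>\<^bsub>W\<^esub> (\<Otimes>\<^bsub>W\<^esub>j\<in>{..<Suc l}. \<gamma> (d' j) (y' j)) = \<gamma> d\<^sub>0 y\<^sub>0 \<otimes>\<^bsub>W\<^esub> w"
  proof -
    have "(\<Otimes>\<^bsub>W\<^esub>z\<in>?I. \<alpha> z (e z)) \<in> carrier W" "(\<Otimes>\<^bsub>W\<^esub>j\<in>{..<l}. \<gamma> (d j) (y j)) \<in> carrier W"
      using I e dy by (auto intro!: W.finprod_closed)
    then show ?thesis using d0 y0 by (simp only: prodW w) (simp add: W.m_lcomm)
  qed
  moreover have "(\<lambda>z\<in>carrier X. spread c y\<^sub>0 z \<otimes>\<^bsub>Y\<^esub> g z)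
    = (\<lambda>z\<in>carrier X. r (e z) \<otimes>\<^bsub>Y\<^esub> (\<Otimes>\<^bsub>Y\<^esub>j\<in>{..<Suc l}. y' j [^]\<^bsub>Y\<^esub> Q' z j))"
  proof (rule restrict_ext)
    fix z assume "z \<in> carrier X"
    moreover have "(\<Otimes>\<^bsub>Y\<^esub>j\<in>{..<l}. y j [^]\<^bsub>Y\<^esub> Q z j) \<in> carrier Y"
      using dy by (intro Y.finprod_closed) auto
    ultimately show "spread c y\<^sub>0 z \<otimes>\<^bsub>Y\<^esub> g z
        = r (e z) \<otimes>\<^bsub>Y\<^esub> (\<Otimes>\<^bsub>Y\<^esub>j\<in>{..<Suc l}. y' j [^]\<^bsub>Y\<^esub> Q' z j)"
      using e y0 by (simp only: prodY) (simp add: spread_def g Y.m_lcomm)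
  qed
  moreover have "\<forall>x. x \<notin> ?I \<longrightarrow> e x = \<one>\<^bsub>E\<^esub> \<and> (\<forall>j. Q' x j = 0)"
    using rep' S by (auto simp: represents_def Q'_def)
  ultimately have "represents ?I e (Suc l) Q' d' y' ((\<gamma> d\<^sub>0 y\<^sub>0, spread c y\<^sub>0) \<otimes>\<^bsub>ambient\<^esub> (w, g))"
    unfolding represents_def using I e dy d0 y0 pd'
    by (auto simp: mult_ambient d'_def y'_def less_Suc_eq)
  then show ?thesis by blast
qed

lemma represents_generate:
  assumes "u \<in> generate ambient relators"
  shows "\<exists>I e l Q d y. represents I e l Q d y u"
proof -
  have inv: "\<forall>h\<in>relators. inv\<^bsub>ambient\<^esub> h \<in> relators" using relators_inv by blast
  show ?thesis
    using assms relators_subset inv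
  proof (induction rule: ambient.generate_left_induct)
    case one
    have "represents {} (\<lambda>_. \<one>\<^bsub>E\<^esub>) 0 (\<lambda>_ _. 0) (\<lambda>_. \<one>\<^bsub>E\<^esub>) (\<lambda>_. \<one>\<^bsub>Y\<^esub>) \<one>\<^bsub>ambient\<^esub>"
      by (auto simp: represents_def one_ambient)
    then show ?case by blast
  next
    case (mult h u)
    obtain w g where u: "u = (w, g)" by fastforce
    obtain I e l Q d y where rep: "represents I e l Q d y (w, g)" using mult(3) u by blast
    consider x d\<^sub>0 where "h = (\<alpha> x d\<^sub>0, point x (r d\<^sub>0))" "x \<in> carrier X" "d\<^sub>0 \<in> carrier E"
      | d\<^sub>0 y\<^sub>0 c where "h = (\<gamma> d\<^sub>0 y\<^sub>0, spread c y\<^sub>0)" "d\<^sub>0 \<in> carrier E" "y\<^sub>0 \<in> carrier Y"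
          "combination c (p d\<^sub>0)"
      using mult(1) by (auto simp: relators_def)
    then show ?case
    proof cases
      case 1
      then show ?thesis using represents_point[OF rep] u by metis
    next
      case 2
      then show ?thesis using represents_spread[OF rep] u by metis
      qed
qed
qed

text \<open>This is where the balancing condition enters: the relations imposed to extend the
  pairings do not collapse \<open>W\<close>.\<close>

lemma generate_relators_trivial:
  assumes "(w, \<lambda>x\<in>carrier X. \<one>\<^bsub>Y\<^esub>) \<in> generate ambient relators"
  shows "w = \<one>\<^bsub>W\<^esub>"
proof -
  obtain I e l Q d y where rep: "represents I e l Q d y (w, \<lambda>x\<in>carrier X. \<one>\<^bsub>Y\<^esub>)"
    using represents_generate[OF assms] by blast
  have I: "finite I" "I \<subseteq> carrier X" and e: "\<And>z. e z \<in> carrier E"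
    and dy: "\<And>j. j < l \<Longrightarrow> d j \<in> carrier E" "\<And>j. j < l \<Longrightarrow> y j \<in> carrier Y"
    and pd: "\<And>j. j < l \<Longrightarrow> p (d j) = (\<Otimes>\<^bsub>X\<^esub>x\<in>I. x [^]\<^bsub>X\<^esub> Q x j)"
    and w: "w = (\<Otimes>\<^bsub>W\<^esub>z\<in>I. \<alpha> z (e z)) \<otimes>\<^bsub>W\<^esub> (\<Otimes>\<^bsub>W\<^esub>j\<in>{..<l}. \<gamma> (d j) (y j))"
    and g: "(\<lambda>x\<in>carrier X. \<one>\<^bsub>Y\<^esub>) = (\<lambda>z\<in>carrier X. r (e z) \<otimes>\<^bsub>Y\<^esub> (\<Otimes>\<^bsub>Y\<^esub>j\<in>{..<l}. y j [^]\<^bsub>Y\<^esub> Q z j))"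
    using rep by (auto simp: represents_def)
  \<comment> \<open>The vanishing second component is solved for \<open>r (e x)\<close>. This puts
    the inverses of the \<open>y j\<close> into the role of the column elements of
    \<open>balanced\<close>.\<close>
  have re: "r (e x) = (\<Otimes>\<^bsub>Y\<^esub>j\<in>{..<l}. inv\<^bsub>Y\<^esub> (y j) [^]\<^bsub>Y\<^esub> Q x j)" if "x \<in> I" for x
  proof -
    let ?c = "\<Otimes>\<^bsub>Y\<^esub>j\<in>{..<l}. y j [^]\<^bsub>Y\<^esub> Q x j"
    have c: "?c \<in> carrier Y" using dy by (intro Y.finprod_closed) auto
    have "r (e x) \<otimes>\<^bsub>Y\<^esub> ?c = \<one>\<^bsub>Y\<^esub>" using fun_cong[OF g, of x] that I by auto
    then have "r (e x) = inv\<^bsub>Y\<^esub> ?c" using c e by (simp add: Y.inv_equality)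
    also have "\<dots> = (\<Otimes>\<^bsub>Y\<^esub>j\<in>{..<l}. inv\<^bsub>Y\<^esub> (y j [^]\<^bsub>Y\<^esub> Q x j))"
      using dy by (intro Y.finprod_inv) auto
    also have "\<dots> = (\<Otimes>\<^bsub>Y\<^esub>j\<in>{..<l}. inv\<^bsub>Y\<^esub> (y j) [^]\<^bsub>Y\<^esub> Q x j)"
      using dy by (intro Y.finprod_cong') (auto simp: Y.int_pow_inv)
    finally show ?thesis .
  qed
  \<comment> \<open>Each row index is its own element of \<open>X\<close>, hence the identity
    function as the family \<open>x\<close>. Because the \<open>y j\<close> are inverted, the
    \<alpha>-part comes out as the inverse of the \<gamma>-part.\<close>
  have "balanced I {..<l} Q" using I by (intro balancedI) auto
  then have "(\<Otimes>\<^bsub>W\<^esub>x\<in>I. \<alpha> x (e x)) = (\<Otimes>\<^bsub>W\<^esub>j\<in>{..<l}. \<gamma> (d j) (inv\<^bsub>Y\<^esub> (y j)))"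
    unfolding balanced_def using I e dy pd re
    by (elim ballE[of _ _ "\<lambda>x. x"] ballE[of _ _ "\<lambda>j. inv\<^bsub>Y\<^esub> (y j)"] ballE[of _ _ d] ballE[of _ _ e]) auto
  also have "\<dots> = (\<Otimes>\<^bsub>W\<^esub>j\<in>{..<l}. inv\<^bsub>W\<^esub> \<gamma> (d j) (y j))"
  proof (rule W.finprod_cong')
    fix j assume "j \<in> {..<l}"
    then have j: "d j \<in> carrier E" "y j \<in> carrier Y" using dy by auto
    interpret a: group_hom Y W "\<gamma> (d j)" by unfold_locales (rule \<gamma>_right[OF j(1)])
    show "\<gamma> (d j) (inv\<^bsub>Y\<^esub> (y j)) = inv\<^bsub>W\<^esub> \<gamma> (d j) (y j)" using j by simp
  qed (use dy in auto)
  also have "\<dots> = inv\<^bsub>W\<^esub> (\<Otimes>\<^bsub>W\<^esub>j\<in>{..<l}. \<gamma> (d j) (y j))"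
    using dy by (intro W.finprod_inv[symmetric]) auto
  finally show ?thesis
    using dy by (simp add: w Pi_iff)
qed

section \<open>Formal combinations and the common extension\<close>

lemma combination_unit:
  assumes "u \<in> carrier X"
  shows "combination (\<lambda>z. if z = u then 1 else 0) u"
  unfolding combination_def using assms by (intro exI[of _ "{u}"]) auto

lemma combination_add:
  assumes "combination c u" "combination c' u'"
  shows "combination (\<lambda>z. c z + c' z) (u \<otimes>\<^bsub>X\<^esub> u')"
proof -
  obtain S S' where S: "finite S" "S \<subseteq> carrier X" "\<forall>z. z \<notin> S \<longrightarrow> c z = 0"
    "(\<Otimes>\<^bsub>X\<^esub>z\<in>S. z [^]\<^bsub>X\<^esub> c z) = u"
    and S': "finite S'" "S' \<subseteq> carrier X" "\<forall>z. z \<notin> S' \<longrightarrow> c' z = 0"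
    "(\<Otimes>\<^bsub>X\<^esub>z\<in>S'. z [^]\<^bsub>X\<^esub> c' z) = u'"
    using assms unfolding combination_def by auto
  have "(\<Otimes>\<^bsub>X\<^esub>z\<in>S. z [^]\<^bsub>X\<^esub> c z) = (\<Otimes>\<^bsub>X\<^esub>z\<in>S \<union> S'. z [^]\<^bsub>X\<^esub> c z)"
    using S S' by (intro X.finprod_mono_neutral_cong_left) auto
  moreover have "(\<Otimes>\<^bsub>X\<^esub>z\<in>S'. z [^]\<^bsub>X\<^esub> c' z) = (\<Otimes>\<^bsub>X\<^esub>z\<in>S \<union> S'. z [^]\<^bsub>X\<^esub> c' z)"
    using S S' by (intro X.finprod_mono_neutral_cong_left) auto
  moreover have "(\<Otimes>\<^bsub>X\<^esub>z\<in>S \<union> S'. z [^]\<^bsub>X\<^esub> (c z + c' z))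
    = (\<Otimes>\<^bsub>X\<^esub>z\<in>S \<union> S'. z [^]\<^bsub>X\<^esub> c z \<otimes>\<^bsub>X\<^esub> z [^]\<^bsub>X\<^esub> c' z)"
    using S S' by (intro X.finprod_cong') (auto simp: X.int_pow_mult)
  ultimately have "(\<Otimes>\<^bsub>X\<^esub>z\<in>S \<union> S'. z [^]\<^bsub>X\<^esub> (c z + c' z)) = u \<otimes>\<^bsub>X\<^esub> u'"
    using S S' by (subst (asm) X.finprod_multf) auto
  then show ?thesis
    unfolding combination_def using S S' by (intro exI[of _ "S \<union> S'"]) auto
qed

lemma combination_uminus:
  assumes "combination c u"
  shows "combination (\<lambda>z. - c z) (inv\<^bsub>X\<^esub> u)"
proof -
  obtain S where S: "finite S" "S \<subseteq> carrier X" "\<forall>z. z \<notin> S \<longrightarrow> c z = 0"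
    "(\<Otimes>\<^bsub>X\<^esub>z\<in>S. z [^]\<^bsub>X\<^esub> c z) = u"
    using assms unfolding combination_def by auto
  have "(\<Otimes>\<^bsub>X\<^esub>z\<in>S. z [^]\<^bsub>X\<^esub> (- c z)) = (\<Otimes>\<^bsub>X\<^esub>z\<in>S. inv\<^bsub>X\<^esub> (z [^]\<^bsub>X\<^esub> c z))"
    using S by (intro X.finprod_cong') (auto simp: X.int_pow_neg)
  also have "\<dots> = inv\<^bsub>X\<^esub> u"
    using S by (subst X.finprod_inv[symmetric]) auto
  finally show ?thesis unfolding combination_def using S by (intro exI[of _ S]) auto
qed

text \<open>\<open>V\<close> is \<open>ambient\<close> modulo the relators, and \<beta> is the class
  of an elementary tensor. The relators force bilinearity and the prescribed values, so the real
  content is injectivity of \<open>j\<close>, which is \<open>generate_relators_trivial\<close>. The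
  last clause holds because \<open>V\<close> is a quotient of a product of \<open>W\<close> and
  copies of \<open>Y\<close>.\<close>

theorem common_extension:
  obtains V :: "('w \<times> ('x \<Rightarrow> 'y)) set monoid" and j \<beta>
  where "comm_group V" "j \<in> mon W V"
    "\<And>y. y \<in> carrier Y \<Longrightarrow> (\<lambda>x. \<beta> x y) \<in> hom X V"
    "\<And>x. x \<in> carrier X \<Longrightarrow> \<beta> x \<in> hom Y V"
    "\<And>x d. x \<in> carrier X \<Longrightarrow> d \<in> carrier E \<Longrightarrow> \<beta> x (r d) = j (\<alpha> x d)"
    "\<And>d y. d \<in> carrier E \<Longrightarrow> y \<in> carrier Y \<Longrightarrow> \<beta> (p d) y = j (\<gamma> d y)"
    "\<And>k::nat. (\<forall>w\<in>carrier W. w [^]\<^bsub>W\<^esub> k = \<one>\<^bsub>W\<^esub>) \<Longrightarrow> (\<forall>y\<in>carrier Y. y [^]\<^bsub>Y\<^esub> k = \<one>\<^bsub>Y\<^esub>) \<Longrightarrow>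
       \<forall>v\<in>carrier V. v [^]\<^bsub>V\<^esub> k = \<one>\<^bsub>V\<^esub>"
proof -
  define R where "R = generate ambient relators"
  have sub: "subgroup R ambient" unfolding R_def by (rule ambient.generate_is_subgroup[OF relators_subset])
  interpret R: normal R ambient using sub by (simp add: ambient.normal_iff_subgroup)
  define V where "V = ambient Mod R"
  interpret V: comm_group V unfolding V_def by (rule ambient.abelian_FactGroup[OF sub])
  define \<pi> where "\<pi> = (\<lambda>u. R #>\<^bsub>ambient\<^esub> u)"
  interpret \<pi>: group_hom ambient V \<pi>
    by unfold_locales (use R.r_coset_hom_Mod in \<open>simp add: V_def \<pi>_def\<close>)
  have kernel: "\<pi> h = \<one>\<^bsub>V\<^esub> \<longleftrightarrow> h \<in> R" if "h \<in> carrier ambient" for h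
    using R.coset_eq_self_iff[OF that] by (simp add: \<pi>_def V_def)
  have eqI: "\<pi> u = \<pi> v" if "h \<in> relators" "v \<in> carrier ambient" "h \<otimes>\<^bsub>ambient\<^esub> v = u" for h u v
  proof -
    have h: "h \<in> carrier ambient" "h \<in> R"
      using that(1) relators_subset by (auto simp: R_def intro: generate.incl)
    have "\<pi> u = \<pi> h \<otimes>\<^bsub>V\<^esub> \<pi> v"
      unfolding that(3)[symmetric] using h(1) that(2) by (rule \<pi>.hom_mult)
    then show ?thesis using kernel[OF h(1)] h(2) that(2) by simp
  qed
  define j where "j w = \<pi> (w, \<lambda>x\<in>carrier X. \<one>\<^bsub>Y\<^esub>)" for w
  \<comment> \<open>The second component enters with a negative sign, so the tensor of
    \<open>x\<close> and \<open>y\<close> is represented by the inverse of \<open>y\<close>.\<close>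
  define \<beta> where "\<beta> x y = \<pi> (\<one>\<^bsub>W\<^esub>, point x (inv\<^bsub>Y\<^esub> y))" for x y
  have unit: "(\<lambda>x\<in>carrier X. \<one>\<^bsub>Y\<^esub>) \<in> carrier X \<rightarrow>\<^sub>E carrier Y" by auto
  have pt: "(\<one>\<^bsub>W\<^esub>, point x y) \<in> carrier ambient" if "y \<in> carrier Y" for x y
    using that point_closed by (simp add: carrier_ambient)
  have j: "j \<in> hom W V"
  proof (rule homI)
    fix w w' assume w: "w \<in> carrier W" "w' \<in> carrier W"
    then have "(w \<otimes>\<^bsub>W\<^esub> w', \<lambda>x\<in>carrier X. \<one>\<^bsub>Y\<^esub>)
      = (w, \<lambda>x\<in>carrier X. \<one>\<^bsub>Y\<^esub>) \<otimes>\<^bsub>ambient\<^esub> (w', \<lambda>x\<in>carrier X. \<one>\<^bsub>Y\<^esub>)"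
      by (auto simp: mult_ambient)
    then show "j (w \<otimes>\<^bsub>W\<^esub> w') = j w \<otimes>\<^bsub>V\<^esub> j w'"
      using w unit by (simp add: j_def carrier_ambient)
  qed (use unit in \<open>simp add: j_def carrier_ambient\<close>)
  interpret j: group_hom W V j by unfold_locales (rule j)
  show thesis
  proof (rule that)
    show "comm_group V" by (rule V.comm_group_axioms)
    have "w = \<one>\<^bsub>W\<^esub>" if "w \<in> carrier W" "j w = \<one>\<^bsub>V\<^esub>" for w
    proof -
      have "(w, \<lambda>x\<in>carrier X. \<one>\<^bsub>Y\<^esub>) \<in> R"
        using that unit kernel[of "(w, \<lambda>x\<in>carrier X. \<one>\<^bsub>Y\<^esub>)"] by (simp add: j_def carrier_ambient)
      then show ?thesis unfolding R_def by (rule generate_relators_trivial)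
    qed
    then have "inj_on j (carrier W)"
      using j.inj_on_one_iff by blast
    then show "j \<in> mon W V" using j by (simp add: mon_def)
  next
    fix y assume y: "y \<in> carrier Y"
    show "(\<lambda>x. \<beta> x y) \<in> hom X V"
    proof (rule homI)
      fix x x' assume x: "x \<in> carrier X" "x' \<in> carrier X"
      let ?u = "x \<otimes>\<^bsub>X\<^esub> x'"
      \<comment> \<open>The formal combination \<open>[x] + [x'] - [x x']\<close> evaluates to the
        identity, which is \<open>p\<close> of the identity of \<open>E\<close>. Its relator is
        therefore exactly additivity in the first argument.\<close>
      define c where "c = (\<lambda>z. (if z = x then 1 else 0) + (if z = x' then 1 else 0)
        + - (if z = ?u then 1 else (0::int)))"
      have "combination c (x \<otimes>\<^bsub>X\<^esub> x' \<otimes>\<^bsub>X\<^esub> inv\<^bsub>X\<^esub> ?u)"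
        unfolding c_def using x by (intro combination_add combination_uminus combination_unit) auto
      then have "combination c (p \<one>\<^bsub>E\<^esub>)" using x by simp
      then have rel: "(\<gamma> \<one>\<^bsub>E\<^esub> y, spread c y) \<in> relators"
        unfolding relators_def using y by blast
      have "spread c y z \<otimes>\<^bsub>Y\<^esub> (point x (inv\<^bsub>Y\<^esub> y) z \<otimes>\<^bsub>Y\<^esub> point x' (inv\<^bsub>Y\<^esub> y) z) = point ?u (inv\<^bsub>Y\<^esub> y) z"
        if z: "z \<in> carrier X" for z
      proof -
        \<comment> \<open>The elements \<open>x\<close>, \<open>x'\<close> and their product may
          coincide. Writing the values at \<open>z\<close> through \<open>t\<close> treats all
          coincidences uniformly.\<close>
        define t where "t v = (if z = v then y else \<one>\<^bsub>Y\<^esub>)" for v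
        have t: "t v \<in> carrier Y" for v using y by (simp add: t_def)
        have pt': "point v (inv\<^bsub>Y\<^esub> y) z = inv\<^bsub>Y\<^esub> t v" for v using z by (simp add: t_def point_def)
        have sp: "spread c y z = t x \<otimes>\<^bsub>Y\<^esub> t x' \<otimes>\<^bsub>Y\<^esub> inv\<^bsub>Y\<^esub> t ?u"
        proof -
          have "y [^]\<^bsub>Y\<^esub> (if z = v then 1 else (0::int)) = t v" for v using y by (simp add: t_def)
          then show ?thesis
            using y z by (simp only: spread_def c_def restrict_apply' Y.int_pow_mult Y.int_pow_neg)
        qed
        have cancel: "t x \<otimes>\<^bsub>Y\<^esub> t x' \<otimes>\<^bsub>Y\<^esub> i \<otimes>\<^bsub>Y\<^esub> (inv\<^bsub>Y\<^esub> t x \<otimes>\<^bsub>Y\<^esub> inv\<^bsub>Y\<^esub> t x') = i"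
          if "i \<in> carrier Y" for i
          using Y.inv_mult[of "t x" "t x'"] Y.m_comm[of "t x \<otimes>\<^bsub>Y\<^esub> t x'" i]
            Y.m_assoc[of i "t x \<otimes>\<^bsub>Y\<^esub> t x'" "inv\<^bsub>Y\<^esub> (t x \<otimes>\<^bsub>Y\<^esub> t x')"]
            Y.r_inv[of "t x \<otimes>\<^bsub>Y\<^esub> t x'"] t that by simp
        show ?thesis unfolding pt' sp using t by (intro cancel) simp
      qed
      then have "(\<lambda>z\<in>carrier X. spread c y z \<otimes>\<^bsub>Y\<^esub>
          (\<lambda>z\<in>carrier X. point x (inv\<^bsub>Y\<^esub> y) z \<otimes>\<^bsub>Y\<^esub> point x' (inv\<^bsub>Y\<^esub> y) z) z) = point ?u (inv\<^bsub>Y\<^esub> y)"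
        by (intro extensionalityI[of _ "carrier X"]) (simp_all add: point_def)
      then have "(\<gamma> \<one>\<^bsub>E\<^esub> y, spread c y) \<otimes>\<^bsub>ambient\<^esub>
          ((\<one>\<^bsub>W\<^esub>, point x (inv\<^bsub>Y\<^esub> y)) \<otimes>\<^bsub>ambient\<^esub> (\<one>\<^bsub>W\<^esub>, point x' (inv\<^bsub>Y\<^esub> y)))
        = (\<one>\<^bsub>W\<^esub>, point ?u (inv\<^bsub>Y\<^esub> y))"
        by (simp only: mult_ambient \<gamma>_one_left[OF y] W.l_one[OF W.one_closed])
      then have "\<pi> (\<one>\<^bsub>W\<^esub>, point ?u (inv\<^bsub>Y\<^esub> y))
        = \<pi> ((\<one>\<^bsub>W\<^esub>, point x (inv\<^bsub>Y\<^esub> y)) \<otimes>\<^bsub>ambient\<^esub> (\<one>\<^bsub>W\<^esub>, point x' (inv\<^bsub>Y\<^esub> y)))"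
        by (rule eqI[OF rel, rotated]) (intro ambient.m_closed pt Y.inv_closed y)
      also have "\<dots> = \<beta> x y \<otimes>\<^bsub>V\<^esub> \<beta> x' y"
        unfolding \<beta>_def by (intro \<pi>.hom_mult pt Y.inv_closed y)
      finally show "\<beta> ?u y = \<beta> x y \<otimes>\<^bsub>V\<^esub> \<beta> x' y" by (simp only: \<beta>_def)
    qed (use y pt in \<open>simp add: \<beta>_def\<close>)
  next
    fix x assume x: "x \<in> carrier X"
    show "\<beta> x \<in> hom Y V"
    proof (rule homI)
      fix y y' assume y: "y \<in> carrier Y" "y' \<in> carrier Y"
      then have "(\<one>\<^bsub>W\<^esub>, point x (inv\<^bsub>Y\<^esub> (y \<otimes>\<^bsub>Y\<^esub> y')))
        = (\<one>\<^bsub>W\<^esub>, point x (inv\<^bsub>Y\<^esub> y)) \<otimes>\<^bsub>ambient\<^esub> (\<one>\<^bsub>W\<^esub>, point x (inv\<^bsub>Y\<^esub> y'))"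
        by (auto simp: mult_ambient point_def Y.inv_mult)
      then show "\<beta> x (y \<otimes>\<^bsub>Y\<^esub> y') = \<beta> x y \<otimes>\<^bsub>V\<^esub> \<beta> x y'"
        using y pt by (simp add: \<beta>_def)
    qed (use pt in \<open>simp add: \<beta>_def\<close>)
  next
    fix x d assume xd: "x \<in> carrier X" "d \<in> carrier E"
    then have rel: "(\<alpha> x d, point x (r d)) \<in> relators"
      unfolding relators_def by blast
    have "(\<alpha> x d, point x (r d)) \<otimes>\<^bsub>ambient\<^esub> (\<one>\<^bsub>W\<^esub>, point x (inv\<^bsub>Y\<^esub> r d)) = (\<alpha> x d, \<lambda>x\<in>carrier X. \<one>\<^bsub>Y\<^esub>)"
      using xd by (simp add: mult_ambient) (auto simp: point_def)
    then show "\<beta> x (r d) = j (\<alpha> x d)"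
      unfolding \<beta>_def j_def using xd by (intro eqI[OF rel, symmetric] pt) auto
  next
    fix d y assume dy: "d \<in> carrier E" "y \<in> carrier Y"
    define c where "c z = (if z = p d then 1 else (0::int))" for z
    have "combination c (p d)"
      unfolding c_def using dy by (intro combination_unit) auto
    then have rel: "(\<gamma> d y, spread c y) \<in> relators"
      unfolding relators_def using dy by blast
    have "(\<gamma> d y, spread c y) \<otimes>\<^bsub>ambient\<^esub> (\<one>\<^bsub>W\<^esub>, point (p d) (inv\<^bsub>Y\<^esub> y)) = (\<gamma> d y, \<lambda>x\<in>carrier X. \<one>\<^bsub>Y\<^esub>)"
      using dy by (simp add: mult_ambient) (auto simp: point_def spread_def c_def)
    then show "\<beta> (p d) y = j (\<gamma> d y)"
      unfolding \<beta>_def j_def using dy by (intro eqI[OF rel, symmetric] pt) auto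
  next
    fix k :: nat
    assume k: "\<forall>w\<in>carrier W. w [^]\<^bsub>W\<^esub> k = \<one>\<^bsub>W\<^esub>" "\<forall>y\<in>carrier Y. y [^]\<^bsub>Y\<^esub> k = \<one>\<^bsub>Y\<^esub>"
    show "\<forall>v\<in>carrier V. v [^]\<^bsub>V\<^esub> k = \<one>\<^bsub>V\<^esub>"
    proof
      fix v assume "v \<in> carrier V"
      then obtain u where u: "u \<in> carrier ambient" "v = \<pi> u"
        by (auto simp: V_def carrier_FactGroup \<pi>_def)
      obtain w g where wg: "u = (w, g)" by fastforce
      have "u [^]\<^bsub>ambient\<^esub> k = \<one>\<^bsub>ambient\<^esub>"
        using u(1) k wg by (auto simp: ambient_def pow_DirProd pow_product_group PiE_iff intro!: restrict_ext)
      then show "v [^]\<^bsub>V\<^esub> k = \<one>\<^bsub>V\<^esub>"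
        using u \<pi>.hom_nat_pow[OF u(1), of k] by simp
    qed
  qed
qed

end

section \<open>Groups of class two\<close>

lemma (in group) centerD: "c \<in> center G \<Longrightarrow> x \<in> carrier G \<Longrightarrow> c \<otimes> x = x \<otimes> c"
  unfolding center_def by blast

lemma (in group) center_carrier: "c \<in> center G \<Longrightarrow> c \<in> carrier G"
  unfolding center_def by blast

lemma (in group) center_subgroup: "subgroup (center G) G"
proof
  fix x y assume xy: "x \<in> center G" "y \<in> center G"
  have "x \<otimes> y \<otimes> z = z \<otimes> (x \<otimes> y)" if z: "z \<in> carrier G" for z
  proof -
    have c: "x \<in> carrier G" "y \<in> carrier G" "x \<otimes> z = z \<otimes> x" "y \<otimes> z = z \<otimes> y"
      using xy z centerD center_carrier by blast+
    have "x \<otimes> y \<otimes> z = x \<otimes> (z \<otimes> y)" using c(1,2) z by (simp only: m_assoc c(4))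
    also have "\<dots> = x \<otimes> z \<otimes> y" using c(1,2) z by (simp only: m_assoc)
    also have "\<dots> = z \<otimes> x \<otimes> y" by (simp only: c(3))
    also have "\<dots> = z \<otimes> (x \<otimes> y)" using c(1,2) z by (simp only: m_assoc)
    finally show ?thesis .
  qed
  moreover have "x \<otimes> y \<in> carrier G" using xy center_carrier by blast
  ultimately show "x \<otimes> y \<in> center G" unfolding center_def by blast
next
  fix x assume x: "x \<in> center G"
  have "inv x \<otimes> y = y \<otimes> inv x" if "y \<in> carrier G" for y
  proof -
    have c: "x \<otimes> y = y \<otimes> x" "x \<in> carrier G" using x that centerD center_carrier by blast+
    have "inv x \<otimes> y = inv x \<otimes> (y \<otimes> x) \<otimes> inv x" using c(2) that by (simp add: m_assoc)
    also have "\<dots> = inv x \<otimes> (x \<otimes> y) \<otimes> inv x" by (simp only: c(1))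
    also have "\<dots> = y \<otimes> inv x" using c(2) that by (simp add: m_assoc[symmetric])
    finally show ?thesis .
  qed
  moreover have "inv x \<in> carrier G" using x center_carrier by blast
  ultimately show "inv x \<in> center G" unfolding center_def by blast
qed (auto simp: center_def)

lemma (in group) commutator_closed [simp]:
  "x \<in> carrier G \<Longrightarrow> y \<in> carrier G \<Longrightarrow> commutator G x y \<in> carrier G"
  by (simp add: commutator_def)

lemma (in group) mult_commutator:
  "x \<in> carrier G \<Longrightarrow> y \<in> carrier G \<Longrightarrow> y \<otimes> x \<otimes> commutator G x y = x \<otimes> y"
  by (simp add: commutator_def m_assoc) (simp add: m_assoc[symmetric])

text \<open>Commutators are computed below by guessing the value and checking this one equation,
  which avoids expanding inverses.\<close>

lemma (in group) commutator_eqI: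
  assumes "x \<in> carrier G" "y \<in> carrier G" "c \<in> carrier G" "y \<otimes> x \<otimes> c = x \<otimes> y"
  shows "commutator G x y = c"
  using assms mult_commutator[of x y] Units_l_cancel[of "y \<otimes> x" "commutator G x y" c]
  by (simp add: Units_eq)

lemma (in group) centerI:
  assumes "c \<in> carrier G" "\<And>x. x \<in> carrier G \<Longrightarrow> commutator G c x = \<one>"
  shows "c \<in> center G"
proof -
  have "c \<otimes> x = x \<otimes> c" if "x \<in> carrier G" for x
    using mult_commutator[of c x] assms that by simp
  then show ?thesis unfolding center_def using assms(1) by blast
qed

lemma (in group_hom) hom_commutator:
  "x \<in> carrier G \<Longrightarrow> y \<in> carrier G \<Longrightarrow> h (commutator G x y) = commutator H (h x) (h y)"
  by (simp add: commutator_def)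

text \<open>Each factor is a generated subgroup, hence least among subgroups containing its
  generators; for \<open>n = 0\<close> the first factor is trivial by definition.\<close>

lemma (in group) power_derived_least:
  assumes S: "subgroup S G" and "\<And>x. x \<in> carrier G \<Longrightarrow> x [^] n \<in> S"
    and comm: "\<And>x y. x \<in> carrier G \<Longrightarrow> y \<in> carrier G \<Longrightarrow> commutator G x y \<in> S"
  shows "power_derived G n \<subseteq> S"
proof -
  have "power_subgroup G n \<subseteq> S"
    using generate_subgroup_incl[OF _ S, of "(\<lambda>x. x [^] n) ` carrier G"] assms(2) subgroup.one_closed[OF S]
    by (auto simp: power_subgroup_def)
  moreover have "x \<otimes> y \<otimes> inv x \<otimes> inv y \<in> S" if "x \<in> carrier G" "y \<in> carrier G" for x y
    using comm[of "inv x" "inv y"] that by (simp add: commutator_def)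
  then have "derived_set G (carrier G) \<subseteq> S" by auto
  then have "derived G (carrier G) \<subseteq> S"
    unfolding derived_def using generate_subgroup_incl[OF _ S] by blast
  ultimately show ?thesis
    unfolding power_derived_def set_mult_def using subgroup.m_closed[OF S] by blast
qed

lemma (in group) power_subgroup_subgroup: "subgroup (power_subgroup G k) G"
  unfolding power_subgroup_def
  by (auto intro!: generate_is_subgroup triv_subgroup)

lemma (in group) pow_in_power_derived:
  assumes "x \<in> carrier G"
  shows "x [^] n \<in> power_derived G n"
proof -
  have "x [^] n \<in> power_subgroup G n"
    using assms by (auto simp: power_subgroup_def intro: generate.incl)
  moreover have "\<one> \<in> derived G (carrier G)"
    by (simp add: derived_def generate.one)
  ultimately show ?thesis
    unfolding power_derived_def set_mult_def using assms by (auto intro!: bexI)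
qed

lemma (in group) commutator_in_power_derived:
  assumes "x \<in> carrier G" "y \<in> carrier G"
  shows "commutator G x y \<in> power_derived G n"
proof -
  have "inv x \<otimes> inv y \<otimes> inv (inv x) \<otimes> inv (inv y) \<in> derived_set G (carrier G)"
    using assms by blast
  then have "commutator G x y \<in> derived G (carrier G)"
    using assms by (simp add: commutator_def derived_def generate.incl)
  moreover have "\<one> \<in> power_subgroup G n" by (rule subgroup.one_closed[OF power_subgroup_subgroup])
  ultimately show ?thesis
    unfolding power_derived_def set_mult_def using assms
    by (intro UN_I[of \<one>] UN_I[of "commutator G x y"]) auto
qed

section \<open>Commutator calculus and the subgroup \<open>G^n G'\<close> in a group of the
  variety\<close>

locale variety_group = group G for G (structure) +
  fixes m n :: nat
  assumes in_variety: "in_variety m n G"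
begin

abbreviation PD where "PD \<equiv> power_derived G n"

lemma pow_exponent: "x \<in> carrier G \<Longrightarrow> x [^] m = \<one>"
  and commutator_pow: "x \<in> carrier G \<Longrightarrow> y \<in> carrier G \<Longrightarrow> commutator G x y [^] n = \<one>"
  and commutator3: "x \<in> carrier G \<Longrightarrow> y \<in> carrier G \<Longrightarrow> z \<in> carrier G \<Longrightarrow>
    commutator G (commutator G x y) z = \<one>"
  using in_variety unfolding in_variety_def by blast+

lemma commutator_central:
  assumes "x \<in> carrier G" "y \<in> carrier G"
  shows "commutator G x y \<in> center G"
  using assms by (intro centerI commutator3) auto

lemma commutator_mult_left:
  assumes [simp]: "x \<in> carrier G" "y \<in> carrier G" "z \<in> carrier G"
  shows "commutator G (x \<otimes> y) z = commutator G x z \<otimes> commutator G y z"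
proof (rule commutator_eqI)
  have "z \<otimes> (x \<otimes> y) \<otimes> (commutator G x z \<otimes> commutator G y z)
    = z \<otimes> x \<otimes> (y \<otimes> commutator G x z) \<otimes> commutator G y z" by (simp add: m_assoc)
  also have "\<dots> = (z \<otimes> x \<otimes> commutator G x z) \<otimes> y \<otimes> commutator G y z"
    using centerD[OF commutator_central[of x z], of y] by (simp add: m_assoc)
  also have "\<dots> = x \<otimes> z \<otimes> y \<otimes> commutator G y z" by (simp add: mult_commutator)
  also have "\<dots> = x \<otimes> (z \<otimes> y \<otimes> commutator G y z)" by (simp add: m_assoc)
  also have "\<dots> = x \<otimes> (y \<otimes> z)" by (simp add: mult_commutator)
  also have "\<dots> = x \<otimes> y \<otimes> z" by (simp add: m_assoc)
  finally show "z \<otimes> (x \<otimes> y) \<otimes> (commutator G x z \<otimes> commutator G y z) = x \<otimes> y \<otimes> z" .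
qed auto

lemma commutator_swap:
  assumes "x \<in> carrier G" "y \<in> carrier G"
  shows "commutator G y x = inv (commutator G x y)"
  using assms by (simp add: commutator_def inv_mult_group m_assoc)

lemma commutator_mult_right:
  assumes [simp]: "x \<in> carrier G" "y \<in> carrier G" "z \<in> carrier G"
  shows "commutator G z (x \<otimes> y) = commutator G z x \<otimes> commutator G z y"
proof -
  have "commutator G z (x \<otimes> y) = inv (commutator G x z \<otimes> commutator G y z)"
    using commutator_swap[of "x \<otimes> y" z] by (simp add: commutator_mult_left)
  also have "\<dots> = inv (commutator G y z \<otimes> commutator G x z)"
    using centerD[OF commutator_central[of x z], of "commutator G y z"] by simp
  also have "\<dots> = commutator G z x \<otimes> commutator G z y"
    by (simp add: inv_mult_group commutator_swap[of x z] commutator_swap[of y z])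
  finally show ?thesis .
qed

lemma commutator_hom_left: "z \<in> carrier G \<Longrightarrow> (\<lambda>x. commutator G x z) \<in> hom G G"
  by (auto simp: hom_def commutator_mult_left)

lemma commutator_hom_right: "z \<in> carrier G \<Longrightarrow> commutator G z \<in> hom G G"
  by (auto simp: hom_def commutator_mult_right)

lemma commutator_pow_left:
  "x \<in> carrier G \<Longrightarrow> y \<in> carrier G \<Longrightarrow> commutator G (x [^] (k::nat)) y = commutator G x y [^] k"
  using hom_nat_pow[OF commutator_hom_left] by (simp add: is_group)

lemma commutator_pow_right:
  "x \<in> carrier G \<Longrightarrow> y \<in> carrier G \<Longrightarrow> commutator G x (y [^] (k::nat)) = commutator G x y [^] k"
  using hom_nat_pow[OF commutator_hom_right] by (simp add: is_group)

lemma commutator_center_left: "c \<in> center G \<Longrightarrow> x \<in> carrier G \<Longrightarrow> commutator G c x = \<one>"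
  by (rule commutator_eqI) (simp_all add: center_carrier, metis centerD)

lemma commutator_center_right: "c \<in> center G \<Longrightarrow> x \<in> carrier G \<Longrightarrow> commutator G x c = \<one>"
  by (rule commutator_eqI) (simp_all add: center_carrier, metis centerD)

lemma pow_central: "x \<in> carrier G \<Longrightarrow> x [^] n \<in> center G"
  by (rule centerI) (auto simp: commutator_pow_left commutator_pow)

lemma PD_central: "PD \<subseteq> center G"
  by (rule power_derived_least[OF center_subgroup pow_central commutator_central])

text \<open>\<open>PD\<close> is defined as a product set. It is closed under multiplication and
  inversion because its first factor is central.\<close>

lemma PD_subgroup: "subgroup PD G"
proof -
  have sub: "subgroup (derived G (carrier G)) G"
    by (rule derived_is_subgroup) simp
  have mem: "u \<otimes> d \<in> PD" if "u \<in> power_subgroup G n" "d \<in> derived G (carrier G)" for u d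
    using that by (auto simp: power_derived_def set_mult_def)
  have "power_subgroup G n \<subseteq> PD"
  proof
    fix x assume x: "x \<in> power_subgroup G n"
    then have "x \<in> carrier G" using subgroup.mem_carrier[OF power_subgroup_subgroup] by blast
    then show "x \<in> PD" using mem[OF x subgroup.one_closed[OF sub]] by simp
  qed
  then have c: "x \<in> center G" if "x \<in> power_subgroup G n" for x using PD_central that by blast
  show ?thesis
  proof
    show "PD \<subseteq> carrier G" using PD_central center_carrier by blast
    show "\<one> \<in> PD" using commutator_in_power_derived[of \<one> \<one> n] by (simp add: commutator_def)
  next
    fix x y assume "x \<in> PD" "y \<in> PD"
    then obtain u d v e where uv: "u \<in> power_subgroup G n" "v \<in> power_subgroup G n"
      and de: "d \<in> derived G (carrier G)" "e \<in> derived G (carrier G)" and xy: "x = u \<otimes> d" "y = v \<otimes> e"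
      unfolding power_derived_def set_mult_def by blast
    have [simp]: "u \<in> carrier G" "v \<in> carrier G" "d \<in> carrier G" "e \<in> carrier G"
      using uv de c center_carrier subgroup.mem_carrier[OF sub] by auto
    have "x \<otimes> y = u \<otimes> (d \<otimes> v) \<otimes> e" by (simp add: xy m_assoc)
    also have "\<dots> = u \<otimes> (v \<otimes> d) \<otimes> e" using centerD[OF c[OF uv(2)], of d] by simp
    also have "\<dots> = (u \<otimes> v) \<otimes> (d \<otimes> e)" by (simp add: m_assoc)
    finally show "x \<otimes> y \<in> PD"
      using mem[OF subgroup.m_closed[OF power_subgroup_subgroup uv] subgroup.m_closed[OF sub de]] by simp
  next
    fix x assume "x \<in> PD"
    then obtain u d where u: "u \<in> power_subgroup G n" and d: "d \<in> derived G (carrier G)"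
      and x: "x = u \<otimes> d"
      unfolding power_derived_def set_mult_def by blast
    have [simp]: "u \<in> carrier G" "d \<in> carrier G"
      using u d c center_carrier subgroup.mem_carrier[OF sub] by auto
    have "inv x = inv u \<otimes> inv d"
      using centerD[OF c[OF u], of d] inv_mult_group[of d u] by (simp add: x)
    then show "inv x \<in> PD"
      using mem[OF subgroup.m_inv_closed[OF power_subgroup_subgroup u] subgroup.m_inv_closed[OF sub d]]
      by simp
  qed
qed

lemma PD_carrier [simp]: "x \<in> PD \<Longrightarrow> x \<in> carrier G"
  by (rule subgroup.mem_carrier[OF PD_subgroup])

lemma PD_normal: "PD \<lhd> G"
proof -
  have "x \<otimes> h \<otimes> inv x = h" if "x \<in> carrier G" "h \<in> PD" for x h
  proof -
    have "h \<in> center G" "h \<in> carrier G" using that PD_central by auto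
    then show ?thesis using that centerD[of h x] m_assoc[of h x "inv x"] by simp
  qed
  then show ?thesis using PD_subgroup by (auto simp: normal_inv_iff)
qed

sublocale PD: normal PD G by (rule PD_normal)

lemma quotient_comm_group: "comm_group (G Mod PD)"
proof (rule group.group_comm_groupI[OF PD.factorgroup_is_group])
  fix u v assume "u \<in> carrier (G Mod PD)" "v \<in> carrier (G Mod PD)"
  then obtain x y where xy: "x \<in> carrier G" "y \<in> carrier G" "u = PD #> x" "v = PD #> y"
    by (auto simp: carrier_FactGroup)
  have "commutator G y x \<in> PD" using xy by (simp add: commutator_in_power_derived)
  then have "PD #> (x \<otimes> y) = PD #> (y \<otimes> x)"
  proof -
    have "y \<otimes> x = x \<otimes> y \<otimes> commutator G y x" using xy by (simp add: mult_commutator)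
    also have "\<dots> = commutator G y x \<otimes> (x \<otimes> y)"
      using xy by (simp add: centerD[OF commutator_central])
    finally have "y \<otimes> x \<in> PD #> (x \<otimes> y)"
      using \<open>commutator G y x \<in> PD\<close> unfolding r_coset_def by blast
    then show ?thesis using xy repr_independence[OF _ _ PD_subgroup] by blast
  qed
  then show "u \<otimes>\<^bsub>G Mod PD\<^esub> v = v \<otimes>\<^bsub>G Mod PD\<^esub> u" using xy by (simp add: PD.rcos_sum)
qed

lemma quotient_exponent:
  assumes "u \<in> carrier (G Mod PD)"
  shows "u [^]\<^bsub>G Mod PD\<^esub> n = \<one>\<^bsub>G Mod PD\<^esub>"
proof -
  obtain x where x: "x \<in> carrier G" "u = PD #> x" using assms by (auto simp: carrier_FactGroup)
  then show ?thesis
    using PD.coset_eq_self_iff[of "x [^] n"] pow_in_power_derived[of x n]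
    by (simp add: PD.FactGroup_pow)
qed

text \<open>Cosets are right cosets; centrality of \<open>PD\<close> moves the discrepancy to the
  right, giving the form \<open>a^q a'\<close> of condition (b).\<close>

lemma coset_eqD:
  assumes "x \<in> carrier G" "y \<in> carrier G" "PD #> x = PD #> y"
  obtains c where "c \<in> PD" "y = x \<otimes> c"
proof -
  have "y \<in> PD #> x" using rcos_self[OF assms(2) PD_subgroup] assms(3) by simp
  then obtain c where c: "c \<in> PD" "y = c \<otimes> x" by (auto simp: r_coset_def)
  then show thesis using that[of c] centerD[of c x] PD_central assms by auto
qed

text \<open>Elements of \<open>PD\<close> are central, so they do not affect commutators. This makes
  the commutator pairings well defined on the quotients by \<open>PD\<close>.\<close>

lemma commutator_coset_cong:
  assumes "x \<in> carrier G" "y \<in> carrier G" "PD #> x = PD #> y" "z \<in> carrier G"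
  shows "commutator G x z = commutator G y z"
proof -
  obtain c where "c \<in> PD" "y = x \<otimes> c" using coset_eqD assms by blast
  then show ?thesis
    using assms PD_central commutator_center_left[of c z] by (auto simp: commutator_mult_left)
qed

end

lemma in_variety_hom_image:
  assumes G: "in_variety m n G" and H: "group H" and h: "h \<in> hom G H" and surj: "h ` carrier G = carrier H"
  shows "in_variety m n H"
proof -
  interpret group_hom G H h
    using assms by (simp add: group_hom_def group_hom_axioms_def in_variety_def)
  have H: "\<exists>x\<in>carrier G. y = h x" if "y \<in> carrier H" for y using that surj by blast
  show ?thesis
    unfolding in_variety_def
  proof (intro conjI ballI)
    fix y assume "y \<in> carrier H"
    then show "y [^]\<^bsub>H\<^esub> m = \<one>\<^bsub>H\<^esub>" using G H[of y] by (auto simp: in_variety_def hom_nat_pow[symmetric])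
  next
    fix y z assume "y \<in> carrier H" "z \<in> carrier H"
    then show "commutator H y z [^]\<^bsub>H\<^esub> n = \<one>\<^bsub>H\<^esub>"
      using G H[of y] H[of z] by (auto simp: in_variety_def hom_nat_pow[symmetric] hom_commutator[symmetric])
  next
    fix y z t assume "y \<in> carrier H" "z \<in> carrier H" "t \<in> carrier H"
    then show "commutator H (commutator H y z) t = \<one>\<^bsub>H\<^esub>"
      using G H[of y] H[of z] H[of t] by (auto simp: in_variety_def hom_commutator[symmetric])
  qed (fact assms)
qed

text \<open>The preimage of the center of \<open>M\<close> is a subgroup of \<open>G\<close>
  containing all \<open>n\<close>-th powers and all commutators.\<close>

lemma power_derived_hom_central:
  assumes "group G" "in_variety m n M" and h: "h \<in> hom G M" and x: "x \<in> power_derived G n"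
  shows "h x \<in> center M"
proof -
  interpret group_hom G M h
    using assms by (simp add: group_hom_def group_hom_axioms_def in_variety_def)
  interpret M: variety_group M m n by unfold_locales (rule assms)
  have "subgroup {x \<in> carrier G. h x \<in> center M} G"
    using H.center_subgroup by unfold_locales
      (auto simp: subgroup.m_closed subgroup.one_closed subgroup.m_inv_closed)
  then have "power_derived G n \<subseteq> {x \<in> carrier G. h x \<in> center M}"
    by (rule G.power_derived_least) (auto simp: hom_nat_pow hom_commutator M.pow_central M.commutator_central)
  then show ?thesis using x by blast
qed

section \<open>Amalgamating along a pairing\<close>

lemma (in group) mult_inv_eq_one_iff:
  assumes "x \<in> carrier G" "y \<in> carrier G"
  shows "x \<otimes> inv y = \<one> \<longleftrightarrow> x = y"
  using assms inv_equality[of x "inv y"] by auto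

text \<open>The data from which the amalgam is built. \<beta> is the intended commutator of an
  element of \<open>A\<close> with one of \<open>B\<close>, and \<open>z\<^sub>A\<close>,
  \<open>z\<^sub>B\<close> are the intended positions of the two central subgroups inside
  \<open>V\<close>. The last two assumptions are forced by identifying the images of
  \<open>D\<close>, and \<open>separate\<close> ensures that nothing outside \<open>D\<close> gets
  identified.\<close>

locale amalgam_pairing =
  A: variety_group A m n + B: variety_group B m n + D: group D + V: comm_group V
  for A :: "('a, 'as) monoid_scheme" and B :: "('b, 'bs) monoid_scheme"
    and D :: "('d, 'ds) monoid_scheme" and V :: "('v, 'vs) monoid_scheme" and m n +
  fixes \<iota>\<^sub>A :: "'d \<Rightarrow> 'a" and \<iota>\<^sub>B :: "'d \<Rightarrow> 'b"
    and z\<^sub>A :: "'a \<Rightarrow> 'v" and z\<^sub>B :: "'b \<Rightarrow> 'v" and \<beta> :: "'a \<Rightarrow> 'b \<Rightarrow> 'v"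
  assumes \<iota>\<^sub>A: "\<iota>\<^sub>A \<in> mon D A" and \<iota>\<^sub>B: "\<iota>\<^sub>B \<in> mon D B"
    and n_dvd: "n dvd m choose 2"
    and V_exponent: "\<And>v. v \<in> carrier V \<Longrightarrow> v [^]\<^bsub>V\<^esub> m = \<one>\<^bsub>V\<^esub>"
    and z\<^sub>A: "z\<^sub>A \<in> hom (A\<lparr>carrier := A.PD\<rparr>) V" and z\<^sub>B: "z\<^sub>B \<in> hom (B\<lparr>carrier := B.PD\<rparr>) V"
    and separate: "\<And>x y. x \<in> A.PD \<Longrightarrow> y \<in> B.PD \<Longrightarrow> z\<^sub>A x \<otimes>\<^bsub>V\<^esub> z\<^sub>B y = \<one>\<^bsub>V\<^esub> \<Longrightarrow>
      \<exists>e\<in>carrier D. x = \<iota>\<^sub>A e \<and> y = inv\<^bsub>B\<^esub> \<iota>\<^sub>B e"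
    and \<beta>_left: "\<And>b. b \<in> carrier B \<Longrightarrow> (\<lambda>a. \<beta> a b) \<in> hom A V"
    and \<beta>_right: "\<And>a. a \<in> carrier A \<Longrightarrow> \<beta> a \<in> hom B V"
    and \<beta>_PD_left: "\<And>a b. a \<in> A.PD \<Longrightarrow> b \<in> carrier B \<Longrightarrow> \<beta> a b = \<one>\<^bsub>V\<^esub>"
    and \<beta>_PD_right: "\<And>a b. a \<in> carrier A \<Longrightarrow> b \<in> B.PD \<Longrightarrow> \<beta> a b = \<one>\<^bsub>V\<^esub>"
    and \<beta>_D_right: "\<And>a d. a \<in> carrier A \<Longrightarrow> d \<in> carrier D \<Longrightarrow>
      \<beta> a (\<iota>\<^sub>B d) = z\<^sub>A (commutator A a (\<iota>\<^sub>A d))"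
    and \<beta>_D_left: "\<And>b d. b \<in> carrier B \<Longrightarrow> d \<in> carrier D \<Longrightarrow>
      \<beta> (\<iota>\<^sub>A d) b = z\<^sub>B (commutator B (\<iota>\<^sub>B d) b)"
begin

sublocale \<iota>\<^sub>A: group_hom D A \<iota>\<^sub>A by unfold_locales (use \<iota>\<^sub>A in \<open>simp add: mon_def\<close>)
sublocale \<iota>\<^sub>B: group_hom D B \<iota>\<^sub>B by unfold_locales (use \<iota>\<^sub>B in \<open>simp add: mon_def\<close>)

lemma \<beta>_closed [simp]: "a \<in> carrier A \<Longrightarrow> b \<in> carrier B \<Longrightarrow> \<beta> a b \<in> carrier V"
  using \<beta>_right by (auto simp: hom_def)

lemma \<beta>_mult_left:
  "a \<in> carrier A \<Longrightarrow> a' \<in> carrier A \<Longrightarrow> b \<in> carrier B \<Longrightarrow> \<beta> (a \<otimes>\<^bsub>A\<^esub> a') b = \<beta> a b \<otimes>\<^bsub>V\<^esub> \<beta> a' b"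
  using hom_mult[OF \<beta>_left] by simp

lemma \<beta>_mult_right:
  "a \<in> carrier A \<Longrightarrow> b \<in> carrier B \<Longrightarrow> b' \<in> carrier B \<Longrightarrow> \<beta> a (b \<otimes>\<^bsub>B\<^esub> b') = \<beta> a b \<otimes>\<^bsub>V\<^esub> \<beta> a b'"
  using hom_mult[OF \<beta>_right] by simp

lemma \<beta>_one_left [simp]: "b \<in> carrier B \<Longrightarrow> \<beta> \<one>\<^bsub>A\<^esub> b = \<one>\<^bsub>V\<^esub>"
  using hom_one[OF \<beta>_left] by (simp add: A.is_group V.is_group)

lemma \<beta>_one_right [simp]: "a \<in> carrier A \<Longrightarrow> \<beta> a \<one>\<^bsub>B\<^esub> = \<one>\<^bsub>V\<^esub>"
  using hom_one[OF \<beta>_right] by (simp add: B.is_group V.is_group)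

lemma \<beta>_inv_right: "a \<in> carrier A \<Longrightarrow> b \<in> carrier B \<Longrightarrow> \<beta> a (inv\<^bsub>B\<^esub> b) = inv\<^bsub>V\<^esub> \<beta> a b"
  using \<beta>_mult_right[of a "inv\<^bsub>B\<^esub> b" b] by (simp add: V.inv_equality)

lemma \<beta>_pow_left: "a \<in> carrier A \<Longrightarrow> b \<in> carrier B \<Longrightarrow> \<beta> (a [^]\<^bsub>A\<^esub> (k::nat)) b = \<beta> a b [^]\<^bsub>V\<^esub> k"
  using hom_nat_pow[OF \<beta>_left] by (simp add: A.is_group V.is_group)

lemma \<beta>_pow_right: "a \<in> carrier A \<Longrightarrow> b \<in> carrier B \<Longrightarrow> \<beta> a (b [^]\<^bsub>B\<^esub> (k::nat)) = \<beta> a b [^]\<^bsub>V\<^esub> k"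
  using hom_nat_pow[OF \<beta>_right] by (simp add: B.is_group V.is_group)

lemma \<beta>_pow_n: "a \<in> carrier A \<Longrightarrow> b \<in> carrier B \<Longrightarrow> \<beta> a b [^]\<^bsub>V\<^esub> n = \<one>\<^bsub>V\<^esub>"
  using \<beta>_pow_left[of a b n] \<beta>_PD_left[of "a [^]\<^bsub>A\<^esub> n" b] by (simp add: A.pow_in_power_derived)

lemma z\<^sub>A_closed [simp]: "x \<in> A.PD \<Longrightarrow> z\<^sub>A x \<in> carrier V"
  using z\<^sub>A by (auto simp: hom_def)

lemma z\<^sub>B_closed [simp]: "x \<in> B.PD \<Longrightarrow> z\<^sub>B x \<in> carrier V"
  using z\<^sub>B by (auto simp: hom_def)

lemma z\<^sub>A_mult: "x \<in> A.PD \<Longrightarrow> y \<in> A.PD \<Longrightarrow> z\<^sub>A (x \<otimes>\<^bsub>A\<^esub> y) = z\<^sub>A x \<otimes>\<^bsub>V\<^esub> z\<^sub>A y"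
  using hom_mult[OF z\<^sub>A] by simp

lemma z\<^sub>B_mult: "x \<in> B.PD \<Longrightarrow> y \<in> B.PD \<Longrightarrow> z\<^sub>B (x \<otimes>\<^bsub>B\<^esub> y) = z\<^sub>B x \<otimes>\<^bsub>V\<^esub> z\<^sub>B y"
  using hom_mult[OF z\<^sub>B] by simp

lemma z\<^sub>A_one [simp]: "z\<^sub>A \<one>\<^bsub>A\<^esub> = \<one>\<^bsub>V\<^esub>"
  using hom_one[OF z\<^sub>A subgroup.subgroup_is_group[OF A.PD_subgroup A.is_group] V.is_group] by simp

lemma z\<^sub>B_one [simp]: "z\<^sub>B \<one>\<^bsub>B\<^esub> = \<one>\<^bsub>V\<^esub>"
  using hom_one[OF z\<^sub>B subgroup.subgroup_is_group[OF B.PD_subgroup B.is_group] V.is_group] by simp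

lemma z\<^sub>B_inv: "x \<in> B.PD \<Longrightarrow> z\<^sub>B (inv\<^bsub>B\<^esub> x) = inv\<^bsub>V\<^esub> z\<^sub>B x"
  using z\<^sub>B_mult[of "inv\<^bsub>B\<^esub> x" x] by (simp add: V.inv_equality)

text \<open>The triple \<open>(a, b, v)\<close> stands for the product \<open>a b v\<close> with \<open>v\<close> central and
  \<open>[a, b] = \<beta> a b\<close>.\<close>

definition K :: "('a \<times> 'b \<times> 'v) monoid" where
  "K = \<lparr>carrier = carrier A \<times> carrier B \<times> carrier V,
    mult = (\<lambda>(a, b, v) (a', b', v').
      (a \<otimes>\<^bsub>A\<^esub> a', b \<otimes>\<^bsub>B\<^esub> b', v \<otimes>\<^bsub>V\<^esub> v' \<otimes>\<^bsub>V\<^esub> inv\<^bsub>V\<^esub> \<beta> a' b)),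
    one = (\<one>\<^bsub>A\<^esub>, \<one>\<^bsub>B\<^esub>, \<one>\<^bsub>V\<^esub>)\<rparr>"

lemma carrier_K: "carrier K = carrier A \<times> carrier B \<times> carrier V"
  and mult_K: "(a, b, v) \<otimes>\<^bsub>K\<^esub> (a', b', v')
    = (a \<otimes>\<^bsub>A\<^esub> a', b \<otimes>\<^bsub>B\<^esub> b', v \<otimes>\<^bsub>V\<^esub> v' \<otimes>\<^bsub>V\<^esub> inv\<^bsub>V\<^esub> \<beta> a' b)"
  and one_K: "\<one>\<^bsub>K\<^esub> = (\<one>\<^bsub>A\<^esub>, \<one>\<^bsub>B\<^esub>, \<one>\<^bsub>V\<^esub>)"
  by (simp_all add: K_def)

sublocale K: group K
proof (rule groupI)
  fix x y z assume "x \<in> carrier K" "y \<in> carrier K" "z \<in> carrier K"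
  then show "x \<otimes>\<^bsub>K\<^esub> y \<otimes>\<^bsub>K\<^esub> z = x \<otimes>\<^bsub>K\<^esub> (y \<otimes>\<^bsub>K\<^esub> z)"
    by (auto simp: carrier_K mult_K A.m_assoc B.m_assoc \<beta>_mult_left \<beta>_mult_right V.inv_mult V.m_ac)
next
  fix x assume "x \<in> carrier K"
  then obtain a b v where x: "x = (a, b, v)" "a \<in> carrier A" "b \<in> carrier B" "v \<in> carrier V"
    by (auto simp: carrier_K)
  \<comment> \<open>Multiplying the candidate inverse by \<open>x\<close> produces the cocycle value
    at \<open>a\<close> and the inverse of \<open>b\<close>; the third component of the candidate
    compensates for it.\<close>
  define u where "u = \<beta> a (inv\<^bsub>B\<^esub> b)"
  have u: "u \<in> carrier V" using x by (simp add: u_def)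
  have "inv\<^bsub>V\<^esub> v \<otimes>\<^bsub>V\<^esub> u \<otimes>\<^bsub>V\<^esub> v \<otimes>\<^bsub>V\<^esub> inv\<^bsub>V\<^esub> u = (inv\<^bsub>V\<^esub> v \<otimes>\<^bsub>V\<^esub> v) \<otimes>\<^bsub>V\<^esub> (u \<otimes>\<^bsub>V\<^esub> inv\<^bsub>V\<^esub> u)"
    using x u by (simp add: V.m_ac del: V.l_inv V.r_inv)
  also have "\<dots> = \<one>\<^bsub>V\<^esub>" using x u by simp
  finally show "\<exists>y\<in>carrier K. y \<otimes>\<^bsub>K\<^esub> x = \<one>\<^bsub>K\<^esub>"
    using x u by (intro bexI[of _ "(inv\<^bsub>A\<^esub> a, inv\<^bsub>B\<^esub> b, inv\<^bsub>V\<^esub> v \<otimes>\<^bsub>V\<^esub> u)"])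
      (simp_all add: carrier_K mult_K one_K u_def)
qed (auto simp: carrier_K mult_K one_K)

text \<open>By bilinearity the commutator of \<open>a b v\<close> and \<open>a' b' v'\<close> splits
  into \<open>[a, a']\<close>, \<open>[b, b']\<close>, \<open>[a, b']\<close> and
  \<open>[b, a']\<close>. The last two are \<beta>-values, and \<open>[b, a']\<close> is the inverse
  of \<open>[a', b]\<close>.\<close>

lemma commutator_K:
  assumes "a \<in> carrier A" "b \<in> carrier B" "v \<in> carrier V"
    and "a' \<in> carrier A" "b' \<in> carrier B" "v' \<in> carrier V"
  shows "commutator K (a, b, v) (a', b', v')
    = (commutator A a a', commutator B b b', \<beta> a b' \<otimes>\<^bsub>V\<^esub> inv\<^bsub>V\<^esub> \<beta> a' b)"
proof (rule K.commutator_eqI)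
  have "\<beta> (commutator A a a') (b' \<otimes>\<^bsub>B\<^esub> b) = \<one>\<^bsub>V\<^esub>"
    using assms by (intro \<beta>_PD_left) (auto simp: A.commutator_in_power_derived)
  moreover have "v' \<otimes>\<^bsub>V\<^esub> v \<otimes>\<^bsub>V\<^esub> inv\<^bsub>V\<^esub> \<beta> a b' \<otimes>\<^bsub>V\<^esub> (\<beta> a b' \<otimes>\<^bsub>V\<^esub> inv\<^bsub>V\<^esub> \<beta> a' b)
    = v \<otimes>\<^bsub>V\<^esub> v' \<otimes>\<^bsub>V\<^esub> inv\<^bsub>V\<^esub> \<beta> a' b"
  proof -
    have "inv\<^bsub>V\<^esub> \<beta> a b' \<otimes>\<^bsub>V\<^esub> (\<beta> a b' \<otimes>\<^bsub>V\<^esub> inv\<^bsub>V\<^esub> \<beta> a' b) = inv\<^bsub>V\<^esub> \<beta> a' b"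
      using assms by (simp add: V.m_assoc[symmetric])
    moreover have "v' \<otimes>\<^bsub>V\<^esub> v \<otimes>\<^bsub>V\<^esub> i \<otimes>\<^bsub>V\<^esub> k = v \<otimes>\<^bsub>V\<^esub> v' \<otimes>\<^bsub>V\<^esub> (i \<otimes>\<^bsub>V\<^esub> k)"
      if "i \<in> carrier V" "k \<in> carrier V" for i k
      using that assms by (simp add: V.m_ac)
    ultimately show ?thesis using assms by simp
  qed
  ultimately show "(a', b', v') \<otimes>\<^bsub>K\<^esub> (a, b, v) \<otimes>\<^bsub>K\<^esub>
      (commutator A a a', commutator B b b', \<beta> a b' \<otimes>\<^bsub>V\<^esub> inv\<^bsub>V\<^esub> \<beta> a' b)
    = (a, b, v) \<otimes>\<^bsub>K\<^esub> (a', b', v')"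
    using assms by (simp add: mult_K A.mult_commutator B.mult_commutator)
qed (use assms in \<open>auto simp: carrier_K\<close>)

text \<open>In \<open>(a b v)^k\<close> each \<open>b\<close> has to pass every later
  \<open>a\<close> to reach the form \<open>a^k b^k\<close>. There are \<open>k choose 2\<close>
  such pairs, and each costs one inverse of \<open>\<beta> a b\<close>.\<close>

lemma pow_K:
  assumes "a \<in> carrier A" "b \<in> carrier B" "v \<in> carrier V"
  shows "(a, b, v) [^]\<^bsub>K\<^esub> (k::nat)
    = (a [^]\<^bsub>A\<^esub> k, b [^]\<^bsub>B\<^esub> k, v [^]\<^bsub>V\<^esub> k \<otimes>\<^bsub>V\<^esub> (inv\<^bsub>V\<^esub> \<beta> a b) [^]\<^bsub>V\<^esub> (k choose 2))"
proof (induction k)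
  case 0
  then show ?case using assms by (simp add: one_K numeral_2_eq_2)
next
  case (Suc k)
  have "Suc k choose 2 = (k choose 2) + k" by (simp add: numeral_2_eq_2)
  moreover have "inv\<^bsub>V\<^esub> (\<beta> a b [^]\<^bsub>V\<^esub> k) = (inv\<^bsub>V\<^esub> \<beta> a b) [^]\<^bsub>V\<^esub> k"
    using assms by (simp add: V.nat_pow_inv)
  ultimately show ?case
    using assms Suc by (simp add: mult_K \<beta>_pow_right V.nat_pow_mult[symmetric] V.m_ac)
qed

text \<open>Values of \<beta> have order dividing \<open>n\<close>, so the binomial factor in an
  \<open>m\<close>-th power vanishes by \<open>n_dvd\<close>. Commutators have their first two
  components in the subgroups \<open>A.PD\<close> and \<open>B.PD\<close>, on which \<beta> is
  trivial; this settles the other two identities.\<close>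

lemma in_variety_K: "in_variety m n K"
  unfolding in_variety_def
proof (intro conjI ballI)
  show "group K" by (rule K.is_group)
next
  fix x assume "x \<in> carrier K"
  then obtain a b v where x: "x = (a, b, v)" "a \<in> carrier A" "b \<in> carrier B" "v \<in> carrier V"
    by (auto simp: carrier_K)
  obtain k where k: "m choose 2 = n * k" using n_dvd by blast
  have "(inv\<^bsub>V\<^esub> \<beta> a b) [^]\<^bsub>V\<^esub> (m choose 2) = \<one>\<^bsub>V\<^esub>"
    using x by (simp add: k V.nat_pow_pow[symmetric] V.nat_pow_inv \<beta>_pow_n)
  then show "x [^]\<^bsub>K\<^esub> m = \<one>\<^bsub>K\<^esub>"
    using x by (simp add: pow_K one_K A.pow_exponent B.pow_exponent V_exponent)
next
  fix x y assume "x \<in> carrier K" "y \<in> carrier K"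
  then obtain a b v a' b' v' where x: "x = (a, b, v)" "a \<in> carrier A" "b \<in> carrier B" "v \<in> carrier V"
    and y: "y = (a', b', v')" "a' \<in> carrier A" "b' \<in> carrier B" "v' \<in> carrier V"
    by (auto simp: carrier_K)
  have "\<beta> (commutator A a a') (commutator B b b') = \<one>\<^bsub>V\<^esub>"
    using x y by (intro \<beta>_PD_left) (auto simp: A.commutator_in_power_derived)
  then show "commutator K x y [^]\<^bsub>K\<^esub> n = \<one>\<^bsub>K\<^esub>"
    using x y by (simp add: commutator_K pow_K one_K A.commutator_pow B.commutator_pow
        V.pow_mult_distrib V.m_comm V.nat_pow_inv \<beta>_pow_n)
next
  fix x y z assume "x \<in> carrier K" "y \<in> carrier K" "z \<in> carrier K"
  then obtain a b v a' b' v' a'' b'' v''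
    where x: "x = (a, b, v)" "a \<in> carrier A" "b \<in> carrier B" "v \<in> carrier V"
      and y: "y = (a', b', v')" "a' \<in> carrier A" "b' \<in> carrier B" "v' \<in> carrier V"
      and z: "z = (a'', b'', v'')" "a'' \<in> carrier A" "b'' \<in> carrier B" "v'' \<in> carrier V"
    by (auto simp: carrier_K)
  have "\<beta> (commutator A a a') b'' = \<one>\<^bsub>V\<^esub>"
    using x y z by (intro \<beta>_PD_left) (auto simp: A.commutator_in_power_derived)
  moreover have "\<beta> a'' (commutator B b b') = \<one>\<^bsub>V\<^esub>"
    using x y z by (intro \<beta>_PD_right) (auto simp: B.commutator_in_power_derived)
  ultimately show "commutator K (commutator K x y) z = \<one>\<^bsub>K\<^esub>"
    using x y z by (simp add: commutator_K one_K A.commutator3 B.commutator3)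
qed

section \<open>The quotient that identifies the two copies of \<open>D\<close>\<close>

text \<open>Dividing by these elements imposes three identifications at once:
  \<open>\<iota>\<^sub>A d\<close> with \<open>\<iota>\<^sub>B d\<close>, each \<open>x\<close> in
  \<open>A.PD\<close> with \<open>z\<^sub>A x\<close>, and each \<open>y\<close> in
  \<open>B.PD\<close> with \<open>z\<^sub>B y\<close>.\<close>

definition elem :: "'d \<Rightarrow> 'a \<Rightarrow> 'b \<Rightarrow> 'a \<times> 'b \<times> 'v" where
  "elem d x y = (\<iota>\<^sub>A d \<otimes>\<^bsub>A\<^esub> x, inv\<^bsub>B\<^esub> \<iota>\<^sub>B d \<otimes>\<^bsub>B\<^esub> y, inv\<^bsub>V\<^esub> (z\<^sub>A x \<otimes>\<^bsub>V\<^esub> z\<^sub>B y))"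

definition N :: "('a \<times> 'b \<times> 'v) set" where
  "N = {elem d x y |d x y. d \<in> carrier D \<and> x \<in> A.PD \<and> y \<in> B.PD}"

lemma elem_closed: "d \<in> carrier D \<Longrightarrow> x \<in> A.PD \<Longrightarrow> y \<in> B.PD \<Longrightarrow> elem d x y \<in> carrier K"
  by (simp add: elem_def carrier_K)

lemma elem_one: "elem \<one>\<^bsub>D\<^esub> \<one>\<^bsub>A\<^esub> \<one>\<^bsub>B\<^esub> = \<one>\<^bsub>K\<^esub>"
  by (simp add: elem_def one_K)

text \<open>In the second component the images of \<open>d\<close> and \<open>e\<close> appear
  inverted, so their product is the inverse of the image of \<open>e d\<close> rather than of
  \<open>d e\<close>. The discrepancy is a commutator in \<open>B.PD\<close> and is absorbed by the
  third parameter of \<open>elem\<close>.\<close>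

lemma elem_mult:
  assumes d: "d \<in> carrier D" "x \<in> A.PD" "y \<in> B.PD" and e: "e \<in> carrier D" "x' \<in> A.PD" "y' \<in> B.PD"
  shows "elem d x y \<otimes>\<^bsub>K\<^esub> elem e x' y'
    = elem (d \<otimes>\<^bsub>D\<^esub> e) (x \<otimes>\<^bsub>A\<^esub> x') (inv\<^bsub>B\<^esub> commutator B (\<iota>\<^sub>B e) (\<iota>\<^sub>B d) \<otimes>\<^bsub>B\<^esub> (y \<otimes>\<^bsub>B\<^esub> y'))"
proof -
  let ?c = "commutator B (\<iota>\<^sub>B e) (\<iota>\<^sub>B d)"
  have c: "?c \<in> B.PD" using d e by (simp add: B.commutator_in_power_derived)
  have cent: "x \<in> center A" "y \<in> center B" using d A.PD_central B.PD_central by auto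
  have "\<iota>\<^sub>A d \<otimes>\<^bsub>A\<^esub> x \<otimes>\<^bsub>A\<^esub> (\<iota>\<^sub>A e \<otimes>\<^bsub>A\<^esub> x') = \<iota>\<^sub>A d \<otimes>\<^bsub>A\<^esub> (x \<otimes>\<^bsub>A\<^esub> \<iota>\<^sub>A e) \<otimes>\<^bsub>A\<^esub> x'"
    using d e by (simp add: A.m_assoc)
  also have "\<dots> = \<iota>\<^sub>A d \<otimes>\<^bsub>A\<^esub> (\<iota>\<^sub>A e \<otimes>\<^bsub>A\<^esub> x) \<otimes>\<^bsub>A\<^esub> x'"
    using A.centerD[OF cent(1), of "\<iota>\<^sub>A e"] e by simp
  also have "\<dots> = \<iota>\<^sub>A (d \<otimes>\<^bsub>D\<^esub> e) \<otimes>\<^bsub>A\<^esub> (x \<otimes>\<^bsub>A\<^esub> x')"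
    using d e by (simp add: A.m_assoc)
  finally have first: "\<iota>\<^sub>A d \<otimes>\<^bsub>A\<^esub> x \<otimes>\<^bsub>A\<^esub> (\<iota>\<^sub>A e \<otimes>\<^bsub>A\<^esub> x') = \<iota>\<^sub>A (d \<otimes>\<^bsub>D\<^esub> e) \<otimes>\<^bsub>A\<^esub> (x \<otimes>\<^bsub>A\<^esub> x')" .
  have "inv\<^bsub>B\<^esub> \<iota>\<^sub>B d \<otimes>\<^bsub>B\<^esub> y \<otimes>\<^bsub>B\<^esub> (inv\<^bsub>B\<^esub> \<iota>\<^sub>B e \<otimes>\<^bsub>B\<^esub> y')
    = inv\<^bsub>B\<^esub> \<iota>\<^sub>B d \<otimes>\<^bsub>B\<^esub> (y \<otimes>\<^bsub>B\<^esub> inv\<^bsub>B\<^esub> \<iota>\<^sub>B e) \<otimes>\<^bsub>B\<^esub> y'"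
    using d e by (simp add: B.m_assoc)
  also have "\<dots> = inv\<^bsub>B\<^esub> \<iota>\<^sub>B d \<otimes>\<^bsub>B\<^esub> (inv\<^bsub>B\<^esub> \<iota>\<^sub>B e \<otimes>\<^bsub>B\<^esub> y) \<otimes>\<^bsub>B\<^esub> y'"
    using B.centerD[OF cent(2), of "inv\<^bsub>B\<^esub> \<iota>\<^sub>B e"] e by simp
  also have "\<dots> = inv\<^bsub>B\<^esub> (\<iota>\<^sub>B e \<otimes>\<^bsub>B\<^esub> \<iota>\<^sub>B d) \<otimes>\<^bsub>B\<^esub> (y \<otimes>\<^bsub>B\<^esub> y')"
    using d e by (simp add: B.m_assoc B.inv_mult_group)
  also have "\<iota>\<^sub>B e \<otimes>\<^bsub>B\<^esub> \<iota>\<^sub>B d = ?c \<otimes>\<^bsub>B\<^esub> \<iota>\<^sub>B (d \<otimes>\<^bsub>D\<^esub> e)"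
    using d e B.centerD[OF B.commutator_central, of "\<iota>\<^sub>B e" "\<iota>\<^sub>B d" "\<iota>\<^sub>B (d \<otimes>\<^bsub>D\<^esub> e)"]
    by (simp add: B.mult_commutator)
  also have "inv\<^bsub>B\<^esub> \<dots> \<otimes>\<^bsub>B\<^esub> (y \<otimes>\<^bsub>B\<^esub> y') = inv\<^bsub>B\<^esub> \<iota>\<^sub>B (d \<otimes>\<^bsub>D\<^esub> e) \<otimes>\<^bsub>B\<^esub> (inv\<^bsub>B\<^esub> ?c \<otimes>\<^bsub>B\<^esub> (y \<otimes>\<^bsub>B\<^esub> y'))"
    using d e by (simp add: B.inv_mult_group B.m_assoc)
  finally have second: "inv\<^bsub>B\<^esub> \<iota>\<^sub>B d \<otimes>\<^bsub>B\<^esub> y \<otimes>\<^bsub>B\<^esub> (inv\<^bsub>B\<^esub> \<iota>\<^sub>B e \<otimes>\<^bsub>B\<^esub> y')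
    = inv\<^bsub>B\<^esub> \<iota>\<^sub>B (d \<otimes>\<^bsub>D\<^esub> e) \<otimes>\<^bsub>B\<^esub> (inv\<^bsub>B\<^esub> ?c \<otimes>\<^bsub>B\<^esub> (y \<otimes>\<^bsub>B\<^esub> y'))" .
  \<comment> \<open>At elements of \<open>D\<close> the cocycle is known by
    \<open>\<beta>_D_left\<close>; its value accounts exactly for the commutator that was moved into
    the second component.\<close>
  have "\<beta> (\<iota>\<^sub>A e \<otimes>\<^bsub>A\<^esub> x') (inv\<^bsub>B\<^esub> \<iota>\<^sub>B d \<otimes>\<^bsub>B\<^esub> y) = inv\<^bsub>V\<^esub> z\<^sub>B ?c"
    using d e c by (simp add: \<beta>_mult_left \<beta>_mult_right \<beta>_PD_left \<beta>_PD_right \<beta>_inv_right \<beta>_D_left)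
  then have third: "inv\<^bsub>V\<^esub> (z\<^sub>A x \<otimes>\<^bsub>V\<^esub> z\<^sub>B y) \<otimes>\<^bsub>V\<^esub> inv\<^bsub>V\<^esub> (z\<^sub>A x' \<otimes>\<^bsub>V\<^esub> z\<^sub>B y')
      \<otimes>\<^bsub>V\<^esub> inv\<^bsub>V\<^esub> \<beta> (\<iota>\<^sub>A e \<otimes>\<^bsub>A\<^esub> x') (inv\<^bsub>B\<^esub> \<iota>\<^sub>B d \<otimes>\<^bsub>B\<^esub> y)
    = inv\<^bsub>V\<^esub> (z\<^sub>A (x \<otimes>\<^bsub>A\<^esub> x') \<otimes>\<^bsub>V\<^esub> z\<^sub>B (inv\<^bsub>B\<^esub> ?c \<otimes>\<^bsub>B\<^esub> (y \<otimes>\<^bsub>B\<^esub> y')))"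
    using d e c by (simp add: z\<^sub>A_mult z\<^sub>B_mult z\<^sub>B_inv V.inv_mult V.m_ac)
  show ?thesis unfolding elem_def mult_K first second third ..
qed

lemma N_subgroup: "subgroup N K"
proof
  show "N \<subseteq> carrier K" by (auto simp: N_def elem_closed)
  show "\<one>\<^bsub>K\<^esub> \<in> N" unfolding N_def
    by (rule CollectI, rule exI[of _ "\<one>\<^bsub>D\<^esub>"], rule exI[of _ "\<one>\<^bsub>A\<^esub>"], rule exI[of _ "\<one>\<^bsub>B\<^esub>"])
      (simp add: elem_one)
next
  fix u w assume "u \<in> N" "w \<in> N"
  then obtain d x y e x' y' where d: "d \<in> carrier D" "x \<in> A.PD" "y \<in> B.PD"
    and e: "e \<in> carrier D" "x' \<in> A.PD" "y' \<in> B.PD" and u: "u = elem d x y" "w = elem e x' y'"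
    unfolding N_def by blast
  have "inv\<^bsub>B\<^esub> commutator B (\<iota>\<^sub>B e) (\<iota>\<^sub>B d) \<otimes>\<^bsub>B\<^esub> (y \<otimes>\<^bsub>B\<^esub> y') \<in> B.PD"
    using d e by (simp add: B.commutator_in_power_derived)
  moreover have "x \<otimes>\<^bsub>A\<^esub> x' \<in> A.PD" "d \<otimes>\<^bsub>D\<^esub> e \<in> carrier D" using d e by simp_all
  ultimately show "u \<otimes>\<^bsub>K\<^esub> w \<in> N"
    unfolding u elem_mult[OF d e] N_def by blast
next
  fix u assume "u \<in> N"
  then obtain d x y where d: "d \<in> carrier D" "x \<in> A.PD" "y \<in> B.PD" and u: "u = elem d x y"
    unfolding N_def by blast
  let ?w = "elem (inv\<^bsub>D\<^esub> d) (inv\<^bsub>A\<^esub> x) (inv\<^bsub>B\<^esub> y)"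
  have d': "inv\<^bsub>D\<^esub> d \<in> carrier D" "inv\<^bsub>A\<^esub> x \<in> A.PD" "inv\<^bsub>B\<^esub> y \<in> B.PD" using d by simp_all
  have "commutator B (\<iota>\<^sub>B d) (\<iota>\<^sub>B (inv\<^bsub>D\<^esub> d)) = \<one>\<^bsub>B\<^esub>"
    using d by (intro B.commutator_eqI) auto
  then have "?w \<otimes>\<^bsub>K\<^esub> u = \<one>\<^bsub>K\<^esub>"
    unfolding u elem_mult[OF d' d] using d by (simp add: elem_one)
  then have "inv\<^bsub>K\<^esub> u = ?w"
    using K.inv_equality elem_closed d d' u by simp
  then show "inv\<^bsub>K\<^esub> u \<in> N" unfolding N_def using d' by blast
qed

text \<open>The third component combines the values of \<beta> at \<open>a\<close> with
  \<open>D\<close> and at \<open>D\<close> with \<open>b\<close>. Both compatibility assumptions on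
  \<beta> enter, and they make the result an element of \<open>N\<close> again.\<close>

lemma commutator_elem:
  assumes "a \<in> carrier A" "b \<in> carrier B" "v \<in> carrier V" and d: "d \<in> carrier D" "x \<in> A.PD" "y \<in> B.PD"
  shows "commutator K (a, b, v) (elem d x y) = elem \<one>\<^bsub>D\<^esub> (commutator A a (\<iota>\<^sub>A d)) (commutator B (\<iota>\<^sub>B d) b)"
proof -
  have cent: "x \<in> center A" "y \<in> center B" using d A.PD_central B.PD_central by auto
  have cA: "commutator A a (\<iota>\<^sub>A d \<otimes>\<^bsub>A\<^esub> x) = commutator A a (\<iota>\<^sub>A d)"
    using assms cent by (simp add: A.commutator_mult_right A.commutator_center_right)
  have i: "commutator B b (inv\<^bsub>B\<^esub> \<iota>\<^sub>B d) = inv\<^bsub>B\<^esub> commutator B b (\<iota>\<^sub>B d)"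
    using assms B.commutator_mult_right[of "inv\<^bsub>B\<^esub> \<iota>\<^sub>B d" "\<iota>\<^sub>B d" b] B.commutator_center_right[of "\<one>\<^bsub>B\<^esub>" b]
      subgroup.one_closed[OF B.center_subgroup] by (simp add: B.inv_equality)
  have cB: "commutator B b (inv\<^bsub>B\<^esub> \<iota>\<^sub>B d \<otimes>\<^bsub>B\<^esub> y) = commutator B (\<iota>\<^sub>B d) b"
    using assms cent i B.commutator_swap[of b "\<iota>\<^sub>B d"]
    by (simp add: B.commutator_mult_right B.commutator_center_right)
  have PD: "commutator A a (\<iota>\<^sub>A d) \<in> A.PD" "commutator B (\<iota>\<^sub>B d) b \<in> B.PD"
    using assms by (simp_all add: A.commutator_in_power_derived B.commutator_in_power_derived)
  have "\<beta> a (inv\<^bsub>B\<^esub> \<iota>\<^sub>B d \<otimes>\<^bsub>B\<^esub> y) \<otimes>\<^bsub>V\<^esub> inv\<^bsub>V\<^esub> \<beta> (\<iota>\<^sub>A d \<otimes>\<^bsub>A\<^esub> x) b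
    = inv\<^bsub>V\<^esub> (z\<^sub>A (commutator A a (\<iota>\<^sub>A d)) \<otimes>\<^bsub>V\<^esub> z\<^sub>B (commutator B (\<iota>\<^sub>B d) b))"
    using assms PD by (simp add: \<beta>_mult_left \<beta>_mult_right \<beta>_PD_left \<beta>_PD_right \<beta>_inv_right \<beta>_D_left
        \<beta>_D_right V.inv_mult)
  then show ?thesis
    using assms cA cB unfolding elem_def by (subst commutator_K) simp_all
qed

text \<open>Since \<open>K\<close> has class two, conjugating \<open>h\<close> by \<open>x\<close>
  multiplies \<open>h\<close> by the central element \<open>[x, h]\<close>, and
  \<open>commutator_elem\<close> places it in \<open>N\<close>.\<close>

lemma N_normal: "N \<lhd> K"
proof -
  interpret K': variety_group K m n by unfold_locales (rule in_variety_K)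
  have "x \<otimes>\<^bsub>K\<^esub> h \<otimes>\<^bsub>K\<^esub> inv\<^bsub>K\<^esub> x \<in> N" if x: "x \<in> carrier K" and h: "h \<in> N" for x h
  proof -
    have hK: "h \<in> carrier K" using h subgroup.mem_carrier[OF N_subgroup] by blast
    obtain a b v where x': "x = (a, b, v)" "a \<in> carrier A" "b \<in> carrier B" "v \<in> carrier V"
      using x by (auto simp: carrier_K)
    obtain d y z where h': "h = elem d y z" "d \<in> carrier D" "y \<in> A.PD" "z \<in> B.PD"
      using h unfolding N_def by blast
    have "commutator K x h \<in> N"
      unfolding x' h' commutator_elem[OF x'(2-4) h'(2-4)] N_def
      using A.commutator_in_power_derived[OF x'(2) \<iota>\<^sub>A.hom_closed[OF h'(2)]]
        B.commutator_in_power_derived[OF \<iota>\<^sub>B.hom_closed[OF h'(2)] x'(3)] D.one_closed by blast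
    then have "h \<otimes>\<^bsub>K\<^esub> commutator K x h \<in> N" by (rule subgroup.m_closed[OF N_subgroup h])
    moreover have "h \<otimes>\<^bsub>K\<^esub> commutator K x h = x \<otimes>\<^bsub>K\<^esub> h \<otimes>\<^bsub>K\<^esub> inv\<^bsub>K\<^esub> x"
    proof -
      have "h \<otimes>\<^bsub>K\<^esub> commutator K x h \<otimes>\<^bsub>K\<^esub> x = h \<otimes>\<^bsub>K\<^esub> x \<otimes>\<^bsub>K\<^esub> commutator K x h"
        using x hK K.centerD[OF K'.commutator_central[OF x hK] x] by (simp add: K.m_assoc)
      also have "\<dots> = x \<otimes>\<^bsub>K\<^esub> h" using x hK by (simp add: K.mult_commutator)
      finally show ?thesis using x hK by (simp add: K.inv_solve_right)
    qed
    ultimately show ?thesis by simp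
  qed
  then show ?thesis using N_subgroup by (simp add: K.normal_inv_iff)
qed

text \<open>A trivial third component means
  \<open>z\<^sub>A x \<otimes> z\<^sub>B y = \<one>\<close>, and \<open>separate\<close> then shows
  that \<open>x\<close> and \<open>y\<close> come from \<open>D\<close> too. This one fact yields
  both the injectivity of the two embeddings and the intersection of their images.\<close>

lemma N_trivial_third:
  assumes "(a, b, \<one>\<^bsub>V\<^esub>) \<in> N"
  shows "\<exists>e\<in>carrier D. a = \<iota>\<^sub>A e \<and> b = inv\<^bsub>B\<^esub> \<iota>\<^sub>B e"
proof -
  obtain d x y where d: "d \<in> carrier D" "x \<in> A.PD" "y \<in> B.PD"
    and ab: "a = \<iota>\<^sub>A d \<otimes>\<^bsub>A\<^esub> x" "b = inv\<^bsub>B\<^esub> \<iota>\<^sub>B d \<otimes>\<^bsub>B\<^esub> y"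
    and v: "\<one>\<^bsub>V\<^esub> = inv\<^bsub>V\<^esub> (z\<^sub>A x \<otimes>\<^bsub>V\<^esub> z\<^sub>B y)"
    using assms unfolding N_def elem_def by blast
  have "z\<^sub>A x \<otimes>\<^bsub>V\<^esub> z\<^sub>B y = \<one>\<^bsub>V\<^esub>" using v d by (metis V.inv_eq_1_iff V.m_closed z\<^sub>A_closed z\<^sub>B_closed)
  then obtain e where e: "e \<in> carrier D" "x = \<iota>\<^sub>A e" "y = inv\<^bsub>B\<^esub> \<iota>\<^sub>B e"
    using separate d by blast
  have "b = inv\<^bsub>B\<^esub> \<iota>\<^sub>B e \<otimes>\<^bsub>B\<^esub> inv\<^bsub>B\<^esub> \<iota>\<^sub>B d"
    using ab e d B.PD_central B.centerD[of y "inv\<^bsub>B\<^esub> \<iota>\<^sub>B d"] by auto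
  then have "b = inv\<^bsub>B\<^esub> \<iota>\<^sub>B (d \<otimes>\<^bsub>D\<^esub> e)" using d e by (simp add: B.inv_mult_group)
  moreover have "a = \<iota>\<^sub>A (d \<otimes>\<^bsub>D\<^esub> e)" using ab d e by simp
  ultimately show ?thesis using d e by (intro bexI[of _ "d \<otimes>\<^bsub>D\<^esub> e"]) auto
qed

lemma strong_embedding_quotient:
  "strong_embedding m n A B D \<iota>\<^sub>A \<iota>\<^sub>B (K Mod N)
     (\<lambda>a. N #>\<^bsub>K\<^esub> (a, \<one>\<^bsub>B\<^esub>, \<one>\<^bsub>V\<^esub>)) (\<lambda>b. N #>\<^bsub>K\<^esub> (\<one>\<^bsub>A\<^esub>, b, \<one>\<^bsub>V\<^esub>))"
proof -
  interpret N: normal N K by (rule N_normal)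
  interpret M: group "K Mod N" by (rule N.factorgroup_is_group)
  interpret \<pi>: group_hom K "K Mod N" "\<lambda>u. N #>\<^bsub>K\<^esub> u" by unfold_locales (rule N.r_coset_hom_Mod)
  define \<phi>\<^sub>A where "\<phi>\<^sub>A = (\<lambda>a. N #>\<^bsub>K\<^esub> (a, \<one>\<^bsub>B\<^esub>, \<one>\<^bsub>V\<^esub>))"
  define \<phi>\<^sub>B where "\<phi>\<^sub>B = (\<lambda>b. N #>\<^bsub>K\<^esub> (\<one>\<^bsub>A\<^esub>, b, \<one>\<^bsub>V\<^esub>))"
  have inA: "(a, \<one>\<^bsub>B\<^esub>, \<one>\<^bsub>V\<^esub>) \<in> carrier K" if "a \<in> carrier A" for a using that by (simp add: carrier_K)
  have inB: "(\<one>\<^bsub>A\<^esub>, b, \<one>\<^bsub>V\<^esub>) \<in> carrier K" if "b \<in> carrier B" for b using that by (simp add: carrier_K)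
  have homA: "\<phi>\<^sub>A \<in> hom A (K Mod N)"
  proof (rule homI)
    fix a a' assume a: "a \<in> carrier A" "a' \<in> carrier A"
    then have "(a \<otimes>\<^bsub>A\<^esub> a', \<one>\<^bsub>B\<^esub>, \<one>\<^bsub>V\<^esub>) = (a, \<one>\<^bsub>B\<^esub>, \<one>\<^bsub>V\<^esub>) \<otimes>\<^bsub>K\<^esub> (a', \<one>\<^bsub>B\<^esub>, \<one>\<^bsub>V\<^esub>)"
      by (simp add: mult_K)
    then show "\<phi>\<^sub>A (a \<otimes>\<^bsub>A\<^esub> a') = \<phi>\<^sub>A a \<otimes>\<^bsub>K Mod N\<^esub> \<phi>\<^sub>A a'"
      unfolding \<phi>\<^sub>A_def using \<pi>.hom_mult[OF inA[OF a(1)] inA[OF a(2)]] by simp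
  qed (use \<pi>.hom_closed inA in \<open>simp add: \<phi>\<^sub>A_def\<close>)
  have homB: "\<phi>\<^sub>B \<in> hom B (K Mod N)"
  proof (rule homI)
    fix b b' assume b: "b \<in> carrier B" "b' \<in> carrier B"
    then have "(\<one>\<^bsub>A\<^esub>, b \<otimes>\<^bsub>B\<^esub> b', \<one>\<^bsub>V\<^esub>) = (\<one>\<^bsub>A\<^esub>, b, \<one>\<^bsub>V\<^esub>) \<otimes>\<^bsub>K\<^esub> (\<one>\<^bsub>A\<^esub>, b', \<one>\<^bsub>V\<^esub>)"
      by (simp add: mult_K)
    then show "\<phi>\<^sub>B (b \<otimes>\<^bsub>B\<^esub> b') = \<phi>\<^sub>B b \<otimes>\<^bsub>K Mod N\<^esub> \<phi>\<^sub>B b'"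
      unfolding \<phi>\<^sub>B_def using \<pi>.hom_mult[OF inB[OF b(1)] inB[OF b(2)]] by simp
  qed (use \<pi>.hom_closed inB in \<open>simp add: \<phi>\<^sub>B_def\<close>)
  interpret \<phi>\<^sub>A: group_hom A "K Mod N" \<phi>\<^sub>A by unfold_locales (rule homA)
  interpret \<phi>\<^sub>B: group_hom B "K Mod N" \<phi>\<^sub>B by unfold_locales (rule homB)
  \<comment> \<open>With \<open>b\<close> or \<open>a\<close> trivial this equivalence controls a
    kernel; for general \<open>a\<close> and \<open>b\<close> it controls the intersection of the
    images.\<close>
  have eq: "\<phi>\<^sub>A a = \<phi>\<^sub>B b \<longleftrightarrow> (a, inv\<^bsub>B\<^esub> b, \<one>\<^bsub>V\<^esub>) \<in> N" if a: "a \<in> carrier A" and b: "b \<in> carrier B" for a b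
  proof -
    have "\<phi>\<^sub>A a = \<phi>\<^sub>B b \<longleftrightarrow> \<phi>\<^sub>A a \<otimes>\<^bsub>K Mod N\<^esub> \<phi>\<^sub>B (inv\<^bsub>B\<^esub> b) = \<one>\<^bsub>K Mod N\<^esub>"
      using a b M.mult_inv_eq_one_iff[of "\<phi>\<^sub>A a" "\<phi>\<^sub>B b"] by simp
    also have "\<phi>\<^sub>A a \<otimes>\<^bsub>K Mod N\<^esub> \<phi>\<^sub>B (inv\<^bsub>B\<^esub> b)
        = N #>\<^bsub>K\<^esub> ((a, \<one>\<^bsub>B\<^esub>, \<one>\<^bsub>V\<^esub>) \<otimes>\<^bsub>K\<^esub> (\<one>\<^bsub>A\<^esub>, inv\<^bsub>B\<^esub> b, \<one>\<^bsub>V\<^esub>))"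
      unfolding \<phi>\<^sub>A_def \<phi>\<^sub>B_def using a b by (intro \<pi>.hom_mult[symmetric] inA inB) auto
    also have "(a, \<one>\<^bsub>B\<^esub>, \<one>\<^bsub>V\<^esub>) \<otimes>\<^bsub>K\<^esub> (\<one>\<^bsub>A\<^esub>, inv\<^bsub>B\<^esub> b, \<one>\<^bsub>V\<^esub>) = (a, inv\<^bsub>B\<^esub> b, \<one>\<^bsub>V\<^esub>)"
      using a b by (simp add: mult_K)
    finally show ?thesis
      using a b N.coset_eq_self_iff[of "(a, inv\<^bsub>B\<^esub> b, \<one>\<^bsub>V\<^esub>)"] by (simp add: carrier_K)
  qed
  have inj\<iota>: "e = \<one>\<^bsub>D\<^esub>" if "e \<in> carrier D" "\<iota>\<^sub>A e = \<one>\<^bsub>A\<^esub> \<or> \<iota>\<^sub>B e = \<one>\<^bsub>B\<^esub>" for e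
    using that \<iota>\<^sub>A \<iota>\<^sub>B \<iota>\<^sub>A.inj_on_one_iff \<iota>\<^sub>B.inj_on_one_iff unfolding mon_def by blast
  have "a = \<one>\<^bsub>A\<^esub>" if a: "a \<in> carrier A" "\<phi>\<^sub>A a = \<one>\<^bsub>K Mod N\<^esub>" for a
  proof -
    have "(a, \<one>\<^bsub>B\<^esub>, \<one>\<^bsub>V\<^esub>) \<in> N" using eq[of a "\<one>\<^bsub>B\<^esub>"] a by simp
    then obtain e where e: "e \<in> carrier D" "a = \<iota>\<^sub>A e" "\<one>\<^bsub>B\<^esub> = inv\<^bsub>B\<^esub> \<iota>\<^sub>B e"
      using N_trivial_third by blast
    have "\<iota>\<^sub>B e = \<one>\<^bsub>B\<^esub>" using B.inv_eq_1_iff[OF \<iota>\<^sub>B.hom_closed[OF e(1)]] e(3) by metis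
    then have "e = \<one>\<^bsub>D\<^esub>" using inj\<iota>[OF e(1)] by blast
    then show ?thesis using e(2) by simp
  qed
  then have monA: "\<phi>\<^sub>A \<in> mon A (K Mod N)"
    unfolding mon_def using homA \<phi>\<^sub>A.inj_on_one_iff by blast
  have "b = \<one>\<^bsub>B\<^esub>" if b: "b \<in> carrier B" "\<phi>\<^sub>B b = \<one>\<^bsub>K Mod N\<^esub>" for b
  proof -
    have "(\<one>\<^bsub>A\<^esub>, inv\<^bsub>B\<^esub> b, \<one>\<^bsub>V\<^esub>) \<in> N" using eq[of "\<one>\<^bsub>A\<^esub>" b] b by simp
    then obtain e where e: "e \<in> carrier D" "\<one>\<^bsub>A\<^esub> = \<iota>\<^sub>A e" "inv\<^bsub>B\<^esub> b = inv\<^bsub>B\<^esub> \<iota>\<^sub>B e"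
      using N_trivial_third by blast
    then have "e = \<one>\<^bsub>D\<^esub>" using inj\<iota>[OF e(1)] by metis
    then show ?thesis using e(3) b(1) by simp
  qed
  then have monB: "\<phi>\<^sub>B \<in> mon B (K Mod N)"
    unfolding mon_def using homB \<phi>\<^sub>B.inj_on_one_iff by blast
  have agree: "\<phi>\<^sub>A (\<iota>\<^sub>A d) = \<phi>\<^sub>B (\<iota>\<^sub>B d)" if d: "d \<in> carrier D" for d
  proof -
    have "elem d \<one>\<^bsub>A\<^esub> \<one>\<^bsub>B\<^esub> \<in> N"
      unfolding N_def using d subgroup.one_closed[OF A.PD_subgroup] subgroup.one_closed[OF B.PD_subgroup]
      by blast
    then show ?thesis using d by (subst eq) (simp_all add: elem_def)
  qed
  have "\<phi>\<^sub>A ` carrier A \<inter> \<phi>\<^sub>B ` carrier B \<subseteq> \<phi>\<^sub>A ` \<iota>\<^sub>A ` carrier D"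
  proof
    fix u assume "u \<in> \<phi>\<^sub>A ` carrier A \<inter> \<phi>\<^sub>B ` carrier B"
    then obtain a b where ab: "a \<in> carrier A" "b \<in> carrier B" "u = \<phi>\<^sub>A a" "\<phi>\<^sub>A a = \<phi>\<^sub>B b" by auto
    then have "(a, inv\<^bsub>B\<^esub> b, \<one>\<^bsub>V\<^esub>) \<in> N" using eq by blast
    then obtain e where "e \<in> carrier D" "a = \<iota>\<^sub>A e" using N_trivial_third by blast
    then show "u \<in> \<phi>\<^sub>A ` \<iota>\<^sub>A ` carrier D" using ab(3) by blast
  qed
  moreover have "\<phi>\<^sub>A ` \<iota>\<^sub>A ` carrier D \<subseteq> \<phi>\<^sub>A ` carrier A \<inter> \<phi>\<^sub>B ` carrier B"
  proof
    fix u assume "u \<in> \<phi>\<^sub>A ` \<iota>\<^sub>A ` carrier D"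
    then obtain d where d: "d \<in> carrier D" "u = \<phi>\<^sub>A (\<iota>\<^sub>A d)" by blast
    then have "u = \<phi>\<^sub>B (\<iota>\<^sub>B d)" using agree[OF d(1)] by metis
    then show "u \<in> \<phi>\<^sub>A ` carrier A \<inter> \<phi>\<^sub>B ` carrier B"
      using imageI[OF \<iota>\<^sub>A.hom_closed[OF d(1)], of \<phi>\<^sub>A] imageI[OF \<iota>\<^sub>B.hom_closed[OF d(1)], of \<phi>\<^sub>B] d(2)
      by simp
  qed
  ultimately have "\<phi>\<^sub>A ` carrier A \<inter> \<phi>\<^sub>B ` carrier B = \<phi>\<^sub>A ` \<iota>\<^sub>A ` carrier D"
    by (rule equalityI)
  moreover have "in_variety m n (K Mod N)"
    by (rule in_variety_hom_image[OF in_variety_K M.is_group N.r_coset_hom_Mod])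
      (simp add: carrier_FactGroup)
  ultimately have "strong_embedding m n A B D \<iota>\<^sub>A \<iota>\<^sub>B (K Mod N) \<phi>\<^sub>A \<phi>\<^sub>B"
    using monA monB agree unfolding strong_embedding_def by (intro conjI ballI)
  then show ?thesis unfolding \<phi>\<^sub>A_def \<phi>\<^sub>B_def .
qed

end

section \<open>The amalgam of two groups in the variety\<close>

lemma (in group) int_pow_add_exponent:
  assumes "x \<in> carrier G" "x [^] (n::nat) = \<one>"
  shows "x [^] (k + l * int n) = x [^] k"
proof -
  have "x [^] (int n * l) = (x [^] int n) [^] l" using assms(1) by (rule int_pow_pow[symmetric])
  then have "x [^] (l * int n) = \<one>" using assms(2) by (simp add: int_pow_int mult.commute)
  then show ?thesis using assms(1) by (simp add: int_pow_mult)
qed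

text \<open>Condition (b) speaks of positive divisors of \<open>n\<close>, whereas diagonalisation
  produces arbitrary integers. As \<open>X\<close> and \<open>Y\<close> have exponent
  \<open>n\<close>, an exponent \<open>q\<close> is reduced to \<open>g = gcd q n\<close>: Bezout
  turns the hypotheses for \<open>q\<close> into those for \<open>g\<close>, and the conclusion for
  \<open>g\<close> is raised to the power \<open>q / g\<close>.\<close>

lemma balanced_pairingsI:
  assumes X: "comm_group X" and Y: "comm_group Y" and W: "comm_group W" and E: "group E"
    and p: "p \<in> hom E X" and r: "r \<in> hom E Y"
    and \<alpha>_left: "\<And>d. d \<in> carrier E \<Longrightarrow> (\<lambda>x. \<alpha> x d) \<in> hom X W"
    and \<alpha>_right: "\<And>x. x \<in> carrier X \<Longrightarrow> \<alpha> x \<in> hom E W"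
    and \<gamma>_left: "\<And>y. y \<in> carrier Y \<Longrightarrow> (\<lambda>d. \<gamma> d y) \<in> hom E W"
    and \<gamma>_right: "\<And>d. d \<in> carrier E \<Longrightarrow> \<gamma> d \<in> hom Y W"
    and X_exp: "\<And>x. x \<in> carrier X \<Longrightarrow> x [^]\<^bsub>X\<^esub> (n::nat) = \<one>\<^bsub>X\<^esub>"
    and Y_exp: "\<And>y. y \<in> carrier Y \<Longrightarrow> y [^]\<^bsub>Y\<^esub> n = \<one>\<^bsub>Y\<^esub>"
    and \<gamma>_cong: "\<And>d e y. d \<in> carrier E \<Longrightarrow> e \<in> carrier E \<Longrightarrow> y \<in> carrier Y \<Longrightarrow> p d = p e \<Longrightarrow> \<gamma> d y = \<gamma> e y"
    and \<alpha>_cong: "\<And>d e x. d \<in> carrier E \<Longrightarrow> e \<in> carrier E \<Longrightarrow> x \<in> carrier X \<Longrightarrow> r d = r e \<Longrightarrow> \<alpha> x d = \<alpha> x e"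
    and balance: "\<And>(q::nat) x y d e. q > 0 \<Longrightarrow> q dvd n \<Longrightarrow> x \<in> carrier X \<Longrightarrow> y \<in> carrier Y \<Longrightarrow>
      d \<in> carrier E \<Longrightarrow> e \<in> carrier E \<Longrightarrow> p d = x [^]\<^bsub>X\<^esub> q \<Longrightarrow> r e = y [^]\<^bsub>Y\<^esub> q \<Longrightarrow> \<gamma> d y = \<alpha> x e"
  shows "balanced_pairings X Y W E p r \<alpha> \<gamma>"
proof -
  interpret X: comm_group X by fact
  interpret Y: comm_group Y by fact
  interpret W: comm_group W by fact
  interpret E: group E by fact
  interpret p: group_hom E X p by unfold_locales fact
  interpret r: group_hom E Y r by unfold_locales fact
  have main: "\<gamma> d y = \<alpha> x e" if x: "x \<in> carrier X" and y: "y \<in> carrier Y" and d: "d \<in> carrier E"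
    and e: "e \<in> carrier E" and pd: "p d = x [^]\<^bsub>X\<^esub> q" and re: "r e = y [^]\<^bsub>Y\<^esub> q" for q :: int and x y d e
  proof (cases "gcd q (int n) = 0")
    case True
    \<comment> \<open>The gcd vanishes only when \<open>q\<close> and \<open>n\<close> are both 0, a
      case that no positive divisor covers. Both images are then trivial, and the congruence
      assumptions apply.\<close>
    then have "q = 0" by simp
    then have "p d = p \<one>\<^bsub>E\<^esub>" "r e = r \<one>\<^bsub>E\<^esub>" using pd re by simp_all
    then have "\<gamma> d y = \<gamma> \<one>\<^bsub>E\<^esub> y" "\<alpha> x e = \<alpha> x \<one>\<^bsub>E\<^esub>"
      using \<gamma>_cong[OF d E.one_closed y] \<alpha>_cong[OF e E.one_closed x] by blast+
    then show ?thesis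
      using hom_one[OF \<gamma>_left[OF y] E W.is_group] hom_one[OF \<alpha>_right[OF x] E W.is_group] by simp
  next
    case False
    define g where "g = gcd q (int n)"
    obtain u v where uv: "u * q + v * int n = g" using bezout_int[of q "int n"] g_def by blast
    obtain k where k: "q = g * k" using g_def by (metis dvd_def gcd_dvd1)
    have g: "g > 0" using False gcd_ge_0_int[of q "int n"] unfolding g_def by linarith
    then have g_nat: "int (nat g) = g" by simp
    have "nat g dvd n" using g_nat by (metis g_def gcd_dvd2 int_dvd_int_iff)
    have powX: "z [^]\<^bsub>X\<^esub> (u * q) = z [^]\<^bsub>X\<^esub> g" if "z \<in> carrier X" for z
      unfolding uv[symmetric] using that X_exp by (intro X.int_pow_add_exponent[symmetric]) auto
    have powY: "z [^]\<^bsub>Y\<^esub> (u * q) = z [^]\<^bsub>Y\<^esub> g" if "z \<in> carrier Y" for z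
      unfolding uv[symmetric] using that Y_exp by (intro Y.int_pow_add_exponent[symmetric]) auto
    \<comment> \<open>From \<open>p d = x^q\<close> the Bezout coefficient \<open>u\<close> gives
      \<open>p (d^u) = x^(u q) = x^g\<close>, because \<open>u q\<close> and \<open>g\<close> differ
      by a multiple of \<open>n\<close>.\<close>
    define d' where "d' = d [^]\<^bsub>E\<^esub> u"
    define e' where "e' = e [^]\<^bsub>E\<^esub> u"
    have d': "d' \<in> carrier E" and e': "e' \<in> carrier E" using d e by (simp_all add: d'_def e'_def)
    have pd': "p d' = x [^]\<^bsub>X\<^esub> g"
      using d x by (simp add: d'_def p.hom_int_pow pd X.int_pow_pow mult.commute powX[symmetric])
    have re': "r e' = y [^]\<^bsub>Y\<^esub> g"
      using e y by (simp add: e'_def r.hom_int_pow re Y.int_pow_pow mult.commute powY[symmetric])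
    have "p d' = x [^]\<^bsub>X\<^esub> nat g" "r e' = y [^]\<^bsub>Y\<^esub> nat g"
      using pd' re' g_nat by (metis int_pow_int)+
    then have "\<gamma> d' y = \<alpha> x e'"
      using balance[OF _ \<open>nat g dvd n\<close> x y d' e'] g by simp
    moreover have "\<gamma> d y = \<gamma> d' y [^]\<^bsub>W\<^esub> k"
    proof -
      \<comment> \<open>The elements \<open>d'^k\<close> and \<open>d\<close> need not be equal, but
        they have the same image under \<open>p\<close>, which is all that \<gamma> sees.\<close>
      have "p (d' [^]\<^bsub>E\<^esub> k) = p d" using d' x by (simp add: p.hom_int_pow pd pd' X.int_pow_pow k mult.commute)
      then have "\<gamma> d y = \<gamma> (d' [^]\<^bsub>E\<^esub> k) y" using d d' y by (intro \<gamma>_cong) auto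
      also have "\<dots> = \<gamma> d' y [^]\<^bsub>W\<^esub> k" by (rule hom_int_pow[OF \<gamma>_left[OF y] d' E W.is_group])
      finally show ?thesis .
    qed
    moreover have "\<alpha> x e = \<alpha> x e' [^]\<^bsub>W\<^esub> k"
    proof -
      have "r (e' [^]\<^bsub>E\<^esub> k) = r e" using e' y by (simp add: r.hom_int_pow re re' Y.int_pow_pow k mult.commute)
      then have "\<alpha> x e = \<alpha> x (e' [^]\<^bsub>E\<^esub> k)" using e e' x by (intro \<alpha>_cong) auto
      also have "\<dots> = \<alpha> x e' [^]\<^bsub>W\<^esub> k" by (rule hom_int_pow[OF \<alpha>_right[OF x] e' E W.is_group])
      finally show ?thesis .
    qed
    ultimately show ?thesis by simp
  qed
  show ?thesis
    by (intro balanced_pairings.intro balanced_pairings_axioms.intro)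
      (fact assms main)+
qed

locale compatible_amalgam =
  A: variety_group A m n + B: variety_group B m n + D: group D
  for A :: "('a, 'as) monoid_scheme" and B :: "('b, 'bs) monoid_scheme"
    and D :: "('d, 'ds) monoid_scheme" and m n +
  fixes \<iota>\<^sub>A :: "'d \<Rightarrow> 'a" and \<iota>\<^sub>B :: "'d \<Rightarrow> 'b"
  assumes \<iota>\<^sub>A: "\<iota>\<^sub>A \<in> mon D A" and \<iota>\<^sub>B: "\<iota>\<^sub>B \<in> mon D B"
    and central_B: "\<And>d. d \<in> carrier D \<Longrightarrow> \<iota>\<^sub>A d \<in> A.PD \<Longrightarrow> \<iota>\<^sub>B d \<in> center B"
    and central_A: "\<And>d. d \<in> carrier D \<Longrightarrow> \<iota>\<^sub>B d \<in> B.PD \<Longrightarrow> \<iota>\<^sub>A d \<in> center A"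
    and commutators: "\<And>(q::nat) a a' b b' d e. q > 0 \<Longrightarrow> q dvd n \<Longrightarrow> a \<in> carrier A \<Longrightarrow> a' \<in> A.PD \<Longrightarrow>
      b \<in> carrier B \<Longrightarrow> b' \<in> B.PD \<Longrightarrow> d \<in> carrier D \<Longrightarrow> e \<in> carrier D \<Longrightarrow>
      \<iota>\<^sub>A d = a [^]\<^bsub>A\<^esub> q \<otimes>\<^bsub>A\<^esub> a' \<Longrightarrow> \<iota>\<^sub>B e = b [^]\<^bsub>B\<^esub> q \<otimes>\<^bsub>B\<^esub> b' \<Longrightarrow>
      \<exists>f\<in>carrier D. \<iota>\<^sub>B f = commutator B (\<iota>\<^sub>B d) b \<and> \<iota>\<^sub>A f = commutator A a (\<iota>\<^sub>A e)"
begin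

sublocale \<iota>\<^sub>A: group_hom D A \<iota>\<^sub>A by unfold_locales (use \<iota>\<^sub>A in \<open>simp add: mon_def\<close>)
sublocale \<iota>\<^sub>B: group_hom D B \<iota>\<^sub>B by unfold_locales (use \<iota>\<^sub>B in \<open>simp add: mon_def\<close>)

definition P :: "('a \<times> 'b) monoid" where
  "P = A\<lparr>carrier := A.PD\<rparr> \<times>\<times> B\<lparr>carrier := B.PD\<rparr>"

text \<open>Only elements of \<open>D\<close> lying in both central subgroups are glued. The inverse
  in the second coordinate makes the classes of \<open>(\<iota>\<^sub>A e, 1)\<close> and
  \<open>(1, \<iota>\<^sub>B e)\<close> equal.\<close>

definition R :: "('a \<times> 'b) set" where
  "R = {(\<iota>\<^sub>A e, inv\<^bsub>B\<^esub> \<iota>\<^sub>B e) |e. e \<in> carrier D \<and> \<iota>\<^sub>A e \<in> A.PD \<and> \<iota>\<^sub>B e \<in> B.PD}"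

definition w :: "'a \<Rightarrow> 'b \<Rightarrow> ('a \<times> 'b) set" where
  "w x y = R #>\<^bsub>P\<^esub> (x, y)"

abbreviation X where "X \<equiv> A Mod A.PD"
abbreviation Y where "Y \<equiv> B Mod B.PD"
abbreviation W where "W \<equiv> P Mod R"

lemma carrier_P: "carrier P = A.PD \<times> B.PD"
  and mult_P: "(x, y) \<otimes>\<^bsub>P\<^esub> (x', y') = (x \<otimes>\<^bsub>A\<^esub> x', y \<otimes>\<^bsub>B\<^esub> y')"
  and one_P: "\<one>\<^bsub>P\<^esub> = (\<one>\<^bsub>A\<^esub>, \<one>\<^bsub>B\<^esub>)"
  by (simp_all add: P_def)

sublocale P: comm_group P
  unfolding P_def
proof (rule comm_group_DirProd)
  show "comm_group (A\<lparr>carrier := A.PD\<rparr>)"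
    using A.PD_central A.centerD
    by (intro group.group_comm_groupI subgroup.subgroup_is_group[OF A.PD_subgroup A.is_group]) auto
  show "comm_group (B\<lparr>carrier := B.PD\<rparr>)"
    using B.PD_central B.centerD
    by (intro group.group_comm_groupI subgroup.subgroup_is_group[OF B.PD_subgroup B.is_group]) auto
qed

lemma R_subgroup: "subgroup R P"
proof (rule P.subgroupI)
  show "R \<subseteq> carrier P" by (auto simp: R_def carrier_P)
  have "(\<iota>\<^sub>A \<one>\<^bsub>D\<^esub>, inv\<^bsub>B\<^esub> \<iota>\<^sub>B \<one>\<^bsub>D\<^esub>) \<in> R" unfolding R_def
    using subgroup.one_closed[OF A.PD_subgroup] subgroup.one_closed[OF B.PD_subgroup] by force
  then show "R \<noteq> {}" by blast
next
  fix u assume "u \<in> R"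
  then obtain e where e: "e \<in> carrier D" "\<iota>\<^sub>A e \<in> A.PD" "\<iota>\<^sub>B e \<in> B.PD" and u: "u = (\<iota>\<^sub>A e, inv\<^bsub>B\<^esub> \<iota>\<^sub>B e)"
    unfolding R_def by blast
  have "inv\<^bsub>P\<^esub> u = (\<iota>\<^sub>A (inv\<^bsub>D\<^esub> e), inv\<^bsub>B\<^esub> \<iota>\<^sub>B (inv\<^bsub>D\<^esub> e))"
    using e u by (intro P.inv_equality) (auto simp: mult_P one_P carrier_P)
  moreover have "\<iota>\<^sub>A (inv\<^bsub>D\<^esub> e) \<in> A.PD" "\<iota>\<^sub>B (inv\<^bsub>D\<^esub> e) \<in> B.PD" using e by simp_all
  ultimately show "inv\<^bsub>P\<^esub> u \<in> R" unfolding R_def using D.inv_closed[OF e(1)] by blast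
next
  fix u v assume "u \<in> R" "v \<in> R"
  then obtain e f where e: "e \<in> carrier D" "\<iota>\<^sub>A e \<in> A.PD" "\<iota>\<^sub>B e \<in> B.PD" and u: "u = (\<iota>\<^sub>A e, inv\<^bsub>B\<^esub> \<iota>\<^sub>B e)"
    and f: "f \<in> carrier D" "\<iota>\<^sub>A f \<in> A.PD" "\<iota>\<^sub>B f \<in> B.PD" and v: "v = (\<iota>\<^sub>A f, inv\<^bsub>B\<^esub> \<iota>\<^sub>B f)"
    unfolding R_def by blast
  have "inv\<^bsub>B\<^esub> \<iota>\<^sub>B e \<in> center B" using e B.PD_central by auto
  then have "inv\<^bsub>B\<^esub> \<iota>\<^sub>B e \<otimes>\<^bsub>B\<^esub> inv\<^bsub>B\<^esub> \<iota>\<^sub>B f = inv\<^bsub>B\<^esub> \<iota>\<^sub>B f \<otimes>\<^bsub>B\<^esub> inv\<^bsub>B\<^esub> \<iota>\<^sub>B e"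
    using f by (intro B.centerD) simp_all
  then have "u \<otimes>\<^bsub>P\<^esub> v = (\<iota>\<^sub>A (e \<otimes>\<^bsub>D\<^esub> f), inv\<^bsub>B\<^esub> \<iota>\<^sub>B (e \<otimes>\<^bsub>D\<^esub> f))"
    using e f u v by (simp add: mult_P B.inv_mult_group)
  moreover have "\<iota>\<^sub>A (e \<otimes>\<^bsub>D\<^esub> f) \<in> A.PD" "\<iota>\<^sub>B (e \<otimes>\<^bsub>D\<^esub> f) \<in> B.PD" using e f by simp_all
  ultimately show "u \<otimes>\<^bsub>P\<^esub> v \<in> R" unfolding R_def using D.m_closed[OF e(1) f(1)] by blast
qed

sublocale R: normal R P using R_subgroup by (simp add: P.normal_iff_subgroup)
sublocale X: comm_group X by (rule A.quotient_comm_group)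
sublocale Y: comm_group Y by (rule B.quotient_comm_group)
sublocale W: comm_group W by (rule P.abelian_FactGroup[OF R_subgroup])

lemma w_closed: "x \<in> A.PD \<Longrightarrow> y \<in> B.PD \<Longrightarrow> w x y \<in> carrier W"
  by (auto simp: w_def carrier_FactGroup carrier_P)

lemma w_mult:
  "x \<in> A.PD \<Longrightarrow> y \<in> B.PD \<Longrightarrow> x' \<in> A.PD \<Longrightarrow> y' \<in> B.PD \<Longrightarrow>
   w (x \<otimes>\<^bsub>A\<^esub> x') (y \<otimes>\<^bsub>B\<^esub> y') = w x y \<otimes>\<^bsub>W\<^esub> w x' y'"
  by (simp add: w_def R.rcos_sum carrier_P mult_P)

lemma w_mult_left:
  "x \<in> A.PD \<Longrightarrow> x' \<in> A.PD \<Longrightarrow> w (x \<otimes>\<^bsub>A\<^esub> x') \<one>\<^bsub>B\<^esub> = w x \<one>\<^bsub>B\<^esub> \<otimes>\<^bsub>W\<^esub> w x' \<one>\<^bsub>B\<^esub>"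
  using w_mult[of x "\<one>\<^bsub>B\<^esub>" x' "\<one>\<^bsub>B\<^esub>"] by simp

lemma w_mult_right:
  "y \<in> B.PD \<Longrightarrow> y' \<in> B.PD \<Longrightarrow> w \<one>\<^bsub>A\<^esub> (y \<otimes>\<^bsub>B\<^esub> y') = w \<one>\<^bsub>A\<^esub> y \<otimes>\<^bsub>W\<^esub> w \<one>\<^bsub>A\<^esub> y'"
  using w_mult[of "\<one>\<^bsub>A\<^esub>" y "\<one>\<^bsub>A\<^esub>" y'] by simp

lemma w_eq_one_iff:
  "x \<in> A.PD \<Longrightarrow> y \<in> B.PD \<Longrightarrow> w x y = \<one>\<^bsub>W\<^esub> \<longleftrightarrow> (x, y) \<in> R"
  using R.coset_eq_self_iff[of "(x, y)"] by (simp add: w_def carrier_P)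

lemma w_glue:
  assumes "e \<in> carrier D" "\<iota>\<^sub>A e \<in> A.PD" "\<iota>\<^sub>B e \<in> B.PD"
  shows "w \<one>\<^bsub>A\<^esub> (\<iota>\<^sub>B e) = w (\<iota>\<^sub>A e) \<one>\<^bsub>B\<^esub>"
proof -
  have "(\<iota>\<^sub>A e, inv\<^bsub>B\<^esub> \<iota>\<^sub>B e) \<in> R" unfolding R_def using assms by blast
  then have "w (\<iota>\<^sub>A e) (inv\<^bsub>B\<^esub> \<iota>\<^sub>B e) = \<one>\<^bsub>W\<^esub>" using assms by (subst w_eq_one_iff) simp_all
  then have "w (\<iota>\<^sub>A e) \<one>\<^bsub>B\<^esub> = \<one>\<^bsub>W\<^esub> \<otimes>\<^bsub>W\<^esub> w \<one>\<^bsub>A\<^esub> (\<iota>\<^sub>B e)"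
    using w_mult[of "\<iota>\<^sub>A e" "inv\<^bsub>B\<^esub> \<iota>\<^sub>B e" "\<one>\<^bsub>A\<^esub>" "\<iota>\<^sub>B e"] assms by simp
  also have "\<dots> = w \<one>\<^bsub>A\<^esub> (\<iota>\<^sub>B e)" using assms by (intro W.l_one w_closed) simp_all
  finally show ?thesis by simp
qed

lemma w_pow: "x \<in> A.PD \<Longrightarrow> y \<in> B.PD \<Longrightarrow> w x y [^]\<^bsub>W\<^esub> (k::nat) = w (x [^]\<^bsub>A\<^esub> k) (y [^]\<^bsub>B\<^esub> k)"
proof (induction k)
  case 0
  then show ?case using R.coset_eq_self_iff[OF P.one_closed] by (simp add: w_def one_P[symmetric])
next
  case (Suc k)
  have "x [^]\<^bsub>A\<^esub> k \<in> A.PD" "y [^]\<^bsub>B\<^esub> k \<in> B.PD"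
    using Suc.prems by (induction k) simp_all
  then show ?case using Suc by (simp add: w_mult del: mult_FactGroup)
qed

section \<open>The commutator pairings with values in \<open>W\<close>\<close>

definition p where "p d = A.PD #>\<^bsub>A\<^esub> \<iota>\<^sub>A d"
definition r where "r d = B.PD #>\<^bsub>B\<^esub> \<iota>\<^sub>B d"
text \<open>The argument is a coset, so a representative has to be chosen; the coset lemmas below
  show that the choice does not affect the value. The order of the entries in \<alpha> and \<gamma>
  follows \<open>[a, b]\<close> with \<open>a\<close> from \<open>A\<close> and \<open>b\<close>
  from \<open>B\<close>, an element of \<open>D\<close> standing in for the other side.\<close>

definition \<alpha> where
  "\<alpha> u d = w (commutator A (SOME a. a \<in> carrier A \<and> A.PD #>\<^bsub>A\<^esub> a = u) (\<iota>\<^sub>A d)) \<one>\<^bsub>B\<^esub>"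
definition \<gamma> where
  "\<gamma> d u = w \<one>\<^bsub>A\<^esub> (commutator B (\<iota>\<^sub>B d) (SOME b. b \<in> carrier B \<and> B.PD #>\<^bsub>B\<^esub> b = u))"

lemma \<alpha>_coset:
  assumes "a \<in> carrier A" "d \<in> carrier D"
  shows "\<alpha> (A.PD #>\<^bsub>A\<^esub> a) d = w (commutator A a (\<iota>\<^sub>A d)) \<one>\<^bsub>B\<^esub>"
proof -
  define a' where "a' = (SOME a'. a' \<in> carrier A \<and> A.PD #>\<^bsub>A\<^esub> a' = A.PD #>\<^bsub>A\<^esub> a)"
  have "a' \<in> carrier A \<and> A.PD #>\<^bsub>A\<^esub> a' = A.PD #>\<^bsub>A\<^esub> a"
    unfolding a'_def by (rule someI[of _ a]) (simp add: assms)
  then have "commutator A a' (\<iota>\<^sub>A d) = commutator A a (\<iota>\<^sub>A d)"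
    using assms by (intro A.commutator_coset_cong) simp_all
  then show ?thesis unfolding \<alpha>_def a'_def by simp
qed

lemma \<gamma>_coset:
  assumes "b \<in> carrier B" "d \<in> carrier D"
  shows "\<gamma> d (B.PD #>\<^bsub>B\<^esub> b) = w \<one>\<^bsub>A\<^esub> (commutator B (\<iota>\<^sub>B d) b)"
proof -
  define b' where "b' = (SOME b'. b' \<in> carrier B \<and> B.PD #>\<^bsub>B\<^esub> b' = B.PD #>\<^bsub>B\<^esub> b)"
  have b': "b' \<in> carrier B \<and> B.PD #>\<^bsub>B\<^esub> b' = B.PD #>\<^bsub>B\<^esub> b"
    unfolding b'_def by (rule someI[of _ b]) (simp add: assms)
  then have "commutator B b' (\<iota>\<^sub>B d) = commutator B b (\<iota>\<^sub>B d)"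
    using assms by (intro B.commutator_coset_cong) simp_all
  then have "commutator B (\<iota>\<^sub>B d) b' = commutator B (\<iota>\<^sub>B d) b"
    using B.commutator_swap[of b' "\<iota>\<^sub>B d"] B.commutator_swap[of b "\<iota>\<^sub>B d"] assms b' by simp
  then show ?thesis unfolding \<gamma>_def b'_def by simp
qed

lemma X_cases:
  assumes "u \<in> carrier X"
  obtains a where "a \<in> carrier A" "u = A.PD #>\<^bsub>A\<^esub> a"
  using assms by (auto simp: carrier_FactGroup)

lemma Y_cases:
  assumes "u \<in> carrier Y"
  obtains b where "b \<in> carrier B" "u = B.PD #>\<^bsub>B\<^esub> b"
  using assms by (auto simp: carrier_FactGroup)

lemma \<alpha>_hom_left:
  assumes d: "d \<in> carrier D"
  shows "(\<lambda>x. \<alpha> x d) \<in> hom X W"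
proof (rule homI)
  fix u assume "u \<in> carrier X"
  then obtain a where "a \<in> carrier A" "u = A.PD #>\<^bsub>A\<^esub> a" by (rule X_cases)
  then show "\<alpha> u d \<in> carrier W" using d by (simp add: \<alpha>_coset w_closed A.commutator_in_power_derived)
next
  fix u v assume "u \<in> carrier X" "v \<in> carrier X"
  then obtain a b where a: "a \<in> carrier A" "u = A.PD #>\<^bsub>A\<^esub> a" and b: "b \<in> carrier A" "v = A.PD #>\<^bsub>A\<^esub> b"
    by (metis X_cases)
  have "\<alpha> (u \<otimes>\<^bsub>X\<^esub> v) d = \<alpha> (A.PD #>\<^bsub>A\<^esub> (a \<otimes>\<^bsub>A\<^esub> b)) d" using a b by (simp add: A.PD.rcos_sum)
  also have "\<dots> = w (commutator A a (\<iota>\<^sub>A d) \<otimes>\<^bsub>A\<^esub> commutator A b (\<iota>\<^sub>A d)) \<one>\<^bsub>B\<^esub>"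
    using a b d by (simp add: \<alpha>_coset A.commutator_mult_left)
  also have "\<dots> = \<alpha> u d \<otimes>\<^bsub>W\<^esub> \<alpha> v d"
    using a b d by (simp add: \<alpha>_coset A.commutator_in_power_derived w_mult_left del: mult_FactGroup)
  finally show "\<alpha> (u \<otimes>\<^bsub>X\<^esub> v) d = \<alpha> u d \<otimes>\<^bsub>W\<^esub> \<alpha> v d" .
qed

lemma \<alpha>_hom_right:
  assumes "u \<in> carrier X"
  shows "\<alpha> u \<in> hom D W"
proof -
  obtain a where a: "a \<in> carrier A" "u = A.PD #>\<^bsub>A\<^esub> a" using assms by (rule X_cases)
  show ?thesis
  proof (rule homI)
    fix d assume "d \<in> carrier D"
    then show "\<alpha> u d \<in> carrier W" using a by (simp add: \<alpha>_coset w_closed A.commutator_in_power_derived)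
  next
    fix d e assume "d \<in> carrier D" "e \<in> carrier D"
    then show "\<alpha> u (d \<otimes>\<^bsub>D\<^esub> e) = \<alpha> u d \<otimes>\<^bsub>W\<^esub> \<alpha> u e"
      using a by (simp add: \<alpha>_coset A.commutator_mult_right A.commutator_in_power_derived w_mult_left
          del: mult_FactGroup)
  qed
qed

lemma \<gamma>_hom_right:
  assumes d: "d \<in> carrier D"
  shows "\<gamma> d \<in> hom Y W"
proof (rule homI)
  fix u assume "u \<in> carrier Y"
  then obtain a where "a \<in> carrier B" "u = B.PD #>\<^bsub>B\<^esub> a" by (rule Y_cases)
  then show "\<gamma> d u \<in> carrier W" using d by (simp add: \<gamma>_coset w_closed B.commutator_in_power_derived)
next
  fix u v assume "u \<in> carrier Y" "v \<in> carrier Y"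
  then obtain a b where a: "a \<in> carrier B" "u = B.PD #>\<^bsub>B\<^esub> a" and b: "b \<in> carrier B" "v = B.PD #>\<^bsub>B\<^esub> b"
    by (metis Y_cases)
  have "\<gamma> d (u \<otimes>\<^bsub>Y\<^esub> v) = \<gamma> d (B.PD #>\<^bsub>B\<^esub> (a \<otimes>\<^bsub>B\<^esub> b))" using a b by (simp add: B.PD.rcos_sum)
  also have "\<dots> = w \<one>\<^bsub>A\<^esub> (commutator B (\<iota>\<^sub>B d) a \<otimes>\<^bsub>B\<^esub> commutator B (\<iota>\<^sub>B d) b)"
    using a b d by (simp add: \<gamma>_coset B.commutator_mult_right)
  also have "\<dots> = \<gamma> d u \<otimes>\<^bsub>W\<^esub> \<gamma> d v"
    using a b d by (simp add: \<gamma>_coset B.commutator_in_power_derived w_mult_right del: mult_FactGroup)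
  finally show "\<gamma> d (u \<otimes>\<^bsub>Y\<^esub> v) = \<gamma> d u \<otimes>\<^bsub>W\<^esub> \<gamma> d v" .
qed

lemma \<gamma>_hom_left:
  assumes "u \<in> carrier Y"
  shows "(\<lambda>d. \<gamma> d u) \<in> hom D W"
proof -
  obtain b where b: "b \<in> carrier B" "u = B.PD #>\<^bsub>B\<^esub> b" using assms by (rule Y_cases)
  show ?thesis
  proof (rule homI)
    fix d assume "d \<in> carrier D"
    then show "\<gamma> d u \<in> carrier W" using b by (simp add: \<gamma>_coset w_closed B.commutator_in_power_derived)
  next
    fix d e assume "d \<in> carrier D" "e \<in> carrier D"
    then show "\<gamma> (d \<otimes>\<^bsub>D\<^esub> e) u = \<gamma> d u \<otimes>\<^bsub>W\<^esub> \<gamma> e u"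
      using b by (simp add: \<gamma>_coset B.commutator_mult_left B.commutator_in_power_derived w_mult_right
          del: mult_FactGroup)
  qed
qed

lemma p_hom: "p \<in> hom D X"
  by (rule homI) (auto simp: p_def A.PD.rcos_sum carrier_FactGroup)

lemma r_hom: "r \<in> hom D Y"
  by (rule homI) (auto simp: r_def B.PD.rcos_sum carrier_FactGroup)

sublocale p: group_hom D X p by unfold_locales (rule p_hom)
sublocale r: group_hom D Y r by unfold_locales (rule r_hom)

text \<open>Condition (a) at work: if \<open>p d = p e\<close>, then the quotient of
  \<open>d\<close> by \<open>e\<close> maps into \<open>A.PD\<close>, so its image in
  \<open>B\<close> is central and drops out of the commutator. The statement for \<alpha> uses the
  other half of (a).\<close>

lemma \<gamma>_cong:
  assumes d: "d \<in> carrier D" and e: "e \<in> carrier D" and u: "u \<in> carrier Y" and eq: "p d = p e"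
  shows "\<gamma> d u = \<gamma> e u"
proof -
  obtain b where b: "b \<in> carrier B" "u = B.PD #>\<^bsub>B\<^esub> b" using u by (rule Y_cases)
  let ?f = "d \<otimes>\<^bsub>D\<^esub> inv\<^bsub>D\<^esub> e"
  have "p ?f = \<one>\<^bsub>X\<^esub>" using d e eq by (simp del: mult_FactGroup one_FactGroup)
  then have "\<iota>\<^sub>A ?f \<in> A.PD" using d e A.PD.coset_eq_self_iff[of "\<iota>\<^sub>A ?f"] by (simp add: p_def)
  then have "\<iota>\<^sub>B ?f \<in> center B" using d e by (intro central_B) simp_all
  then have c: "commutator B (\<iota>\<^sub>B ?f) b = \<one>\<^bsub>B\<^esub>" using b(1) by (rule B.commutator_center_left)
  have f: "\<iota>\<^sub>B ?f \<otimes>\<^bsub>B\<^esub> \<iota>\<^sub>B e = \<iota>\<^sub>B d" using d e by (simp add: B.m_assoc)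
  have "commutator B (\<iota>\<^sub>B ?f \<otimes>\<^bsub>B\<^esub> \<iota>\<^sub>B e) b = commutator B (\<iota>\<^sub>B ?f) b \<otimes>\<^bsub>B\<^esub> commutator B (\<iota>\<^sub>B e) b"
    using d e b by (intro B.commutator_mult_left) simp_all
  then have "commutator B (\<iota>\<^sub>B d) b = commutator B (\<iota>\<^sub>B e) b"
    unfolding f c using e b by simp
  then show ?thesis using b d e by (simp add: \<gamma>_coset)
qed

lemma \<alpha>_cong:
  assumes d: "d \<in> carrier D" and e: "e \<in> carrier D" and u: "u \<in> carrier X" and eq: "r d = r e"
  shows "\<alpha> u d = \<alpha> u e"
proof -
  obtain a where a: "a \<in> carrier A" "u = A.PD #>\<^bsub>A\<^esub> a" using u by (rule X_cases)
  let ?f = "d \<otimes>\<^bsub>D\<^esub> inv\<^bsub>D\<^esub> e"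
  have "r ?f = \<one>\<^bsub>Y\<^esub>" using d e eq by (simp del: mult_FactGroup one_FactGroup)
  then have "\<iota>\<^sub>B ?f \<in> B.PD" using d e B.PD.coset_eq_self_iff[of "\<iota>\<^sub>B ?f"] by (simp add: r_def)
  then have "\<iota>\<^sub>A ?f \<in> center A" using d e by (intro central_A) simp_all
  then have c: "commutator A a (\<iota>\<^sub>A ?f) = \<one>\<^bsub>A\<^esub>" using a(1) by (rule A.commutator_center_right)
  have f: "\<iota>\<^sub>A ?f \<otimes>\<^bsub>A\<^esub> \<iota>\<^sub>A e = \<iota>\<^sub>A d" using d e by (simp add: A.m_assoc)
  have "commutator A a (\<iota>\<^sub>A ?f \<otimes>\<^bsub>A\<^esub> \<iota>\<^sub>A e) = commutator A a (\<iota>\<^sub>A ?f) \<otimes>\<^bsub>A\<^esub> commutator A a (\<iota>\<^sub>A e)"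
    using d e a by (intro A.commutator_mult_right) simp_all
  then have "commutator A a (\<iota>\<^sub>A d) = commutator A a (\<iota>\<^sub>A e)"
    unfolding f c using e a by simp
  then show ?thesis using a d e by (simp add: \<alpha>_coset)
qed

text \<open>Lifting the equations from the quotients to \<open>A\<close> and \<open>B\<close> gives
  the elements \<open>a^q a'\<close> and \<open>b^q b'\<close> of condition (b). The two commutators
  live in different groups, and their values in \<open>W\<close> can be compared only through a
  common element \<open>f\<close> of \<open>D\<close>; this is where the membership in
  \<open>D\<close> in (b) is essential.\<close>

lemma balance:
  assumes q: "q > 0" "q dvd n" and u: "u \<in> carrier X" and v: "v \<in> carrier Y"
    and d: "d \<in> carrier D" and e: "e \<in> carrier D" and pd: "p d = u [^]\<^bsub>X\<^esub> q" and re: "r e = v [^]\<^bsub>Y\<^esub> q"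
  shows "\<gamma> d v = \<alpha> u e"
proof -
  obtain a where a: "a \<in> carrier A" "u = A.PD #>\<^bsub>A\<^esub> a" using u by (rule X_cases)
  obtain b where b: "b \<in> carrier B" "v = B.PD #>\<^bsub>B\<^esub> b" using v by (rule Y_cases)
  have "A.PD #>\<^bsub>A\<^esub> (a [^]\<^bsub>A\<^esub> q) = A.PD #>\<^bsub>A\<^esub> \<iota>\<^sub>A d"
    using pd unfolding p_def a(2) A.PD.FactGroup_pow[OF a(1)] by (rule sym)
  then obtain a' where a': "a' \<in> A.PD" "\<iota>\<^sub>A d = a [^]\<^bsub>A\<^esub> q \<otimes>\<^bsub>A\<^esub> a'"
    by (rule A.coset_eqD[OF A.nat_pow_closed[OF a(1)] \<iota>\<^sub>A.hom_closed[OF d]])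
  have "B.PD #>\<^bsub>B\<^esub> (b [^]\<^bsub>B\<^esub> q) = B.PD #>\<^bsub>B\<^esub> \<iota>\<^sub>B e"
    using re unfolding r_def b(2) B.PD.FactGroup_pow[OF b(1)] by (rule sym)
  then obtain b' where b': "b' \<in> B.PD" "\<iota>\<^sub>B e = b [^]\<^bsub>B\<^esub> q \<otimes>\<^bsub>B\<^esub> b'"
    by (rule B.coset_eqD[OF B.nat_pow_closed[OF b(1)] \<iota>\<^sub>B.hom_closed[OF e]])
  obtain f where f: "f \<in> carrier D" "\<iota>\<^sub>B f = commutator B (\<iota>\<^sub>B d) b" "\<iota>\<^sub>A f = commutator A a (\<iota>\<^sub>A e)"
    using commutators[OF q a(1) a'(1) b(1) b'(1) d e a'(2) b'(2)] by blast
  have "w \<one>\<^bsub>A\<^esub> (\<iota>\<^sub>B f) = w (\<iota>\<^sub>A f) \<one>\<^bsub>B\<^esub>"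
    using f a b d e by (intro w_glue) (simp_all add: A.commutator_in_power_derived B.commutator_in_power_derived)
  then show ?thesis using a b d e f by (simp add: \<alpha>_coset \<gamma>_coset)
qed

sublocale pairings: balanced_pairings X Y W D p r \<alpha> \<gamma>
  by (rule balanced_pairingsI[where n = n])
    (fact X.comm_group_axioms Y.comm_group_axioms W.comm_group_axioms D.is_group p_hom r_hom
      \<alpha>_hom_left \<alpha>_hom_right \<gamma>_hom_left \<gamma>_hom_right A.quotient_exponent B.quotient_exponent
      \<gamma>_cong \<alpha>_cong balance)+

text \<open>The type is that of cosets of \<open>N\<close> in triples from \<open>A\<close>,
  \<open>B\<close> and \<open>V\<close>, with \<open>V\<close> in turn made of cosets of pairs.
  Divisibility of \<open>m choose 2\<close> serves the power formula in \<open>K\<close>,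
  divisibility of \<open>m\<close> the exponent of \<open>V\<close>.\<close>

theorem strong_embedding_exists:
  assumes "n dvd m choose 2" "n dvd m"
  shows "\<exists>(M :: ('a \<times> 'b \<times> (('a \<times> 'b) set \<times> ('a set \<Rightarrow> 'b set)) set) set monoid) \<phi>\<^sub>A \<phi>\<^sub>B.
    strong_embedding m n A B D \<iota>\<^sub>A \<iota>\<^sub>B M \<phi>\<^sub>A \<phi>\<^sub>B"
proof (rule pairings.common_extension)
  fix V :: "(('a \<times> 'b) set \<times> ('a set \<Rightarrow> 'b set)) set monoid" and j \<beta>
  assume V: "comm_group V" and j: "j \<in> mon W V"
      and \<beta>_left: "\<And>y. y \<in> carrier Y \<Longrightarrow> (\<lambda>x. \<beta> x y) \<in> hom X V"
      and \<beta>_right: "\<And>x. x \<in> carrier X \<Longrightarrow> \<beta> x \<in> hom Y V"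
      and \<beta>_r: "\<And>x d. x \<in> carrier X \<Longrightarrow> d \<in> carrier D \<Longrightarrow> \<beta> x (r d) = j (\<alpha> x d)"
      and \<beta>_p: "\<And>d y. d \<in> carrier D \<Longrightarrow> y \<in> carrier Y \<Longrightarrow> \<beta> (p d) y = j (\<gamma> d y)"
      and V_exp: "\<And>k::nat. (\<forall>w\<in>carrier W. w [^]\<^bsub>W\<^esub> k = \<one>\<^bsub>W\<^esub>) \<Longrightarrow>
        (\<forall>y\<in>carrier Y. y [^]\<^bsub>Y\<^esub> k = \<one>\<^bsub>Y\<^esub>) \<Longrightarrow> \<forall>v\<in>carrier V. v [^]\<^bsub>V\<^esub> k = \<one>\<^bsub>V\<^esub>"
  interpret V: comm_group V by (rule V)
  interpret j: group_hom W V j using j by unfold_locales (simp add: mon_def)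
  have quotA: "A.PD #>\<^bsub>A\<^esub> a \<in> carrier X" if "a \<in> carrier A" for a
    using that by (auto simp: carrier_FactGroup)
  have quotB: "B.PD #>\<^bsub>B\<^esub> b \<in> carrier Y" if "b \<in> carrier B" for b
    using that by (auto simp: carrier_FactGroup)
  have "u [^]\<^bsub>W\<^esub> m = \<one>\<^bsub>W\<^esub>" if u: "u \<in> carrier W" for u
  proof -
    obtain x y where xy: "x \<in> A.PD" "y \<in> B.PD" "u = w x y"
      using u by (auto simp: carrier_FactGroup carrier_P w_def)
    \<comment> \<open>The exponent 0 on the right lets \<open>w_pow\<close> rewrite both sides to
      the class of the pair of identities.\<close>
    then have "u [^]\<^bsub>W\<^esub> m = w x y [^]\<^bsub>W\<^esub> (0::nat)"
      by (simp only: w_pow A.pow_exponent B.pow_exponent A.PD_carrier B.PD_carrier A.nat_pow_0 B.nat_pow_0)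
    then show ?thesis by simp
  qed
  moreover have "y [^]\<^bsub>Y\<^esub> m = \<one>\<^bsub>Y\<^esub>" if "y \<in> carrier Y" for y
  proof -
    obtain k where k: "m = n * k" using assms(2) by blast
    have "y [^]\<^bsub>Y\<^esub> m = (y [^]\<^bsub>Y\<^esub> n) [^]\<^bsub>Y\<^esub> k" unfolding k by (rule Y.nat_pow_pow[OF that, symmetric])
    also have "\<dots> = \<one>\<^bsub>Y\<^esub>" unfolding B.quotient_exponent[OF that] by (rule Y.nat_pow_one)
    finally show ?thesis .
  qed
  ultimately have V_exp_m: "v [^]\<^bsub>V\<^esub> m = \<one>\<^bsub>V\<^esub>" if "v \<in> carrier V" for v
    using V_exp[of m] that by blast
  define z\<^sub>A where "z\<^sub>A x = j (w x \<one>\<^bsub>B\<^esub>)" for x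
  define z\<^sub>B where "z\<^sub>B y = j (w \<one>\<^bsub>A\<^esub> y)" for y
  \<comment> \<open>Inflation of \<beta> along the two quotient maps, which makes it trivial as soon
    as one argument lies in \<open>A.PD\<close> or \<open>B.PD\<close>.\<close>
  define \<beta>' where "\<beta>' a b = \<beta> (A.PD #>\<^bsub>A\<^esub> a) (B.PD #>\<^bsub>B\<^esub> b)" for a b
  interpret amalgam_pairing A B D V m n \<iota>\<^sub>A \<iota>\<^sub>B z\<^sub>A z\<^sub>B \<beta>'
  proof unfold_locales
    show "\<iota>\<^sub>A \<in> mon D A" "\<iota>\<^sub>B \<in> mon D B" by (fact \<iota>\<^sub>A \<iota>\<^sub>B)+
    show "n dvd m choose 2" by fact
    show "v [^]\<^bsub>V\<^esub> m = \<one>\<^bsub>V\<^esub>" if "v \<in> carrier V" for v by (rule V_exp_m[OF that])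
    show "z\<^sub>A \<in> hom (A\<lparr>carrier := A.PD\<rparr>) V"
    proof (rule homI)
      fix x y assume "x \<in> carrier (A\<lparr>carrier := A.PD\<rparr>)" "y \<in> carrier (A\<lparr>carrier := A.PD\<rparr>)"
      then show "z\<^sub>A (x \<otimes>\<^bsub>A\<lparr>carrier := A.PD\<rparr>\<^esub> y) = z\<^sub>A x \<otimes>\<^bsub>V\<^esub> z\<^sub>A y"
        using j.hom_mult[of "w x \<one>\<^bsub>B\<^esub>" "w y \<one>\<^bsub>B\<^esub>"] by (simp add: z\<^sub>A_def w_mult_left w_closed)
    qed (simp add: z\<^sub>A_def w_closed)
    show "z\<^sub>B \<in> hom (B\<lparr>carrier := B.PD\<rparr>) V"
    proof (rule homI)
      fix x y assume "x \<in> carrier (B\<lparr>carrier := B.PD\<rparr>)" "y \<in> carrier (B\<lparr>carrier := B.PD\<rparr>)"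
      then show "z\<^sub>B (x \<otimes>\<^bsub>B\<lparr>carrier := B.PD\<rparr>\<^esub> y) = z\<^sub>B x \<otimes>\<^bsub>V\<^esub> z\<^sub>B y"
        using j.hom_mult[of "w \<one>\<^bsub>A\<^esub> x" "w \<one>\<^bsub>A\<^esub> y"] by (simp add: z\<^sub>B_def w_mult_right w_closed)
    qed (simp add: z\<^sub>B_def w_closed)
    \<comment> \<open>Injectivity of \<open>j\<close> brings the equation back to \<open>W\<close>,
      where it says that \<open>(x, y)\<close> belongs to \<open>R\<close>.\<close>
    show "\<exists>e\<in>carrier D. x = \<iota>\<^sub>A e \<and> y = inv\<^bsub>B\<^esub> \<iota>\<^sub>B e"
      if x: "x \<in> A.PD" and y: "y \<in> B.PD" and eq: "z\<^sub>A x \<otimes>\<^bsub>V\<^esub> z\<^sub>B y = \<one>\<^bsub>V\<^esub>" for x y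
    proof -
      have "z\<^sub>A x \<otimes>\<^bsub>V\<^esub> z\<^sub>B y = j (w x \<one>\<^bsub>B\<^esub> \<otimes>\<^bsub>W\<^esub> w \<one>\<^bsub>A\<^esub> y)"
        unfolding z\<^sub>A_def z\<^sub>B_def using x y by (intro j.hom_mult[symmetric] w_closed) simp_all
      also have "w x \<one>\<^bsub>B\<^esub> \<otimes>\<^bsub>W\<^esub> w \<one>\<^bsub>A\<^esub> y = w x y"
        using w_mult[of x "\<one>\<^bsub>B\<^esub>" "\<one>\<^bsub>A\<^esub>" y] x y by simp
      finally have "j (w x y) = \<one>\<^bsub>V\<^esub>" using eq by simp
      then have "w x y = \<one>\<^bsub>W\<^esub>"
        using j j.inj_on_one_iff w_closed[OF x y] unfolding mon_def by blast
      then have "(x, y) \<in> R" using w_eq_one_iff[OF x y] by blast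
      then show ?thesis unfolding R_def by blast
    qed
    show "(\<lambda>a. \<beta>' a b) \<in> hom A V" if b: "b \<in> carrier B" for b
      using hom_compose[OF A.PD.r_coset_hom_Mod \<beta>_left[OF quotB[OF b]]] by (simp add: \<beta>'_def comp_def)
    show "\<beta>' a \<in> hom B V" if a: "a \<in> carrier A" for a
      using hom_compose[OF B.PD.r_coset_hom_Mod \<beta>_right[OF quotA[OF a]]] by (simp add: \<beta>'_def[abs_def] comp_def)
    show "\<beta>' a b = \<one>\<^bsub>V\<^esub>" if a: "a \<in> A.PD" and b: "b \<in> carrier B" for a b
      using hom_one[OF \<beta>_left[OF quotB[OF b]] X.is_group V.is_group] A.PD.coset_eq_self_iff[of a] a
      by (simp add: \<beta>'_def)
    show "\<beta>' a b = \<one>\<^bsub>V\<^esub>" if a: "a \<in> carrier A" and b: "b \<in> B.PD" for a b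
      using hom_one[OF \<beta>_right[OF quotA[OF a]] Y.is_group V.is_group] B.PD.coset_eq_self_iff[of b] b
      by (simp add: \<beta>'_def)
    show "\<beta>' a (\<iota>\<^sub>B d) = z\<^sub>A (commutator A a (\<iota>\<^sub>A d))" if "a \<in> carrier A" "d \<in> carrier D" for a d
      using \<beta>_r[OF quotA[OF that(1)] that(2)] that by (simp add: \<beta>'_def r_def z\<^sub>A_def \<alpha>_coset)
    show "\<beta>' (\<iota>\<^sub>A d) b = z\<^sub>B (commutator B (\<iota>\<^sub>B d) b)" if "b \<in> carrier B" "d \<in> carrier D" for b d
      using \<beta>_p[OF that(2) quotB[OF that(1)]] that by (simp add: \<beta>'_def p_def z\<^sub>B_def \<gamma>_coset)
  qed
  show ?thesis using strong_embedding_quotient by blast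
qed

end

text \<open>This is the purpose of the factor \<open>gcd 2 m\<close>: for even
  \<open>m = 2 t\<close> the number \<open>m choose 2\<close> is \<open>t (m - 1)\<close> and
  \<open>n\<close> divides \<open>t\<close>, while for odd \<open>m\<close> it is already a multiple
  of \<open>m\<close>.\<close>

lemma dvd_choose_two:
  fixes m n :: nat
  assumes "n dvd m div gcd 2 m"
  shows "n dvd m choose 2" "n dvd m"
proof -
  have *: "n dvd m \<and> n dvd m choose 2"
  proof (cases "even m")
    case True
    then obtain t where t: "m = 2 * t" by blast
    then have "n dvd t" using assms by simp
    moreover have "m choose 2 = t * (m - 1)" by (simp add: t choose_two)
    ultimately show ?thesis by (simp add: t)
  next
    case False
    then have "n dvd m" using assms by (simp add: coprime_left_2_iff_odd flip: coprime_iff_gcd_eq_1)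
    moreover obtain t where "m = 2 * t + 1" using False by (rule oddE)
    then have "m choose 2 = m * t" by (simp add: choose_two)
    ultimately show ?thesis by simp
  qed
  then show "n dvd m choose 2" "n dvd m" by blast+
qed

section \<open>Necessity of the two conditions\<close>

text \<open>Inside \<open>M\<close> both commutators become the \<open>q\<close>-th power of one
  commutator between the images of \<open>a\<close> and \<open>b\<close>, since \<open>a'\<close>
  and \<open>b'\<close> have central images.\<close>

lemma strong_embedding_commutators:
  assumes am: "amalgam m n A B D \<iota>\<^sub>A \<iota>\<^sub>B" and emb: "strong_embedding m n A B D \<iota>\<^sub>A \<iota>\<^sub>B M \<phi>\<^sub>A \<phi>\<^sub>B"
    and a: "a \<in> carrier A" "a' \<in> power_derived A n" and b: "b \<in> carrier B" "b' \<in> power_derived B n"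
    and d: "d \<in> carrier D" "\<iota>\<^sub>A d = a [^]\<^bsub>A\<^esub> q \<otimes>\<^bsub>A\<^esub> a'"
    and e: "e \<in> carrier D" "\<iota>\<^sub>B e = b [^]\<^bsub>B\<^esub> (q::nat) \<otimes>\<^bsub>B\<^esub> b'"
  shows "\<exists>f\<in>carrier D. \<iota>\<^sub>B f = commutator B (\<iota>\<^sub>B d) b \<and> \<iota>\<^sub>A f = commutator A a (\<iota>\<^sub>A e)"
proof -
  have varA: "in_variety m n A" and varB: "in_variety m n B" and varM: "in_variety m n M"
    and \<iota>\<^sub>A: "\<iota>\<^sub>A \<in> hom D A" and \<iota>\<^sub>B: "\<iota>\<^sub>B \<in> hom D B"
    and \<phi>\<^sub>A: "\<phi>\<^sub>A \<in> hom A M" "inj_on \<phi>\<^sub>A (carrier A)" and \<phi>\<^sub>B: "\<phi>\<^sub>B \<in> hom B M" "inj_on \<phi>\<^sub>B (carrier B)"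
    and agree: "\<And>d. d \<in> carrier D \<Longrightarrow> \<phi>\<^sub>A (\<iota>\<^sub>A d) = \<phi>\<^sub>B (\<iota>\<^sub>B d)"
    and inter: "\<phi>\<^sub>A ` carrier A \<inter> \<phi>\<^sub>B ` carrier B = \<phi>\<^sub>A ` \<iota>\<^sub>A ` carrier D"
    using am emb unfolding amalgam_def strong_embedding_def mon_def by blast+
  have grA: "group A" and grB: "group B" and grM: "group M"
    using varA varB varM unfolding in_variety_def by blast+
  interpret A: variety_group A m n by (intro variety_group.intro variety_group_axioms.intro grA varA)
  interpret B: variety_group B m n by (intro variety_group.intro variety_group_axioms.intro grB varB)
  interpret M: variety_group M m n by (intro variety_group.intro variety_group_axioms.intro grM varM)
  interpret \<phi>\<^sub>A: group_hom A M \<phi>\<^sub>A by unfold_locales (rule \<phi>\<^sub>A)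
  interpret \<phi>\<^sub>B: group_hom B M \<phi>\<^sub>B by unfold_locales (rule \<phi>\<^sub>B)
  have de: "\<iota>\<^sub>A d \<in> carrier A" "\<iota>\<^sub>B d \<in> carrier B" "\<iota>\<^sub>A e \<in> carrier A" "\<iota>\<^sub>B e \<in> carrier B"
    using hom_in_carrier[OF \<iota>\<^sub>A] hom_in_carrier[OF \<iota>\<^sub>B] d e by blast+
  have cA: "\<phi>\<^sub>A a' \<in> center M" by (rule power_derived_hom_central[OF grA varM \<phi>\<^sub>A(1) a(2)])
  have cB: "\<phi>\<^sub>B b' \<in> center M" by (rule power_derived_hom_central[OF grB varM \<phi>\<^sub>B(1) b(2)])
  have "\<phi>\<^sub>B (commutator B (\<iota>\<^sub>B d) b) = commutator M (\<phi>\<^sub>A a [^]\<^bsub>M\<^esub> q \<otimes>\<^bsub>M\<^esub> \<phi>\<^sub>A a') (\<phi>\<^sub>B b)"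
    using a b de by (simp add: \<phi>\<^sub>B.hom_commutator \<phi>\<^sub>A.hom_nat_pow agree[OF d(1), symmetric] d(2))
  also have "\<dots> = commutator M (\<phi>\<^sub>A a) (\<phi>\<^sub>B b) [^]\<^bsub>M\<^esub> q"
    using a b by (simp add: M.commutator_mult_left M.commutator_center_left[OF cA] M.commutator_pow_left)
  also have "\<dots> = commutator M (\<phi>\<^sub>A a) (\<phi>\<^sub>B b [^]\<^bsub>M\<^esub> q \<otimes>\<^bsub>M\<^esub> \<phi>\<^sub>B b')"
    using a b by (simp add: M.commutator_mult_right M.commutator_center_right[OF cB] M.commutator_pow_right)
  also have "\<dots> = \<phi>\<^sub>A (commutator A a (\<iota>\<^sub>A e))"
    using a b de by (simp add: \<phi>\<^sub>A.hom_commutator \<phi>\<^sub>B.hom_nat_pow agree[OF e(1)] e(2))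
  finally have eq: "\<phi>\<^sub>B (commutator B (\<iota>\<^sub>B d) b) = \<phi>\<^sub>A (commutator A a (\<iota>\<^sub>A e))" .
  \<comment> \<open>The common value lies in the images of both groups. Strength of the embedding is
    used here: the intersection of the images is the image of \<open>D\<close>.\<close>
  have "\<phi>\<^sub>A (commutator A a (\<iota>\<^sub>A e)) \<in> \<phi>\<^sub>A ` carrier A \<inter> \<phi>\<^sub>B ` carrier B"
    using a de by (intro IntI imageI) (simp, metis eq image_eqI b(1) B.commutator_closed)
  then obtain f where f: "f \<in> carrier D" "\<phi>\<^sub>A (commutator A a (\<iota>\<^sub>A e)) = \<phi>\<^sub>A (\<iota>\<^sub>A f)"
    unfolding inter by blast
  have "\<iota>\<^sub>A f = commutator A a (\<iota>\<^sub>A e)"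
    using inj_onD[OF \<phi>\<^sub>A(2) f(2)] a de hom_in_carrier[OF \<iota>\<^sub>A f(1)] by simp
  moreover have "\<iota>\<^sub>B f = commutator B (\<iota>\<^sub>B d) b"
    using inj_onD[OF \<phi>\<^sub>B(2), of "\<iota>\<^sub>B f" "commutator B (\<iota>\<^sub>B d) b"] eq f agree[OF f(1)] b de
      hom_in_carrier[OF \<iota>\<^sub>B f(1)] by simp
  ultimately show ?thesis using f(1) by blast
qed

text \<open>The image of \<open>A^n A'\<close> is central in all of \<open>M\<close>, and the
  injective map from \<open>B\<close> reflects centrality. Applied with \<open>A\<close> and
  \<open>B\<close> in both roles, this gives the two halves of condition (a).\<close>

lemma strong_embedding_central:
  assumes "in_variety m n A" "in_variety m n B" "in_variety m n M"
    and \<phi>\<^sub>A: "\<phi>\<^sub>A \<in> hom A M" and \<phi>\<^sub>B: "\<phi>\<^sub>B \<in> mon B M"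
    and x: "x \<in> power_derived A n" and y: "y \<in> carrier B" and eq: "\<phi>\<^sub>A x = \<phi>\<^sub>B y"
  shows "y \<in> center B"
proof -
  have gr: "group A" "group B" "group M" using assms(1-3) unfolding in_variety_def by blast+
  interpret B: group B by (rule gr)
  interpret M: variety_group M m n by (intro variety_group.intro variety_group_axioms.intro gr assms)
  interpret \<phi>\<^sub>B: group_hom B M \<phi>\<^sub>B using \<phi>\<^sub>B by unfold_locales (simp add: mon_def)
  have c: "\<phi>\<^sub>B y \<in> center M"
    using power_derived_hom_central[OF gr(1) assms(3) \<phi>\<^sub>A x] eq by simp
  show ?thesis
  proof (rule B.centerI[OF y])
    fix b assume b: "b \<in> carrier B"
    then have "\<phi>\<^sub>B (commutator B y b) = \<phi>\<^sub>B \<one>\<^bsub>B\<^esub>"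
      using y by (simp add: \<phi>\<^sub>B.hom_commutator M.commutator_center_left[OF c])
    then show "commutator B y b = \<one>\<^bsub>B\<^esub>"
      using \<phi>\<^sub>B y b by (intro inj_onD[of \<phi>\<^sub>B "carrier B"]) (simp_all add: mon_def)
  qed
qed

theorem theorem2p3:
  fixes m n :: nat
    and A :: "('a, 'x) monoid_scheme" and B :: "('b, 'y) monoid_scheme"
    and D :: "('d, 'z) monoid_scheme"
    and \<iota>\<^sub>A :: "'d \<Rightarrow> 'a" and \<iota>\<^sub>B :: "'d \<Rightarrow> 'b"
  assumes "n dvd m div gcd 2 m"
    and "amalgam m n A B D \<iota>\<^sub>A \<iota>\<^sub>B"
  shows "strongly_embeddable m n A B D \<iota>\<^sub>A \<iota>\<^sub>B \<longleftrightarrow>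
    ((\<forall>d \<in> carrier D. \<iota>\<^sub>A d \<in> power_derived A n \<longrightarrow> \<iota>\<^sub>B d \<in> center B) \<and>
     (\<forall>d \<in> carrier D. \<iota>\<^sub>B d \<in> power_derived B n \<longrightarrow> \<iota>\<^sub>A d \<in> center A)) \<and>
    (\<forall>q :: nat. q > 0 \<longrightarrow> q dvd n \<longrightarrow>
      (\<forall>a \<in> carrier A. \<forall>a' \<in> power_derived A n. \<forall>b \<in> carrier B. \<forall>b' \<in> power_derived B n.
       \<forall>d\<^sub>1 \<in> carrier D. \<forall>d\<^sub>2 \<in> carrier D.
         \<iota>\<^sub>A d\<^sub>1 = a [^]\<^bsub>A\<^esub> q \<otimes>\<^bsub>A\<^esub> a' \<longrightarrow> \<iota>\<^sub>B d\<^sub>2 = b [^]\<^bsub>B\<^esub> q \<otimes>\<^bsub>B\<^esub> b' \<longrightarrow>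
         (\<exists>d \<in> carrier D. \<iota>\<^sub>B d = commutator B (\<iota>\<^sub>B d\<^sub>1) b \<and> \<iota>\<^sub>A d = commutator A a (\<iota>\<^sub>A d\<^sub>2))))"
proof -
  have varA: "in_variety m n A" and varB: "in_variety m n B" and varD: "in_variety m n D"
    and \<iota>\<^sub>A: "\<iota>\<^sub>A \<in> mon D A" and \<iota>\<^sub>B: "\<iota>\<^sub>B \<in> mon D B"
    using assms(2) unfolding amalgam_def by blast+
  have gr: "group A" "group B" "group D"
    using varA varB varD unfolding in_variety_def by blast+
  show ?thesis
  proof (rule iffI, goal_cases)
    case 1
    then obtain M :: "('a + 'b) list monoid" and \<phi>\<^sub>A \<phi>\<^sub>B
      where emb: "strong_embedding m n A B D \<iota>\<^sub>A \<iota>\<^sub>B M \<phi>\<^sub>A \<phi>\<^sub>B"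
      unfolding strongly_embeddable_def by blast
    then have varM: "in_variety m n M" and \<phi>\<^sub>A: "\<phi>\<^sub>A \<in> mon A M" and \<phi>\<^sub>B: "\<phi>\<^sub>B \<in> mon B M"
      and agree: "\<And>d. d \<in> carrier D \<Longrightarrow> \<phi>\<^sub>A (\<iota>\<^sub>A d) = \<phi>\<^sub>B (\<iota>\<^sub>B d)"
      unfolding strong_embedding_def by blast+
    have homs: "\<phi>\<^sub>A \<in> hom A M" "\<phi>\<^sub>B \<in> hom B M" "\<iota>\<^sub>A \<in> hom D A" "\<iota>\<^sub>B \<in> hom D B"
      using \<phi>\<^sub>A \<phi>\<^sub>B \<iota>\<^sub>A \<iota>\<^sub>B unfolding mon_def by blast+
    have "\<iota>\<^sub>B d \<in> center B" if "d \<in> carrier D" "\<iota>\<^sub>A d \<in> power_derived A n" for d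
      by (rule strong_embedding_central[OF varA varB varM homs(1) \<phi>\<^sub>B that(2) hom_in_carrier[OF homs(4) that(1)]
            agree[OF that(1)]])
    moreover have "\<iota>\<^sub>A d \<in> center A" if "d \<in> carrier D" "\<iota>\<^sub>B d \<in> power_derived B n" for d
      by (rule strong_embedding_central[OF varB varA varM homs(2) \<phi>\<^sub>A that(2) hom_in_carrier[OF homs(3) that(1)]
            agree[OF that(1), symmetric]])
    ultimately show ?case
      by (intro conjI allI ballI impI) (assumption | rule strong_embedding_commutators[OF assms(2) emb])+
  next
    case conds: 2
    interpret compatible_amalgam A B D m n \<iota>\<^sub>A \<iota>\<^sub>B
    proof (intro compatible_amalgam.intro compatible_amalgam_axioms.intro variety_group.intro
        variety_group_axioms.intro gr varA varB \<iota>\<^sub>A \<iota>\<^sub>B)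
    qed (use conds in blast)+
    show ?case
      \<comment> \<open>The group constructed lives on a type of iterated cosets;
        \<open>strongly_embeddableI\<close> transports it to the type of words fixed in
        \<open>strongly_embeddable\<close>.\<close>
      using strong_embedding_exists[OF dvd_choose_two[OF assms(1)]] strongly_embeddableI[OF assms(2)]
      by blast
  qed
qed

end
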